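(* Let $d\ge1$, $0<\alpha<1$, $\varepsilon>0$, and let $\Omega\subset\mathbb{R}^d$ be a bounded open domain with $H^{\alpha/2}(\Omega)=\tilde H^{\alpha/2}(\Omega)$. Let $f\in H^{-\alpha/2}(\Omega)$ and let $u\in\tilde H^{\alpha/2}(\Omega)$ be the weak solution of $(-\Delta)^{\alpha/2}u=f$ in $\Omega$, $u=0$ in $\Omega^c$, i.e. $a(u,v)=(f,v)$ for all $v\in\tilde H^{\alpha/2}(\Omega)$. Consider a family of finite sets $X_\Omega\subset\Omega$ of distinct points, with mesh norms $h=\sup_{x\in\Omega}\min_{x_j\in X_\Omega}|x-x_j|$, associated generalized multiquadric trial spaces $V_N(\Omega)$, and Galerkin solutions $u_N\in V_N(\Omega)$, i.e. $a(u_N,v_N)=(f,v_N)$ for all $v_N\in V_N(\Omega)$. (i) Let $s\ge 0$ be such that $u\in H^s(\Omega)$ and assume that there is a constant $C_0$, independent of $h$, such that for all $X_\Omega$ in the family $$\inf_{v_N\in V_N(\Omega)}\|u-v_N\|_{H^{\alpha/2}(\Omega)}\le C_0\,h^{s-\alpha/2}\|u\|_{H^s(\Omega)}.$$ Then there is a constant $C$, independent of $h$, such that for all $X_\Omega$ in the family $$\|u-u_N\|_{H^{\alpha/2}(\Omega)}\le C\,h^{s-\alpha/2}\|u\|_{H^s(\Omega)}.$$ (ii) If the solution $u$ belongs to the native space $\mathcal{N}_\Phi(\Omega)$, then there is spectral convergence: with a constant $c>0$ independent of $h$, $$\inf_{v_N\in V_N(\Omega)}\|u-v_N\|_{H^{\alpha/2}(\Omega)}\le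 e^{-c/h}\|u\|_{\mathcal{N}_\Phi(\Omega)}.$$
   Context: Notation. $\Omega^c=\mathbb{R}^d\setminus\Omega$. For $0<s<1$, $H^s(\Omega)=\{v\in L^2(\Omega):\|v\|_{H^s(\Omega)}<\infty\}$ with $$\|v\|_{H^s(\Omega)}^2=\|v\|_{L^2(\Omega)}^2+|v|_{H^s(\Omega)}^2,\qquad |v|_{H^s(\Omega)}^2=\iint_{\Omega\times\Omega}\frac{(v(x)-v(y))^2}{|x-y|^{d+2s}}\,dx\,dy ;$$ for $s\ge 1$, $s=m+\sigma$ with $m$ an integer and $\sigma\in[0,1)$, $H^s(\Omega)$ is the usual Sobolev(-Slobodeckij) space of $v\in H^m(\Omega)$ with $D^\beta v\in H^\sigma(\Omega)$ for $|\beta|=m$, with $\|v\|_{H^s(\Omega)}^2=\|v\|_{H^m(\Omega)}^2+\sum_{|\beta|=m}|D^\beta v|_{H^\sigma(\Omega)}^2$ (for $\sigma=0$ just the norm of $H^m(\Omega)$); $H^0(\Omega)=L^2(\Omega)$. $\tilde H^s(\Omega)=\{v\in H^s(\Omega):\tilde v\in H^s(\mathbb{R}^d)\}$, where $\tilde v$ is the extension of $v$ by zero, with norm $\|\tilde v\|_{H^s(\mathbb{R}^d)}$. $H^s_0(\Omega)$ is the closure of $C_0^\infty(\Omega)$ in $H^s(\Omega)$, $H^{-s}(\Omega)$ is its dual, and $(\cdot,\cdot)$ denotes the $L^2(\Omega)$ inner product or its extension to the duality pairing. The paper uses as a standard fact that $H^s(\Omega)=H^s_0(\Omega)=\tilde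 H^s(\Omega)$ for $0<s<1/2$. Bilinear form. With $c_{d,\alpha}=\frac{2^{\alpha}\Gamma((\alpha+d)/2)}{\pi^{d/2}|\Gamma(-\alpha/2)|}$ and $\rho_\Omega(x)=c_{d,\alpha}\int_{\Omega^c}|x-y|^{-d-\alpha}\,dy$, $$a(u,v)=\frac{c_{d,\alpha}}{2}\iint_{\Omega\times\Omega}\frac{(u(x)-u(y))(v(x)-v(y))}{|x-y|^{d+\alpha}}\,dx\,dy+\int_\Omega\rho_\Omega(x)u(x)v(x)\,dx,$$ which is the weak form of the integral fractional Laplacian $(-\Delta)^{\alpha/2}u(x)=c_{d,\alpha}\int_{\mathbb{R}^d}\frac{u(x)-u(y)}{|x-y|^{d+\alpha}}\,dy$ acting on functions vanishing outside $\Omega$. Trial space. $V_N(\Omega)=\mathrm{Span}\{\phi_j:\ x_j\in X_\Omega\}$, where $\phi_j(x)=(\varepsilon^2+|x-x_j|^2)^{(\alpha-d)/2}$ for $x\in\Omega$ and $\varepsilon>0$ is the shape parameter. Native space. $\mathcal{N}_\Phi(\Omega)$ is the native space of the radial basis function, i.e. the reproducing kernel Hilbert space on $\Omega$ of the positive definite kernel $(x,y)\mapsto(\varepsilon^2+|x-y|^2)^{(\alpha-d)/2}$, with its Hilbert space norm.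
   Formalization: In (ii) the bound is stated only for sets with mesh norm h ≤ h₀, for some h₀>0 independent of h; for all h it is false (d=1, ε=1, α=1/4, Ω=(−R,R) with R large, X={0}, u=Φ(·−R/2)−Φ(·+R/2) with Φ the kernel: the infimum exceeds the native norm of u). *)

theory Defs
  imports "HOL-Analysis.Analysis"
begin

text \<open>
  A function on a subset \<open>\<Omega>\<close> of \<open>\<real>\<^sup>d\<close> is represented by a total function on \<open>real ^ 'n\<close>,
  with \<open>d = CARD('n)\<close>. Its values outside \<open>\<Omega>\<close> play no role, and elements of Lebesgue and Sobolev
  spaces are representatives of classes modulo equality almost everywhere on \<open>\<Omega>\<close>.
\<close>

section \<open>Test functions and weak derivatives\<close>

definition partial_deriv :: "'n::finite \<Rightarrow> (real ^ 'n \<Rightarrow> real) \<Rightarrow> real ^ 'n \<Rightarrow> real" where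
  "partial_deriv i \<phi> = (\<lambda>x. frechet_derivative \<phi> (at x) (axis i 1))"

definition iter_partial :: "'n::finite list \<Rightarrow> (real ^ 'n \<Rightarrow> real) \<Rightarrow> real ^ 'n \<Rightarrow> real" where
  "iter_partial js \<phi> = foldr partial_deriv js \<phi>"

definition smooth_fun :: "(real ^ 'n::finite \<Rightarrow> real) \<Rightarrow> bool" where
  "smooth_fun \<phi> \<longleftrightarrow> (\<forall>js x. iter_partial js \<phi> differentiable (at x))"

definition test_funs :: "(real ^ 'n::finite) set \<Rightarrow> (real ^ 'n \<Rightarrow> real) set" where
  "test_funs \<Omega> = {\<phi>. smooth_fun \<phi> \<and> compact (closure {x. \<phi> x \<noteq> 0}) \<and> closure {x. \<phi> x \<noteq> 0} \<subseteq> \<Omega>}"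

definition mi_order :: "('n::finite \<Rightarrow> nat) \<Rightarrow> nat" where
  "mi_order \<beta> = (\<Sum>i\<in>UNIV. \<beta> i)"

lemma finite_multi_indices: "finite {\<beta> :: 'n::finite \<Rightarrow> nat. mi_order \<beta> \<le> m}"
proof (rule finite_subset)
  show "{\<beta> :: 'n \<Rightarrow> nat. mi_order \<beta> \<le> m} \<subseteq> Pi\<^sub>E UNIV (\<lambda>_. {..m})"
  proof
    fix \<beta> :: "'n \<Rightarrow> nat" assume "\<beta> \<in> {\<beta>. mi_order \<beta> \<le> m}"
    then have "\<beta> i \<le> m" for i
      using member_le_sum[of i UNIV \<beta>] by (simp add: mi_order_def)
    then show "\<beta> \<in> Pi\<^sub>E UNIV (\<lambda>_. {..m})" by (simp add: PiE_iff extensional_def)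
  qed
  show "finite (Pi\<^sub>E (UNIV :: 'n set) (\<lambda>_. {..m}))"
    by (rule finite_PiE) simp_all
qed

definition L2_space :: "(real ^ 'n::finite) set \<Rightarrow> (real ^ 'n \<Rightarrow> real) set" where
  "L2_space \<Omega> = {v. v \<in> borel_measurable (lebesgue_on \<Omega>) \<and> integrable (lebesgue_on \<Omega>) (\<lambda>x. (v x)\<^sup>2)}"

text \<open>
  \<open>D\<^sup>\<beta> \<phi>\<close> of a test function is computed by differentiating along any list of directions in which
  the direction \<open>i\<close> occurs \<open>\<beta> i\<close> times; the order of the list is irrelevant since \<open>\<phi>\<close> is smooth.
\<close>

definition is_weak_deriv ::
  "(real ^ 'n::finite) set \<Rightarrow> ('n \<Rightarrow> nat) \<Rightarrow> (real ^ 'n \<Rightarrow> real) \<Rightarrow> (real ^ 'n \<Rightarrow> real) \<Rightarrow> bool" where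
  "is_weak_deriv \<Omega> \<beta> v w \<longleftrightarrow>
     (\<forall>\<phi>\<in>test_funs \<Omega>. \<forall>js. (\<forall>i. count_list js i = \<beta> i) \<longrightarrow>
        integral\<^sup>L (lebesgue_on \<Omega>) (\<lambda>x. v x * iter_partial js \<phi> x) =
        (- 1) ^ mi_order \<beta> * integral\<^sup>L (lebesgue_on \<Omega>) (\<lambda>x. w x * \<phi> x))"

text \<open>Weak derivatives are unique almost everywhere; \<open>D\<^sup>0 v\<close> is taken to be \<open>v\<close> itself.\<close>

definition weak_deriv ::
  "(real ^ 'n::finite) set \<Rightarrow> ('n \<Rightarrow> nat) \<Rightarrow> (real ^ 'n \<Rightarrow> real) \<Rightarrow> real ^ 'n \<Rightarrow> real" where
  "weak_deriv \<Omega> \<beta> v =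
     (if \<beta> = (\<lambda>_. 0) then v else (SOME w. w \<in> L2_space \<Omega> \<and> is_weak_deriv \<Omega> \<beta> v w))"


section \<open>Sobolev-Slobodeckij spaces\<close>

definition slobodeckij_sq :: "real \<Rightarrow> (real ^ 'n::finite) set \<Rightarrow> (real ^ 'n \<Rightarrow> real) \<Rightarrow> ennreal" where
  "slobodeckij_sq \<sigma> \<Omega> v =
     (\<integral>\<^sup>+ (x, y). ennreal ((v x - v y)\<^sup>2 / norm (x - y) powr (real CARD('n) + 2 * \<sigma>))
        \<partial>(lebesgue_on \<Omega> \<Otimes>\<^sub>M lebesgue_on \<Omega>))"

text \<open>For \<open>s \<ge> 0\<close>, the decomposition \<open>s = m + \<sigma>\<close> is \<open>m = nat \<lfloor>s\<rfloor>\<close>, \<open>\<sigma> = frac s\<close>.\<close>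

definition sobolev :: "real \<Rightarrow> (real ^ 'n::finite) set \<Rightarrow> (real ^ 'n \<Rightarrow> real) set" where
  "sobolev s \<Omega> = {v \<in> L2_space \<Omega>.
     (\<forall>\<beta>. mi_order \<beta> \<le> nat \<lfloor>s\<rfloor> \<longrightarrow> (\<exists>w\<in>L2_space \<Omega>. is_weak_deriv \<Omega> \<beta> v w)) \<and>
     (frac s > 0 \<longrightarrow>
       (\<forall>\<beta>. mi_order \<beta> = nat \<lfloor>s\<rfloor> \<longrightarrow> slobodeckij_sq (frac s) \<Omega> (weak_deriv \<Omega> \<beta> v) < \<infinity>))}"

definition sobolev_norm :: "real \<Rightarrow> (real ^ 'n::finite) set \<Rightarrow> (real ^ 'n \<Rightarrow> real) \<Rightarrow> real" where
  "sobolev_norm s \<Omega> v = sqrt (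
     (\<Sum>\<beta> | mi_order \<beta> \<le> nat \<lfloor>s\<rfloor>. integral\<^sup>L (lebesgue_on \<Omega>) (\<lambda>x. (weak_deriv \<Omega> \<beta> v x)\<^sup>2)) +
     (if frac s > 0
      then \<Sum>\<beta> | mi_order \<beta> = nat \<lfloor>s\<rfloor>. enn2real (slobodeckij_sq (frac s) \<Omega> (weak_deriv \<Omega> \<beta> v))
      else 0))"

lemma is_weak_deriv_0:
  fixes \<Omega> :: "(real ^ 'n::finite) set"
  shows "is_weak_deriv \<Omega> (\<lambda>_. 0) v v"
proof -
  have js: "js = []" if "\<forall>i. count_list js i = 0" for js :: "'n list"
  proof (cases js)
    case (Cons i ks)
    then show ?thesis using that[rule_format, of i] by simp
  qed
  show ?thesis
    unfolding is_weak_deriv_def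
  proof (intro ballI allI impI)
    fix \<phi> and js :: "'n list"
    assume "\<forall>i. count_list js i = 0"
    then have "js = []" by (rule js)
    then show "integral\<^sup>L (lebesgue_on \<Omega>) (\<lambda>x. v x * iter_partial js \<phi> x) =
        (- 1) ^ mi_order (\<lambda>_ :: 'n. 0) * integral\<^sup>L (lebesgue_on \<Omega>) (\<lambda>x. v x * \<phi> x)"
      by (simp add: iter_partial_def mi_order_def)
  qed
qed

text \<open>For \<open>0 < s < 1\<close> these are the fractional space and norm given by the double integral.\<close>

lemma
  fixes v :: "real ^ 'n::finite \<Rightarrow> real"
  assumes "0 < s" "s < 1"
  shows sobolev_fractional: "v \<in> sobolev s \<Omega> \<longleftrightarrow> v \<in> L2_space \<Omega> \<and> slobodeckij_sq s \<Omega> v < \<infinity>"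
    and sobolev_norm_fractional: "sobolev_norm s \<Omega> v =
      sqrt (integral\<^sup>L (lebesgue_on \<Omega>) (\<lambda>x. (v x)\<^sup>2) + enn2real (slobodeckij_sq s \<Omega> v))"
proof -
  have m: "\<lfloor>s\<rfloor> = 0" and \<sigma>: "frac s = s"
    using assms by (auto simp: frac_eq intro: floor_unique)
  have eq: "{\<beta> :: 'n \<Rightarrow> nat. mi_order \<beta> = 0} = {\<lambda>_. 0}"
    by (auto simp: mi_order_def)
  then have z: "mi_order \<beta> = 0 \<longleftrightarrow> \<beta> = (\<lambda>_. 0)" for \<beta> :: "'n \<Rightarrow> nat"
    by auto
  show "v \<in> sobolev s \<Omega> \<longleftrightarrow> v \<in> L2_space \<Omega> \<and> slobodeckij_sq s \<Omega> v < \<infinity>"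
    using assms is_weak_deriv_0[of \<Omega> v] by (auto simp: sobolev_def m \<sigma> z weak_deriv_def)
  show "sobolev_norm s \<Omega> v =
      sqrt (integral\<^sup>L (lebesgue_on \<Omega>) (\<lambda>x. (v x)\<^sup>2) + enn2real (slobodeckij_sq s \<Omega> v))"
    using assms by (simp add: sobolev_norm_def m \<sigma> z weak_deriv_def)
qed

definition zero_ext :: "'a set \<Rightarrow> ('a \<Rightarrow> real) \<Rightarrow> 'a \<Rightarrow> real" where
  "zero_ext \<Omega> v = (\<lambda>x. if x \<in> \<Omega> then v x else 0)"

definition sobolev_tilde :: "real \<Rightarrow> (real ^ 'n::finite) set \<Rightarrow> (real ^ 'n \<Rightarrow> real) set" where
  "sobolev_tilde s \<Omega> = {v \<in> sobolev s \<Omega>. zero_ext \<Omega> v \<in> sobolev s UNIV}"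

definition sobolev_0 :: "real \<Rightarrow> (real ^ 'n::finite) set \<Rightarrow> (real ^ 'n \<Rightarrow> real) set" where
  "sobolev_0 s \<Omega> = {v \<in> sobolev s \<Omega>.
     \<forall>e>0. \<exists>\<phi>\<in>test_funs \<Omega>. sobolev_norm s \<Omega> (\<lambda>x. v x - \<phi> x) < e}"

text \<open>
  \<open>H\<^sup>-\<^sup>s\<close> consists of the bounded linear functionals on \<open>sobolev_0 s \<Omega>\<close>; the duality pairing
  \<open>(f, v)\<close> is the value \<open>f v\<close>. Boundedness makes \<open>f\<close> independent of representatives.
\<close>

definition sobolev_dual ::
  "real \<Rightarrow> (real ^ 'n::finite) set \<Rightarrow> ((real ^ 'n \<Rightarrow> real) \<Rightarrow> real) set" where
  "sobolev_dual s \<Omega> = {f.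
     (\<forall>v\<in>sobolev_0 s \<Omega>. \<forall>w\<in>sobolev_0 s \<Omega>. f (\<lambda>x. v x + w x) = f v + f w) \<and>
     (\<forall>r. \<forall>v\<in>sobolev_0 s \<Omega>. f (\<lambda>x. r * v x) = r * f v) \<and>
     (\<exists>M. \<forall>v\<in>sobolev_0 s \<Omega>. \<bar>f v\<bar> \<le> M * sobolev_norm s \<Omega> v)}"


section \<open>The bilinear form of the integral fractional Laplacian\<close>

definition frac_lap_const :: "nat \<Rightarrow> real \<Rightarrow> real" where
  "frac_lap_const d \<alpha> =
     2 powr \<alpha> * Gamma ((\<alpha> + real d) / 2) / (pi powr (real d / 2) * \<bar>Gamma (- \<alpha> / 2)\<bar>)"

definition rho :: "real \<Rightarrow> (real ^ 'n::finite) set \<Rightarrow> real ^ 'n \<Rightarrow> real" where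
  "rho \<alpha> \<Omega> x = frac_lap_const CARD('n) \<alpha> *
     integral\<^sup>L (lebesgue_on (- \<Omega>)) (\<lambda>y. norm (x - y) powr (- real CARD('n) - \<alpha>))"

definition frac_form ::
  "real \<Rightarrow> (real ^ 'n::finite) set \<Rightarrow> (real ^ 'n \<Rightarrow> real) \<Rightarrow> (real ^ 'n \<Rightarrow> real) \<Rightarrow> real" where
  "frac_form \<alpha> \<Omega> u v =
     frac_lap_const CARD('n) \<alpha> / 2 *
       integral\<^sup>L (lebesgue_on \<Omega> \<Otimes>\<^sub>M lebesgue_on \<Omega>)
         (\<lambda>(x, y). (u x - u y) * (v x - v y) / norm (x - y) powr (real CARD('n) + \<alpha>)) +
     integral\<^sup>L (lebesgue_on \<Omega>) (\<lambda>x. rho \<alpha> \<Omega> x * u x * v x)"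


section \<open>Trial spaces, mesh norm and native space\<close>

definition gmq_kernel :: "real \<Rightarrow> real \<Rightarrow> real ^ 'n::finite \<Rightarrow> real ^ 'n \<Rightarrow> real" where
  "gmq_kernel \<alpha> \<epsilon> x y = (\<epsilon>\<^sup>2 + (norm (x - y))\<^sup>2) powr ((\<alpha> - real CARD('n)) / 2)"

definition trial_space ::
  "real \<Rightarrow> real \<Rightarrow> (real ^ 'n::finite) set \<Rightarrow> (real ^ 'n) set \<Rightarrow> (real ^ 'n \<Rightarrow> real) set" where
  "trial_space \<alpha> \<epsilon> \<Omega> X = {v. \<exists>c. \<forall>x\<in>\<Omega>. v x = (\<Sum>z\<in>X. c z * gmq_kernel \<alpha> \<epsilon> x z)}"

definition mesh_norm :: "(real ^ 'n::finite) set \<Rightarrow> (real ^ 'n) set \<Rightarrow> real" where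
  "mesh_norm \<Omega> X = (SUP x\<in>\<Omega>. Min ((\<lambda>z. norm (x - z)) ` X))"

text \<open>
  \<open>is_rkhs D K H ip\<close>: the set \<open>H\<close> of functions on \<open>D\<close> (normalised to vanish off \<open>D\<close>) with inner
  product \<open>ip\<close> is the reproducing kernel Hilbert space on \<open>D\<close> of the kernel \<open>K\<close>. By the
  Moore-Aronszajn theorem it exists and is unique when \<open>K\<close> is positive definite.
\<close>

definition ip_norm :: "(('a \<Rightarrow> real) \<Rightarrow> ('a \<Rightarrow> real) \<Rightarrow> real) \<Rightarrow> ('a \<Rightarrow> real) \<Rightarrow> real" where
  "ip_norm ip g = sqrt (ip g g)"

definition is_rkhs ::
  "'a set \<Rightarrow> ('a \<Rightarrow> 'a \<Rightarrow> real) \<Rightarrow> ('a \<Rightarrow> real) set \<Rightarrow>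
    (('a \<Rightarrow> real) \<Rightarrow> ('a \<Rightarrow> real) \<Rightarrow> real) \<Rightarrow> bool" where
  "is_rkhs D K H ip \<longleftrightarrow>
     \<comment> \<open>a linear space of functions on \<open>D\<close>\<close>
     (\<forall>g\<in>H. \<forall>x. x \<notin> D \<longrightarrow> g x = 0) \<and>
     (\<lambda>_. 0) \<in> H \<and>
     (\<forall>g\<in>H. \<forall>k\<in>H. (\<lambda>x. g x + k x) \<in> H) \<and>
     (\<forall>r. \<forall>g\<in>H. (\<lambda>x. r * g x) \<in> H) \<and>
     \<comment> \<open>with an inner product\<close>
     (\<forall>g\<in>H. \<forall>k\<in>H. ip g k = ip k g) \<and>
     (\<forall>g\<in>H. \<forall>k\<in>H. \<forall>l\<in>H. ip (\<lambda>x. g x + k x) l = ip g l + ip k l) \<and>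
     (\<forall>r. \<forall>g\<in>H. \<forall>k\<in>H. ip (\<lambda>x. r * g x) k = r * ip g k) \<and>
     (\<forall>g\<in>H. 0 \<le> ip g g \<and> (ip g g = 0 \<longrightarrow> g = (\<lambda>_. 0))) \<and>
     \<comment> \<open>complete\<close>
     (\<forall>G. (\<forall>n::nat. G n \<in> H) \<and>
          (\<forall>e>0. \<exists>N. \<forall>m\<ge>N. \<forall>n\<ge>N. ip_norm ip (\<lambda>x. G m x - G n x) < e) \<longrightarrow>
          (\<exists>g\<in>H. (\<lambda>n. ip_norm ip (\<lambda>x. G n x - g x)) \<longlonglongrightarrow> 0)) \<and>
     \<comment> \<open>and with reproducing kernel \<open>K\<close>\<close>
     (\<forall>y\<in>D. zero_ext D (\<lambda>x. K x y) \<in> H \<and> (\<forall>g\<in>H. ip g (zero_ext D (\<lambda>x. K x y)) = g y))"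

end

theory Submission
  imports Defs "HOL-Complex_Analysis.Complex_Analysis"
begin

text \<open>
  Part (i). Galerkin orthogonality makes the Galerkin solution the best approximation in the energy norm
  of \<open>a\<close>. The energy norm dominates the Sobolev norm because \<open>\<rho>\<close> is bounded below on the bounded set
  \<open>\<Omega>\<close>, and it is dominated by it because the zero extension is bounded. The latter is only assumed
  as an equality of sets and is made quantitative by a gliding hump argument.

  Part (ii). Let \<open>r\<close> be the residual of the kernel interpolant of \<open>u\<close> on \<open>X\<close>. Then
  \<open>r x = ip u e\<close>, where \<open>e\<close> is the residual of the kernel section at \<open>x\<close>, and \<open>ip e e = e x\<close>, so
  it suffices to show that a finite combination of kernel sections vanishing on \<open>X\<close> is, on \<open>\<Omega>\<close>,
  at most \<open>C exp (- c / h)\<close> times its native norm. Along every line such a combination \<open>S\<close> extends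
  holomorphically to a strip of fixed width, with a bound by its native norm. Multiplying \<open>S\<close> by a
  Gaussian centred in \<open>\<Omega>\<close> and applying the three lines theorem and a Bernstein inequality at a near-maximum
  gives the smallness on a ball in \<open>\<Omega>\<close>. The three circles theorem propagates it to all of \<open>\<Omega>\<close>, so no
  cone condition is needed. Since \<open>r\<close> is also Lipschitz, interpolating the two bounds and using
  \<open>\<alpha> < 1\<close> controls the Slobodeckij seminorm.
\<close>

section \<open>Holomorphic functions in a strip\<close>

text \<open>Two obstacles shape part (ii). First, \<Omega> is an arbitrary bounded open set: near
  its boundary no ball of fixed radius fits, and it may be disconnected. Hence the density of the
  zeros is exploited only in one interior ball. A combination of kernel sections lives on the whole
  space, so smallness may then travel along segments that leave \<Omega>. Each three circles step
  halves the exponent, and the \<open>J\<close> steps needed to cross \<Omega> cost a factor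
  \<open>2 ^ J\<close> in the rate. Second, the holomorphic extension has to be bounded by the
  native norm and not by the coefficients. An inverse stereographic projection turns the
  multiquadric into a weighted \<open>(1 - x \<bullet> y) powr (- \<beta>)\<close>. Its power series
  has positive coefficients, and Cauchy-Schwarz in every tensor power carries the bound to complex
  points. For the residual of a kernel section this bound improves itself, since its value at
  \<open>x\<close> is also its squared norm. A constant prefactor survives all estimates and is
  absorbed into the exponential only for small mesh norm; this is the origin of the threshold
  \<open>h\<^sub>0\<close>.\<close>

text \<open>The factor \<open>exp (\<i> * of_real \<mu> * z)\<close> has modulus
  \<open>exp (- \<mu> * Im z)\<close> and reduces the claim to a bound by \<open>m\<close> on both
  horizontal edges. The maximum principle is applied on a rectangle, whose vertical sides are
  controlled by \<open>decay\<close>.\<close>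

lemma upper_half_strip_bound:
  fixes H :: "complex \<Rightarrow> complex"
  assumes hol: "H holomorphic_on {z. \<bar>Im z\<bar> < \<eta>'}" and \<eta>: "0 < \<eta>" "\<eta> < \<eta>'"
    and m: "0 < m" and real: "\<And>t::real. cmod (H (of_real t)) \<le> m"
    and strip: "\<And>z. \<bar>Im z\<bar> \<le> \<eta> \<Longrightarrow> cmod (H z) \<le> m * exp (\<mu> * \<eta>)"
    and decay: "\<And>z. \<bar>Im z\<bar> \<le> \<eta> \<Longrightarrow> cmod (H z) * (Re z + b)\<^sup>2 \<le> B"
    and \<mu>: "0 \<le> \<mu>" and w: "0 \<le> Im w" "Im w \<le> \<eta>"
  shows "cmod (H w) \<le> m * exp (\<mu> * Im w)"
proof -
  \<comment> \<open>On the vertical sides \<open>\<bar>Re z + b\<bar>\<close> is at least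
    \<open>1 + B / m\<close>, so its square is at least \<open>B / m\<close> and
    \<open>decay\<close> gives \<open>cmod (H z) \<le> m\<close>. The summand
    \<open>\<bar>Re w\<bar>\<close> puts \<open>w\<close> into the rectangle.\<close>
  define R where "R = \<bar>Re w\<bar> + \<bar>b\<bar> + 1 + B / m"
  have B0: "0 \<le> B"
  proof -
    have "0 \<le> cmod (H 0) * (Re 0 + b)\<^sup>2" by simp
    also have "\<dots> \<le> B" using \<eta> by (intro decay) simp
    finally show ?thesis .
  qed
  define S where "S = {z. \<bar>Re z\<bar> < R \<and> 0 < Im z \<and> Im z < \<eta>}"
  define P where "P = (\<lambda>z. H z * exp (\<i> * of_real \<mu> * z))"
  have normP: "cmod (P z) = cmod (H z) * exp (- \<mu> * Im z)" for z
    by (simp add: P_def norm_mult)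
  have Sbox: "S = box (Complex (-R) 0) (Complex R \<eta>)"
    by (auto simp: S_def in_box_complex_iff)
  have R0: "R > 0" unfolding R_def using divide_nonneg_pos[OF B0 m] by linarith
  have clS: "closure S = cbox (Complex (-R) 0) (Complex R \<eta>)"
    unfolding Sbox by (rule closure_box) (use R0 \<eta> in \<open>auto simp: box_ne_empty Basis_complex_def inner_complex_def\<close>)
  have clS': "closure S = {z. \<bar>Re z\<bar> \<le> R \<and> 0 \<le> Im z \<and> Im z \<le> \<eta>}"
    unfolding clS by (auto simp: in_cbox_complex_iff)
  have openS: "open S" unfolding Sbox by (rule open_box)
  have sub: "closure S \<subseteq> {z. \<bar>Im z\<bar> < \<eta>'}" unfolding clS' using \<eta> by auto
  have holP: "P holomorphic_on {z. \<bar>Im z\<bar> < \<eta>'}"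
    unfolding P_def by (intro holomorphic_intros hol)
  have "cmod (P w) \<le> m"
  proof (rule maximum_modulus_frontier[of P "closure S"])
    show "P holomorphic_on interior (closure S)"
      by (rule holomorphic_on_subset[OF holP order_trans[OF interior_subset sub]])
    show "continuous_on (closure (closure S)) P"
      unfolding closure_closure
      by (rule continuous_on_subset[OF holomorphic_on_imp_continuous_on[OF holP] sub])
    show "bounded (closure S)" unfolding clS by simp
    show "w \<in> closure S" using w R0 B0 m unfolding clS' R_def by (auto intro!: divide_nonneg_pos)
  next
    fix z assume "z \<in> frontier (closure S)"
    then have zcl: "z \<in> closure S" and "z \<notin> S"
      using interior_maximal[OF closure_subset openS] by (auto simp: frontier_def)
    then consider "\<bar>Re z\<bar> = R" "0 \<le> Im z" "Im z \<le> \<eta>" | "Im z = 0" | "Im z = \<eta>"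
      using zcl[unfolded clS'] \<open>z \<notin> S\<close>[unfolded S_def] by force
    then show "cmod (P z) \<le> m"
    proof cases
      case 1
      have "R - \<bar>b\<bar> \<le> \<bar>Re z + b\<bar>" using 1 by linarith
      then have "(R - \<bar>b\<bar>)\<^sup>2 \<le> (Re z + b)\<^sup>2"
        unfolding abs_le_square_iff[symmetric] using B0 m by (auto simp: R_def)
      moreover have "1 + B / m \<le> (R - \<bar>b\<bar>)\<^sup>2"
      proof -
        have "1 + B/m \<le> R - \<bar>b\<bar>" and "1 \<le> 1 + B / m" using B0 m by (auto simp: R_def)
        then have "1 + B/m \<le> R - \<bar>b\<bar>" "1 \<le> R - \<bar>b\<bar>" by auto
        then show ?thesis
          using self_le_power[of "R - \<bar>b\<bar>" 2] by linarith
      qed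
      ultimately have "1 + B / m \<le> (Re z + b)\<^sup>2" by linarith
      then have gt: "(Re z + b)\<^sup>2 \<ge> B / m" "(Re z + b)\<^sup>2 > 0" using divide_nonneg_pos[OF B0 m] by linarith+
      have "cmod (H z) * (Re z + b)\<^sup>2 \<le> B" using 1 \<eta> by (intro decay) auto
      also have "\<dots> \<le> m * (Re z + b)\<^sup>2" using gt m by (simp add: field_simps)
      finally have "cmod (H z) \<le> m" using gt by simp
      moreover have "cmod (H z) * exp (- \<mu> * Im z) \<le> cmod (H z) * 1"
        using 1 \<mu> by (intro mult_left_mono) auto
      ultimately show ?thesis unfolding normP by linarith
    next
      case 2
      then have "z = of_real (Re z)" by (simp add: complex_eq_iff)
      then show ?thesis using real[of "Re z"] 2 unfolding normP by simp
    next
      case 3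
      then have "cmod (H z) \<le> m * exp (\<mu> * \<eta>)" using \<eta> by (intro strip) auto
      then show ?thesis unfolding normP 3 by (simp add: exp_minus field_simps)
    qed
  qed
  then show ?thesis unfolding normP by (simp add: exp_minus field_simps)
qed

lemma strip_bound:
  fixes H :: "complex \<Rightarrow> complex"
  assumes hol: "H holomorphic_on {z. \<bar>Im z\<bar> < \<eta>'}" and \<eta>: "0 < \<eta>" "\<eta> < \<eta>'"
    and m: "0 < m" and real: "\<And>t::real. cmod (H (of_real t)) \<le> m"
    and strip: "\<And>z. \<bar>Im z\<bar> \<le> \<eta> \<Longrightarrow> cmod (H z) \<le> m * exp (\<mu> * \<eta>)"
    and decay: "\<And>z. \<bar>Im z\<bar> \<le> \<eta> \<Longrightarrow> cmod (H z) * (Re z + b)\<^sup>2 \<le> B"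
    and \<mu>: "0 \<le> \<mu>" and w: "\<bar>Im w\<bar> \<le> \<eta>"
  shows "cmod (H w) \<le> m * exp (\<mu> * \<bar>Im w\<bar>)"
proof (cases "0 \<le> Im w")
  case True
  then show ?thesis
    using upper_half_strip_bound[OF hol \<eta> m real strip decay \<mu>, of w] w by simp
next
  case False
  have hol': "(\<lambda>z. H (- z)) holomorphic_on {z. \<bar>Im z\<bar> < \<eta>'}"
    by (intro holomorphic_on_compose_gen[where f=uminus, OF _ hol, unfolded o_def] holomorphic_intros) auto
  have "cmod (H (- (- w))) \<le> m * exp (\<mu> * Im (- w))"
  proof (rule upper_half_strip_bound[OF hol' \<eta> m _ _ _ \<mu>, where b="- b" and B=B])
    show "cmod (H (- of_real t)) \<le> m" for t using real[of "- t"] by simp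
    show "cmod (H (- z)) \<le> m * exp (\<mu> * \<eta>)" if "\<bar>Im z\<bar> \<le> \<eta>" for z using strip[of "- z"] that by simp
    show "cmod (H (- z)) * (Re z + - b)\<^sup>2 \<le> B" if "\<bar>Im z\<bar> \<le> \<eta>" for z
      using decay[of "- z"] that by (simp add: power2_commute)
  qed (use False w in auto)
  then show ?thesis using False by simp
qed

text \<open>The weight is \<open>exp (- k * (norm (x - x0))\<^sup>2)\<close> restricted to a line:
  after completing the square, \<open>- b\<close> is the parameter of the point nearest to
  \<open>x0\<close> and \<open>c\<close> the squared distance of the line from \<open>x0\<close>. It
  provides the decay that \<open>strip_bound\<close> asks for, at the price of a gain of at most
  \<open>exp (k * \<eta>\<^sup>2)\<close> off the real axis; \<open>strip\<close> is the rate \<mu>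
  that pays for this gain.\<close>

lemma gaussian_strip_bound:
  fixes F :: "complex \<Rightarrow> complex"
  assumes hol: "F holomorphic_on {z. \<bar>Im z\<bar> < \<eta>'}" and \<eta>: "0 < \<eta>" "\<eta> < \<eta>'"
    and bnd: "\<And>z. \<bar>Im z\<bar> \<le> \<eta> \<Longrightarrow> cmod (F z) \<le> M"
    and k: "0 < k" and m: "0 < m"
    and real: "\<And>t::real. cmod (F (of_real t)) * exp (- k * ((t + b)\<^sup>2 + c)) \<le> m"
    and strip: "M * exp (k * (\<eta>\<^sup>2 - c)) \<le> m * exp (\<mu> * \<eta>)"
    and \<mu>: "0 \<le> \<mu>" and w: "\<bar>Im w\<bar> \<le> \<eta>"
  shows "cmod (F w * exp (- of_real k * ((w + of_real b)\<^sup>2 + of_real c))) \<le> m * exp (\<mu> * \<bar>Im w\<bar>)"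
proof -
  define H where "H = (\<lambda>w. F w * exp (- of_real k * ((w + of_real b)\<^sup>2 + of_real c)))"
  have normH: "cmod (H z) = cmod (F z) * exp (- k * ((Re z + b)\<^sup>2 - (Im z)\<^sup>2 + c))" for z
    by (simp add: H_def norm_mult power2_eq_square)
  have M0: "0 \<le> M" using order_trans[OF norm_ge_zero bnd[of 0]] \<eta> by simp
  have est: "cmod (H z) \<le> M * exp (k * (\<eta>\<^sup>2 - c)) * exp (- k * (Re z + b)\<^sup>2)" if "\<bar>Im z\<bar> \<le> \<eta>" for z
  proof -
    have "(Im z)\<^sup>2 \<le> \<eta>\<^sup>2" using that \<eta> by (simp add: abs_le_square_iff[symmetric])
    then have "- k * ((Re z + b)\<^sup>2 - (Im z)\<^sup>2 + c) \<le> - k * ((Re z + b)\<^sup>2 - \<eta>\<^sup>2 + c)"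
      using k by (simp add: mult_left_mono)
    then have "cmod (H z) \<le> M * exp (- k * ((Re z + b)\<^sup>2 - \<eta>\<^sup>2 + c))"
      unfolding normH using bnd[OF that] M0 by (intro mult_mono) auto
    also have "\<dots> = M * exp (k * (\<eta>\<^sup>2 - c)) * exp (- k * (Re z + b)\<^sup>2)"
      by (simp add: exp_add[symmetric] algebra_simps flip: exp_add)
    finally show ?thesis .
  qed
  have "cmod (H w) \<le> m * exp (\<mu> * \<bar>Im w\<bar>)"
  proof (rule strip_bound[OF _ \<eta> m _ _ _ \<mu> w, where b=b and B="M * exp (k * (\<eta>\<^sup>2 - c)) / k"])
    show "H holomorphic_on {z. \<bar>Im z\<bar> < \<eta>'}"
      unfolding H_def by (intro holomorphic_intros hol)
    show "cmod (H (of_real t)) \<le> m" for t using real[of t] unfolding normH by simp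
  next
    fix z assume z: "\<bar>Im z\<bar> \<le> \<eta>"
    have "exp (- k * (Re z + b)\<^sup>2) \<le> 1" using k by simp
    then have "M * exp (k * (\<eta>\<^sup>2 - c)) * exp (- k * (Re z + b)\<^sup>2) \<le> M * exp (k * (\<eta>\<^sup>2 - c))"
      using M0 by (intro mult_left_le) auto
    then show "cmod (H z) \<le> m * exp (\<mu> * \<eta>)" using est[OF z] strip by linarith
    \<comment> \<open>\<open>t \<le> exp t\<close> at \<open>t = k * (Re z + b)\<^sup>2\<close>: the
      Gaussian beats the quadratic factor with constant \<open>1 / k\<close>.\<close>
    have "k * (Re z + b)\<^sup>2 * exp (- (k * (Re z + b)\<^sup>2)) \<le> 1"
    proof -
      have "k * (Re z + b)\<^sup>2 \<le> exp (k * (Re z + b)\<^sup>2)"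
        using exp_ge_add_one_self[of "k * (Re z + b)\<^sup>2"] by linarith
      then show ?thesis by (simp add: exp_minus divide_simps)
    qed
    then have "exp (- k * (Re z + b)\<^sup>2) * (Re z + b)\<^sup>2 \<le> 1 / k"
      using k by (simp add: field_simps)
    then have "M * exp (k * (\<eta>\<^sup>2 - c)) * (exp (- k * (Re z + b)\<^sup>2) * (Re z + b)\<^sup>2) \<le> M * exp (k * (\<eta>\<^sup>2 - c)) * (1 / k)"
      using M0 by (intro mult_left_mono) auto
    then show "cmod (H z) * (Re z + b)\<^sup>2 \<le> M * exp (k * (\<eta>\<^sup>2 - c)) / k"
      using mult_right_mono[OF est[OF z], of "(Re z + b)\<^sup>2"] by (simp add: mult.assoc)
  qed
  then show ?thesis by (simp add: H_def)
qed

text \<open>A Bernstein inequality: the growth rate \<open>\<mu>\<close> in the imaginary direction controls the derivative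
  on the real axis.\<close>

lemma strip_lipschitz:
  fixes H :: "complex \<Rightarrow> complex"
  assumes hol: "H holomorphic_on {z. \<bar>Im z\<bar> < \<eta>'}" and \<eta>: "\<eta> < \<eta>'" "1 \<le> \<mu> * \<eta>" "0 < \<mu>"
    and bnd: "\<And>w. \<bar>Im w\<bar> \<le> \<eta> \<Longrightarrow> cmod (H w) \<le> m * exp (\<mu> * \<bar>Im w\<bar>)"
  shows "cmod (H (of_real s) - H (of_real t)) \<le> exp 1 * m * \<mu> * \<bar>s - t\<bar>"
proof -
  have opn: "open {z. \<bar>Im z\<bar> < \<eta>'}" by (intro open_Collect_less continuous_intros)
  have r: "1 / \<mu> \<le> \<eta>" "0 < 1 / \<mu>" using \<eta> by (auto simp: field_simps)
  \<comment> \<open>Cauchy's inequality on the disc of radius \<open>1 / \<mu>\<close>, where the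
    growth factor \<open>exp (\<mu> * \<bar>Im w\<bar>)\<close> is at most
    \<open>exp 1\<close>.\<close>
  have d: "cmod (deriv H z) \<le> exp 1 * m * \<mu>" if z: "Im z = 0" for z
  proof -
    have im: "\<bar>Im w\<bar> \<le> 1 / \<mu>" if "dist z w \<le> 1 / \<mu>" for w
      using abs_Im_le_cmod[of "z - w"] that z by (simp add: dist_norm)
    then have sub: "cball z (1 / \<mu>) \<subseteq> {z. \<bar>Im z\<bar> < \<eta>'}" using r \<eta> by force
    have "cmod ((deriv ^^ 1) H z) \<le> fact 1 * (exp 1 * m) / (1 / \<mu>) ^ 1"
    proof (rule Cauchy_inequality)
      show "H holomorphic_on ball z (1 / \<mu>)"
        by (rule holomorphic_on_subset[OF hol order_trans[OF ball_subset_cball sub]])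
      show "continuous_on (cball z (1 / \<mu>)) H"
        by (rule continuous_on_subset[OF holomorphic_on_imp_continuous_on[OF hol] sub])
      show "0 < 1 / \<mu>" by fact
      fix w assume "cmod (z - w) = 1 / \<mu>"
      then have i: "\<bar>Im w\<bar> \<le> 1 / \<mu>" by (intro im) (simp add: dist_norm)
      have "0 \<le> m" using order_trans[OF norm_ge_zero bnd[of 0]] r by simp
      moreover have "\<mu> * \<bar>Im w\<bar> \<le> 1" using i \<eta> by (simp add: field_simps)
      ultimately have "m * exp (\<mu> * \<bar>Im w\<bar>) \<le> m * exp 1" by (intro mult_left_mono) auto
      then show "cmod (H w) \<le> exp 1 * m" using bnd[of w] i r by (simp add: mult.commute)
    qed
    then show ?thesis by simp
  qed
  have "cmod (H (of_real s) - H (of_real t)) \<le> exp 1 * m * \<mu> * cmod (of_real s - of_real t)"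
  proof (rule field_differentiable_bound[where S="closed_segment (of_real s) (of_real t)" and f' = "deriv H"])
    fix z :: complex assume "z \<in> closed_segment (of_real s) (of_real t)"
    then have z: "Im z = 0" by (auto simp: closed_segment_def)
    moreover have "0 < \<eta>'" using r \<eta> by linarith
    ultimately have "z \<in> {z. \<bar>Im z\<bar> < \<eta>'}" by auto
    then show "(H has_field_derivative deriv H z) (at z within closed_segment (of_real s) (of_real t))"
      using hol opn holomorphic_derivI by blast
    show "cmod (deriv H z) \<le> exp 1 * m * \<mu>" by (rule d[OF z])
  qed auto
  then show ?thesis by (simp flip: of_real_diff)
qed


text \<open>The weight \<open>exp (- 2 * k * w\<^sup>2)\<close> makes the smallness global on the
  real line: for \<open>\<bar>t\<bar> \<le> \<rho>\<close> it is the hypothesis, beyond that it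
  comes from the Gaussian. The three lines bound has rate \<open>4 * k * \<rho>\<close>. For
  \<open>cmod w \<le> \<rho> / 4\<close> the exponent, in units of
  \<open>k * \<rho>\<^sup>2\<close>, is at most \<open>- 2 + 1 + 1 / 8\<close>, which is below
  \<open>- 1 / 2\<close>.\<close>

lemma strip_small_disc:
  fixes F :: "complex \<Rightarrow> complex"
  assumes hol: "F holomorphic_on {z. \<bar>Im z\<bar> < 2 * \<rho>}" and \<rho>: "0 < \<rho>"
    and bnd: "\<And>z. \<bar>Im z\<bar> \<le> \<rho> \<Longrightarrow> cmod (F z) \<le> M" and M: "0 < M" and k: "0 < k"
    and small: "\<And>t::real. \<bar>t\<bar> \<le> \<rho> \<Longrightarrow> cmod (F (of_real t)) \<le> M * exp (- 2 * k * \<rho>\<^sup>2)"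
    and w: "cmod w \<le> \<rho> / 4"
  shows "cmod (F w) \<le> M * exp (- k * \<rho>\<^sup>2 / 2)"
proof -
  have imw: "\<bar>Im w\<bar> \<le> \<rho> / 4" and rew: "\<bar>Re w\<bar> \<le> \<rho> / 4"
    using w abs_Im_le_cmod[of w] abs_Re_le_cmod[of w] by linarith+
  have "cmod (F w * exp (- of_real (2 * k) * ((w + of_real 0)\<^sup>2 + of_real 0)))
      \<le> M * exp (- 2 * k * \<rho>\<^sup>2) * exp (4 * k * \<rho> * \<bar>Im w\<bar>)"
  proof (rule gaussian_strip_bound[OF hol \<rho> _ bnd])
    fix t :: real
    show "cmod (F (of_real t)) * exp (- (2 * k) * ((t + 0)\<^sup>2 + 0)) \<le> M * exp (- 2 * k * \<rho>\<^sup>2)"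
    proof (cases "\<bar>t\<bar> \<le> \<rho>")
      case True
      have "exp (- (2 * k) * t\<^sup>2) \<le> 1" using k by simp
      then show ?thesis
        using mult_mono[OF small[OF True], of "exp (- (2 * k) * t\<^sup>2)" 1] M by simp
    next
      case False
      then have "\<rho>\<^sup>2 \<le> t\<^sup>2" using \<rho> by (simp add: abs_le_square_iff[symmetric])
      then have "exp (- (2 * k) * t\<^sup>2) \<le> exp (- (2 * k) * \<rho>\<^sup>2)" using k by simp
      then show ?thesis using mult_mono[OF bnd[of "of_real t"], of "exp (- (2 * k) * t\<^sup>2)"] \<rho> M by simp
    qed
  next
    show "M * exp (2 * k * (\<rho>\<^sup>2 - 0)) \<le> M * exp (- 2 * k * \<rho>\<^sup>2) * exp (4 * k * \<rho> * \<rho>)"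
      by (simp add: mult.assoc power2_eq_square flip: exp_add) (simp add: algebra_simps)?
  qed (use \<rho> k M imw in auto)
  moreover have "cmod (F w * exp (- of_real (2 * k) * ((w + of_real 0)\<^sup>2 + of_real 0)))
      = cmod (F w) * exp (- 2 * k * ((Re w)\<^sup>2 - (Im w)\<^sup>2))"
    by (simp add: norm_mult power2_eq_square)
  ultimately have "cmod (F w) * exp (- 2 * k * ((Re w)\<^sup>2 - (Im w)\<^sup>2)) * exp (2 * k * ((Re w)\<^sup>2 - (Im w)\<^sup>2))
      \<le> M * exp (- 2 * k * \<rho>\<^sup>2) * exp (4 * k * \<rho> * \<bar>Im w\<bar>) * exp (2 * k * ((Re w)\<^sup>2 - (Im w)\<^sup>2))"
    by (intro mult_right_mono) auto
  then have "cmod (F w) \<le> M * exp (- 2 * k * \<rho>\<^sup>2 + 4 * k * \<rho> * \<bar>Im w\<bar> + 2 * k * ((Re w)\<^sup>2 - (Im w)\<^sup>2))"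
    by (simp add: mult.assoc flip: exp_add)
  also have "\<dots> \<le> M * exp (- k * \<rho>\<^sup>2 / 2)"
  proof -
    have "\<rho> * \<bar>Im w\<bar> \<le> \<rho> * (\<rho> / 4)" using imw \<rho> by (intro mult_left_mono) auto
    then have "\<rho> * \<bar>Im w\<bar> \<le> \<rho>\<^sup>2 / 4" by (simp add: power2_eq_square)
    moreover have "(Re w)\<^sup>2 \<le> (\<rho> / 4)\<^sup>2" using rew \<rho> by (simp add: abs_le_square_iff[symmetric])
    then have "(Re w)\<^sup>2 \<le> \<rho>\<^sup>2 / 16" by (simp add: power_divide)
    ultimately have "- 2 * \<rho>\<^sup>2 + 4 * (\<rho> * \<bar>Im w\<bar>) + 2 * ((Re w)\<^sup>2 - (Im w)\<^sup>2) \<le> - (\<rho>\<^sup>2) / 2"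
      using zero_le_power2[of "Im w"] zero_le_power2[of \<rho>] by argo
    then have "k * (- 2 * \<rho>\<^sup>2 + 4 * (\<rho> * \<bar>Im w\<bar>) + 2 * ((Re w)\<^sup>2 - (Im w)\<^sup>2)) \<le> k * (- \<rho>\<^sup>2 / 2)"
      using k by (intro mult_left_mono) auto
    then show ?thesis using M by (simp add: algebra_simps)
  qed
  finally show ?thesis .
qed

section \<open>Propagation of smallness along a line\<close>

text \<open>Dividing by \<open>(z - c) ^ (2 * n)\<close> equalises the bounds on the circles of
  radius \<open>r\<close> and \<open>4 * r\<close>: both become
  \<open>M / (4 * r) ^ (2 * n)\<close>. Since \<open>2 * r\<close> is the geometric mean of the
  radii, multiplying back leaves \<open>M / 4 ^ n\<close>, half of the inner exponent. With integer
  exponents the quotient is single-valued on the annulus.\<close>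

lemma three_circles:
  fixes f :: "complex \<Rightarrow> complex"
  assumes hol: "f holomorphic_on U" and r: "0 < r" and sub: "cball c (4 * r) \<subseteq> U"
    and outer: "\<And>z. dist c z \<le> 4 * r \<Longrightarrow> cmod (f z) \<le> M"
    and inner: "\<And>z. dist c z \<le> r \<Longrightarrow> cmod (f z) \<le> M / 4 ^ (2 * n)"
    and w: "dist c w \<le> 2 * r"
  shows "cmod (f w) \<le> M / 4 ^ n"
proof -
  have M0: "0 \<le> M" using order_trans[OF norm_ge_zero outer[of c]] r by simp
  show ?thesis
  proof (cases "dist c w \<le> r")
    case True
    have "M / 4 ^ (2 * n) \<le> M / 4 ^ n"
      using M0 by (intro divide_left_mono power_increasing) auto
    then show ?thesis using inner[OF True] by linarith
  next
    case False
    define A where "A = cball c (4 * r) - ball c r"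
    define F where "F = (\<lambda>z. f z / (z - c) ^ (2 * n))"
    have clA: "closed A" unfolding A_def by (intro closed_Diff) auto
    have nz: "z \<noteq> c" if "z \<in> A" for z using that r by (auto simp: A_def)
    have "ball c (4 * r) - cball c r \<subseteq> interior A"
      by (rule interior_maximal) (auto simp: A_def intro!: open_Diff)
    then have fr: "dist c z = r \<or> dist c z = 4 * r" if "z \<in> frontier A" for z
    proof -
      have "z \<in> A" "z \<notin> interior A" using that clA by (auto simp: frontier_def)
      then show ?thesis using \<open>ball c (4 * r) - cball c r \<subseteq> interior A\<close> by (force simp: A_def)
    qed
    have holF: "F holomorphic_on A"
      unfolding F_def using nz sub
      by (intro holomorphic_intros holomorphic_on_subset[OF hol]) (auto simp: A_def)
    have "cmod (F w) \<le> M / (4 * r) ^ (2 * n)"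
    proof (rule maximum_modulus_frontier[of F A])
      show "F holomorphic_on interior A" by (rule holomorphic_on_subset[OF holF interior_subset])
      show "continuous_on (closure A) F"
        using holomorphic_on_imp_continuous_on[OF holF] clA by simp
      show "bounded A" unfolding A_def by (rule bounded_subset[OF bounded_cball]) auto
      show "w \<in> A" using False w r by (auto simp: A_def)
    next
      fix z assume "z \<in> frontier A"
      from fr[OF this] show "cmod (F z) \<le> M / (4 * r) ^ (2 * n)"
      proof
        assume z: "dist c z = r"
        have "cmod (F z) = cmod (f z) / r ^ (2 * n)"
          using z by (simp add: F_def norm_divide norm_power dist_norm norm_minus_commute)
        also have "\<dots> \<le> M / 4 ^ (2 * n) / r ^ (2 * n)"
          using inner[of z] z r by (intro divide_right_mono) auto
        finally show ?thesis by (simp add: power_mult_distrib)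
      next
        assume z: "dist c z = 4 * r"
        have "cmod (F z) = cmod (f z) / (4 * r) ^ (2 * n)"
          using z by (simp add: F_def norm_divide norm_power dist_norm norm_minus_commute)
        also have "\<dots> \<le> M / (4 * r) ^ (2 * n)"
          using outer[of z] z r by (intro divide_right_mono) auto
        finally show ?thesis .
      qed
    qed
    then have *: "cmod (f w) / dist c w ^ (2 * n) \<le> M / (4 * r) ^ (2 * n)"
      by (simp add: F_def norm_divide norm_power dist_norm norm_minus_commute)
    have "cmod (f w) \<le> M / (4 * r) ^ (2 * n) * dist c w ^ (2 * n)"
    proof -
      have "0 < dist c w" using False r by linarith
      then show ?thesis using * by (metis pos_divide_le_eq zero_less_power)
    qed
    also have "\<dots> \<le> M / (4 * r) ^ (2 * n) * (2 * r) ^ (2 * n)"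
      using w M0 r by (intro mult_left_mono power_mono) auto
    also have "\<dots> = M * (2 * r / (4 * r)) ^ (2 * n)"
      by (simp only: power_divide times_divide_eq_left times_divide_eq_right)
    also have "2 * r / (4 * r) = 1 / 2" using r by simp
    also have "M * (1 / 2) ^ (2 * n) = M / 4 ^ n"
      by (simp add: power_mult power_divide power2_eq_square)
    finally show ?thesis .
  qed
qed

text \<open>A chain of discs of radius \<open>\<rho> / 4\<close> with centres
  \<open>j * (\<rho> / 4)\<close>. The next disc lies in the doubled disc, and the quadrupled disc
  has radius \<rho> and stays in the strip. Every step halves the exponent, so starting from
  \<open>2 ^ J * n\<close> leaves at least \<open>n\<close> after at most \<open>J\<close>
  steps.\<close>

lemma strip_propagation:
  fixes f :: "complex \<Rightarrow> complex"
  assumes hol: "f holomorphic_on {z. \<bar>Im z\<bar> < 2 * \<rho>}" and \<rho>: "0 < \<rho>"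
    and bnd: "\<And>z. \<bar>Im z\<bar> \<le> \<rho> \<Longrightarrow> cmod (f z) \<le> M"
    and small: "\<And>z. cmod z \<le> \<rho> / 4 \<Longrightarrow> cmod (f z) \<le> M / 4 ^ (2 ^ J * n)"
    and "j \<le> J" and "dist (of_real (real j * (\<rho> / 4))) w \<le> \<rho> / 4"
  shows "cmod (f w) \<le> M / 4 ^ (2 ^ (J - j) * n)"
  using assms(5,6)
proof (induction j arbitrary: w)
  case 0
  then show ?case using small[of w] by simp
next
  case (Suc j)
  define c where "c = complex_of_real (real j * (\<rho> / 4))"
  have strip: "\<bar>Im z\<bar> \<le> \<rho>" if "dist c z \<le> 4 * (\<rho> / 4)" for z
    using abs_Im_le_cmod[of "c - z"] that by (simp add: dist_norm c_def)
  have eq: "2 ^ (J - j) * n = 2 * (2 ^ (J - Suc j) * n)"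
    using Suc.prems(1) by (simp add: Suc_diff_Suc flip: power_Suc)
  show ?case
  proof (rule three_circles[OF hol, where c=c and r="\<rho> / 4"])
    show "cball c (4 * (\<rho> / 4)) \<subseteq> {z. \<bar>Im z\<bar> < 2 * \<rho>}"
      using strip \<rho> by force
    show "cmod (f z) \<le> M" if "dist c z \<le> 4 * (\<rho> / 4)" for z
      by (rule bnd[OF strip[OF that]])
    show "cmod (f z) \<le> M / 4 ^ (2 * (2 ^ (J - Suc j) * n))" if "dist c z \<le> \<rho> / 4" for z
      using Suc.IH[of z] Suc.prems(1) that unfolding c_def eq by simp
    have "dist c (of_real (real (Suc j) * (\<rho> / 4))) = \<rho> / 4"
      using \<rho> unfolding c_def dist_of_real dist_real_def by (simp add: algebra_simps add_divide_distrib)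
    then show "dist c w \<le> 2 * (\<rho> / 4)"
      using dist_triangle[of c w "of_real (real (Suc j) * (\<rho> / 4))"] Suc.prems(2) by simp
  qed (use \<rho> in auto)
qed

section \<open>Smallness caused by a dense set of zeros\<close>

text \<open>Analyticity is recorded line by line, so one complex variable suffices. The extension
  may depend on the line, while width and bound are uniform. Holomorphy is required on twice the
  width of the bound, so that closed strips and discs stay inside the domain.\<close>

definition strip_bounded :: "real \<Rightarrow> real \<Rightarrow> ('a::real_inner \<Rightarrow> real) \<Rightarrow> bool" where
  "strip_bounded \<rho> M S \<longleftrightarrow> (\<forall>a e. norm e = 1 \<longrightarrow>
     (\<exists>F. F holomorphic_on {z. \<bar>Im z\<bar> < 2 * \<rho>} \<and> (\<forall>z. \<bar>Im z\<bar> \<le> \<rho> \<longrightarrow> cmod (F z) \<le> M) \<and>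
        (\<forall>t. F (of_real t) = of_real (S (a + t *\<^sub>R e)))))"

lemma strip_bounded_abs_le:
  fixes S :: "'a::euclidean_space \<Rightarrow> real"
  assumes "strip_bounded \<rho> M S" "0 < \<rho>"
  shows "\<bar>S x\<bar> \<le> M"
proof -
  obtain e :: 'a where "norm e = 1" using vector_choose_size[of 1] by auto
  then obtain F where "\<forall>z. \<bar>Im z\<bar> \<le> \<rho> \<longrightarrow> cmod (F z) \<le> M" "\<forall>t. F (of_real t) = of_real (S (x + t *\<^sub>R e))"
    using assms(1) unfolding strip_bounded_def by metis
  from this(1)[rule_format, of "of_real 0"] this(2)[rule_format, of 0] show ?thesis using assms(2) by simp
qed

text \<open>
  The Gaussian weight forces a near-maximum of \<open>\<bar>S\<bar> exp (- k \<bar>x - x0\<bar>\<^sup>2)\<close> into the region where the zeros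
  are dense. If \<open>S\<close> were not exponentially small, the ratio of the bound in the strip to
  this maximum would be so moderate that the Bernstein inequality excludes a zero within distance \<open>h\<close>.
\<close>

lemma strip_bounded_small_on_ball:
  fixes S :: "'a::euclidean_space \<Rightarrow> real"
  assumes SB: "strip_bounded \<rho> M S" and \<rho>: "0 < \<rho>" and h: "0 < h" "2 * exp 1 * h \<le> \<rho>"
    and dense: "\<And>x. norm (x - x0) < 2 * \<rho> \<Longrightarrow> \<exists>z. norm (x - z) \<le> h \<and> S z = 0"
    and x1: "norm (x1 - x0) \<le> \<rho>"
  shows "\<bar>S x1\<bar> \<le> M * exp (- \<rho> / (4 * exp 1 * h))"
proof (rule ccontr)
  \<comment> \<open>Chosen so that the Bernstein bound
    \<open>exp 1 * m * (4 * k * \<rho>) * h\<close> for the drop over a distance \<open>h\<close>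
    equals \<open>m / 2\<close>.\<close>
  define k where "k = 1 / (8 * exp 1 * \<rho> * h)"
  have k: "0 < k" using \<rho> h by (simp add: k_def)
  have kk: "k * \<rho> * h * exp 1 = 1 / 8" using \<rho> h by (simp add: k_def field_simps)
  have k2: "2 * k * \<rho>\<^sup>2 = \<rho> / (4 * exp 1 * h)" using \<rho> h by (simp add: k_def field_simps power2_eq_square)
  assume "\<not> ?thesis"
  then have x1gt: "\<bar>S x1\<bar> > M * exp (- (2 * k * \<rho>\<^sup>2))" unfolding k2 by simp
  have Sle: "\<bar>S x\<bar> \<le> M" for x by (rule strip_bounded_abs_le[OF SB \<rho>])
  have M0: "0 \<le> M" using order_trans[OF abs_ge_zero Sle] .
  define G where "G = (\<lambda>x. \<bar>S x\<bar> * exp (- k * (norm (x - x0))\<^sup>2))"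
  have Gle: "G x \<le> M" for x
    unfolding G_def using mult_mono[OF Sle[of x], of "exp (- k * (norm (x - x0))\<^sup>2)" 1] k M0 by simp
  then have bdd: "bdd_above (range G)" by (intro bdd_aboveI[of _ M]) auto
  define m where "m = (SUP x. G x)"
  have Gm: "G x \<le> m" for x unfolding m_def by (rule cSUP_upper[OF UNIV_I bdd])
  \<comment> \<open>The assumed lower bound loses \<open>2 * k * \<rho>\<^sup>2\<close> in the
    exponent, and the Gaussian at distance at most \<rho> loses another
    \<open>k * \<rho>\<^sup>2\<close>. At distance \<open>2 * \<rho>\<close> the Gaussian alone
    loses \<open>4 * k * \<rho>\<^sup>2\<close>, which is more.\<close>
  have Gx1: "M * exp (- (3 * k * \<rho>\<^sup>2)) < G x1"
  proof -
    have "(norm (x1 - x0))\<^sup>2 \<le> \<rho>\<^sup>2" using x1 by (intro power_mono) auto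
    then have "exp (- k * \<rho>\<^sup>2) \<le> exp (- k * (norm (x1 - x0))\<^sup>2)" using k by simp
    then have "\<bar>S x1\<bar> * exp (- k * \<rho>\<^sup>2) \<le> G x1" unfolding G_def by (intro mult_left_mono) auto
    moreover have "M * exp (- (2 * k * \<rho>\<^sup>2)) * exp (- k * \<rho>\<^sup>2) < \<bar>S x1\<bar> * exp (- k * \<rho>\<^sup>2)"
      using x1gt by (intro mult_strict_right_mono) auto
    ultimately show ?thesis by (simp add: mult.assoc flip: exp_add)
  qed
  have "0 \<le> M * exp (- (3 * k * \<rho>\<^sup>2))" using M0 by simp
  then have m0: "0 < m" and mM: "M * exp (- (3 * k * \<rho>\<^sup>2)) < m" using Gx1 Gm[of x1] by linarith+
  \<comment> \<open>The point \<open>y\<close> has two duties: exceeding \<open>m / 2\<close>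
    contradicts the Bernstein inequality in the end, and exceeding the other bound places
    \<open>y\<close> within \<open>2 * \<rho>\<close> of \<open>x0\<close>. A near-maximum is enough
    for both, so the supremum may remain unattained.\<close>
  then have "max (m / 2) (M * exp (- (3 * k * \<rho>\<^sup>2))) < (SUP x. G x)" by (simp add: m_def[symmetric])
  then obtain y where y: "m / 2 < G y" "M * exp (- (3 * k * \<rho>\<^sup>2)) < G y"
    using less_cSUP_iff[OF UNIV_not_empty bdd] by auto
  have "norm (y - x0) < 2 * \<rho>"
  proof (rule ccontr)
    assume "\<not> ?thesis"
    then have "(2 * \<rho>)\<^sup>2 \<le> (norm (y - x0))\<^sup>2" using \<rho> by (intro power_mono) auto
    moreover have "(2 * \<rho>)\<^sup>2 = 4 * \<rho>\<^sup>2" by (simp add: power2_eq_square)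
    ultimately have "3 * \<rho>\<^sup>2 \<le> (norm (y - x0))\<^sup>2" using zero_le_power2[of \<rho>] by linarith
    then have "exp (- k * (norm (y - x0))\<^sup>2) \<le> exp (- (3 * k * \<rho>\<^sup>2))"
      using mult_left_mono[of "3 * \<rho>\<^sup>2" "(norm (y - x0))\<^sup>2" k] k by (simp add: mult.left_commute mult.commute)
    then have "G y \<le> M * exp (- (3 * k * \<rho>\<^sup>2))"
      unfolding G_def using Sle[of y] M0 by (intro mult_mono) auto
    then show False using y by simp
  qed
  then obtain z where z: "norm (y - z) \<le> h" "S z = 0" using dense by blast
  have "z \<noteq> y" using y m0 z by (auto simp: G_def)
  define t where "t = norm (z - y)"
  define e where "e = (1 / t) *\<^sub>R (z - y)"
  have t: "0 < t" "t \<le> h" using \<open>z \<noteq> y\<close> z by (auto simp: t_def norm_minus_commute)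
  have e: "norm e = 1" and zt: "y + t *\<^sub>R e = z" using t by (auto simp: e_def t_def[symmetric])
  obtain F where F: "F holomorphic_on {z. \<bar>Im z\<bar> < 2 * \<rho>}" "\<And>z. \<bar>Im z\<bar> \<le> \<rho> \<Longrightarrow> cmod (F z) \<le> M"
      "\<And>t. F (of_real t) = of_real (S (y + t *\<^sub>R e))"
    using SB e unfolding strip_bounded_def by metis
  \<comment> \<open>Pythagoras along the line through \<open>y\<close> and the zero
    \<open>z\<close>: the squared distance to \<open>x0\<close> is
    \<open>(s + b)\<^sup>2 + c\<close>, the form required by
    \<open>gaussian_strip_bound\<close>.\<close>
  define b where "b = e \<bullet> (y - x0)"
  define c where "c = (norm (y - x0))\<^sup>2 - b\<^sup>2"
  have "\<bar>b\<bar> \<le> norm (y - x0)" using Cauchy_Schwarz_ineq2[of e "y - x0"] e by (simp add: b_def)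
  then have c0: "0 \<le> c" using power_mono[of "\<bar>b\<bar>" "norm (y - x0)" 2] by (simp add: c_def)
  have nrm: "(norm (y + s *\<^sub>R e - x0))\<^sup>2 = (s + b)\<^sup>2 + c" for s
  proof -
    have "y + s *\<^sub>R e - x0 = (y - x0) + s *\<^sub>R e" by simp
    then have "(norm (y + s *\<^sub>R e - x0))\<^sup>2 = (norm (y - x0))\<^sup>2 + 2 * s * b + s\<^sup>2 * (norm e)\<^sup>2"
      by (simp only: power2_norm_eq_inner) (simp add: inner_add b_def inner_commute power2_eq_square algebra_simps)
    then show ?thesis using e by (simp add: c_def power2_eq_square algebra_simps)
  qed
  define H where "H = (\<lambda>w. F w * exp (- of_real k * ((w + of_real b)\<^sup>2 + of_real c)))"
  have HG: "cmod (H (of_real s)) = G (y + s *\<^sub>R e)" for s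
  proof -
    have "cmod (H (of_real s)) = \<bar>S (y + s *\<^sub>R e)\<bar> * exp (- k * ((s + b)\<^sup>2 + c))"
      unfolding H_def F(3) by (simp add: norm_mult power2_eq_square)
    then show ?thesis unfolding G_def nrm .
  qed
  have Hstrip: "cmod (H w) \<le> m * exp (4 * k * \<rho> * \<bar>Im w\<bar>)" if "\<bar>Im w\<bar> \<le> \<rho>" for w
    unfolding H_def
  proof (rule gaussian_strip_bound[OF F(1) \<rho> _ F(2) k m0 _ _ _ that])
    fix s :: real
    show "cmod (F (of_real s)) * exp (- k * ((s + b)\<^sup>2 + c)) \<le> m"
      using Gm[of "y + s *\<^sub>R e"] unfolding F(3) G_def nrm by simp
  next
    \<comment> \<open>Origin of the rate \<open>4 * k * \<rho>\<close>: \<open>M\<close> exceeds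
      \<open>m\<close> by a factor of at most \<open>exp (3 * k * \<rho>\<^sup>2)\<close>, and the
      Gaussian contributes one more \<open>exp (k * \<rho>\<^sup>2)\<close> in the strip.\<close>
    have "M * exp (k * (\<rho>\<^sup>2 - c)) \<le> M * exp (k * \<rho>\<^sup>2)"
      using M0 k c0 by (intro mult_left_mono) auto
    also have "\<dots> = M * exp (- (3 * k * \<rho>\<^sup>2)) * exp (4 * k * \<rho> * \<rho>)"
      by (simp add: mult.assoc power2_eq_square flip: exp_add) (simp add: algebra_simps)?
    also have "\<dots> \<le> m * exp (4 * k * \<rho> * \<rho>)" using mM by (intro mult_right_mono) auto
    finally show "M * exp (k * (\<rho>\<^sup>2 - c)) \<le> m * exp (4 * k * \<rho> * \<rho>)" .
  qed (use \<rho> k in auto)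
  have holH: "H holomorphic_on {z. \<bar>Im z\<bar> < 2 * \<rho>}"
    unfolding H_def by (intro holomorphic_intros F)
  \<comment> \<open>Between \<open>y\<close> and the zero, at distance \<open>t \<le> h\<close>, the
    weighted function drops from \<open>G y > m / 2\<close> to \<open>0\<close>, but the Bernstein
    inequality permits a drop of at most \<open>m / 2\<close>.\<close>
  have "cmod (H (of_real 0) - H (of_real t)) \<le> exp 1 * m * (4 * k * \<rho>) * \<bar>0 - t\<bar>"
  proof (rule strip_lipschitz[OF holH _ _ _ Hstrip])
    have "4 * k * \<rho> * \<rho> = \<rho> / (2 * exp 1 * h)" using \<rho> h by (simp add: k_def)
    then show "1 \<le> 4 * k * \<rho> * \<rho>" using h by simp
  qed (use \<rho> k in auto)
  moreover have "H (of_real t) = 0" unfolding H_def F(3) zt z by simp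
  moreover have "cmod (H (of_real 0)) = G y" using HG[of 0] by simp
  moreover have "exp 1 * m * (4 * k * \<rho>) * t \<le> exp 1 * m * (4 * k * \<rho>) * h"
    using t m0 k \<rho> by (intro mult_left_mono) auto
  moreover have "exp 1 * m * (4 * k * \<rho>) * h = 4 * m * (k * \<rho> * h * exp 1)"
    by (simp add: algebra_simps)
  ultimately show False using y t unfolding kk by simp
qed

text \<open>The line from \<open>x0\<close> through \<open>x\<close> is used: smallness on the real
  interval around \<open>x0\<close> passes to a complex disc and is then propagated to
  \<open>x\<close> in at most \<open>J\<close> steps. The condition on \<open>n\<close> says that
  \<open>4 ^ (2 ^ J * n)\<close> does not exceed the gain
  \<open>exp (\<rho> / (16 * exp 1 * h))\<close> on the disc.\<close>

lemma strip_bounded_small: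
  fixes S :: "'a::euclidean_space \<Rightarrow> real"
  assumes SB: "strip_bounded \<rho> M S" and \<rho>: "0 < \<rho>" and h: "0 < h" "2 * exp 1 * h \<le> \<rho>"
    and dense: "\<And>x. norm (x - x0) < 2 * \<rho> \<Longrightarrow> \<exists>z. norm (x - z) \<le> h \<and> S z = 0"
    and x: "norm (x - x0) \<le> real J * (\<rho> / 4)"
    and n: "ln 4 * real (2 ^ J * n) \<le> \<rho> / (16 * exp 1 * h)"
  shows "\<bar>S x\<bar> \<le> M / 4 ^ n"
proof (cases "M = 0")
  case True
  then show ?thesis using strip_bounded_abs_le[OF SB \<rho>, of x] by simp
next
  case False
  have M: "0 < M" using strip_bounded_abs_le[OF SB \<rho>, of x] False by linarith
  \<comment> \<open>The same \<open>k\<close> as on the ball. The exponent there is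
    \<open>2 * k * \<rho>\<^sup>2\<close>; the passage to the complex disc keeps a quarter of it,
    \<open>k * \<rho>\<^sup>2 / 2\<close>.\<close>
  define k where "k = 1 / (8 * exp 1 * \<rho> * h)"
  have k: "0 < k" using \<rho> h by (simp add: k_def)
  have k2: "- 2 * k * \<rho>\<^sup>2 = - \<rho> / (4 * exp 1 * h)" "k * \<rho>\<^sup>2 / 2 = \<rho> / (16 * exp 1 * h)"
    using \<rho> h by (simp_all add: k_def field_simps power2_eq_square)
  obtain e where e: "norm e = 1" "x = x0 + norm (x - x0) *\<^sub>R e"
  proof (cases "x = x0")
    case True
    then show ?thesis using vector_choose_size[of 1] that by auto
  next
    case False
    then show ?thesis using that[of "(1 / norm (x - x0)) *\<^sub>R (x - x0)"] by simp
  qed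
  obtain F where F: "F holomorphic_on {z. \<bar>Im z\<bar> < 2 * \<rho>}" "\<And>z. \<bar>Im z\<bar> \<le> \<rho> \<Longrightarrow> cmod (F z) \<le> M"
      "\<And>t. F (of_real t) = of_real (S (x0 + t *\<^sub>R e))"
    using SB e(1) unfolding strip_bounded_def by metis
  have disc: "cmod (F w) \<le> M / 4 ^ (2 ^ J * n)" if "cmod w \<le> \<rho> / 4" for w
  proof -
    have "cmod (F w) \<le> M * exp (- k * \<rho>\<^sup>2 / 2)"
    proof (rule strip_small_disc[OF F(1) \<rho> F(2) M k _ that])
      fix t :: real assume "\<bar>t\<bar> \<le> \<rho>"
      then have "norm (x0 + t *\<^sub>R e - x0) \<le> \<rho>" using e by simp
      from strip_bounded_small_on_ball[OF SB \<rho> h dense this]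
      show "cmod (F (of_real t)) \<le> M * exp (- 2 * k * \<rho>\<^sup>2)" unfolding F(3) k2 by simp
    qed
    also have "\<dots> \<le> M * exp (- (ln 4 * real (2 ^ J * n)))"
    proof -
      have "- k * \<rho>\<^sup>2 / 2 \<le> - (ln 4 * real (2 ^ J * n))" using n k2(2) by linarith
      then show ?thesis using M by simp
    qed
    also have "exp (- (ln 4 * real (2 ^ J * n))) = 1 / 4 ^ (2 ^ J * n)"
      by (simp add: exp_minus exp_of_nat2_mult inverse_eq_divide del: of_nat_mult)
    finally show ?thesis by simp
  qed
  define t where "t = norm (x - x0)"
  \<comment> \<open>Index of the last disc centre that does not lie beyond the parameter
    \<open>t\<close> of \<open>x\<close>.\<close>
  define j where "j = nat \<lfloor>t / (\<rho> / 4)\<rfloor>"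
  have j: "real j \<le> t / (\<rho> / 4)" "t / (\<rho> / 4) \<le> real j + 1"
    using \<rho> unfolding j_def t_def by (auto simp: of_nat_nat)
  have "t / (\<rho> / 4) \<le> real J" using x \<rho> unfolding t_def by (subst pos_divide_le_eq) auto
  then have "real j \<le> real J" using j(1) by linarith
  then have jJ: "j \<le> J" by simp
  have "cmod (F (of_real t)) \<le> M / 4 ^ (2 ^ (J - j) * n)"
  proof (rule strip_propagation[OF F(1) \<rho> F(2) disc jJ])
    have "\<bar>real j * (\<rho> / 4) - t\<bar> \<le> \<rho> / 4" using j \<rho> by (simp add: field_simps abs_le_iff)
    then show "dist (of_real (real j * (\<rho> / 4))) (complex_of_real t) \<le> \<rho> / 4"
      by (simp only: dist_of_real dist_real_def)
  qed
  also have "\<dots> \<le> M / 4 ^ n" using M by (intro divide_left_mono power_increasing) auto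
  finally show ?thesis using e(2) unfolding F(3) t_def by simp
qed

section \<open>The multiquadric as a kernel on the unit ball\<close>

lemma neg_binomial_complex_sums:
  assumes "cmod w < 1"
  shows "(\<lambda>n. of_real (pochhammer \<beta> n / fact n) * w ^ n) sums (1 - w) powr (- of_real \<beta>)"
proof -
  have "(- of_real \<beta> gchoose n) * (- w) ^ n = of_real (pochhammer \<beta> n / fact n) * w ^ n" for n
    by (simp add: gbinomial_pochhammer pochhammer_of_real power_minus[of w])
      (simp add: mult.assoc[symmetric] flip: power_mult_distrib)?
  with gen_binomial_complex[of "- w" "- of_real \<beta>"] assms show ?thesis by simp
qed

lemma neg_binomial_real_sums:
  fixes x :: real
  assumes "\<bar>x\<bar> < 1"
  shows "(\<lambda>n. pochhammer \<beta> n / fact n * x ^ n) sums (1 - x) powr (- \<beta>)"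
proof -
  have "(- \<beta> gchoose n) * (- x) ^ n = pochhammer \<beta> n / fact n * x ^ n" for n
    by (simp add: gbinomial_pochhammer power_minus[of x])
      (simp add: mult.assoc[symmetric] flip: power_mult_distrib)?
  with gen_binomial_real[of "- x" "- \<beta>"] assms show ?thesis by simp
qed

text \<open>The coordinates of the \<open>n\<close>-th tensor power are indexed by words of length \<open>n\<close>.\<close>

lemma tensor_power_Cauchy_Schwarz:
  fixes Z :: "'k::finite \<Rightarrow> complex" and Y :: "'j \<Rightarrow> 'k \<Rightarrow> real" and a :: "'j \<Rightarrow> real"
  shows "(cmod (\<Sum>j\<in>A. of_real (a j) * (\<Sum>l\<in>UNIV. Z l * of_real (Y j l)) ^ n))\<^sup>2
    \<le> (\<Sum>l\<in>UNIV. (cmod (Z l))\<^sup>2) ^ n * (\<Sum>i\<in>A. \<Sum>j\<in>A. a i * a j * (\<Sum>l\<in>UNIV. Y i l * Y j l) ^ n)"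
proof -
  let ?S = "\<lambda>j. \<Sum>l\<in>UNIV. Z l * of_real (Y j l)" and ?Z = "\<Sum>l\<in>UNIV. (cmod (Z l))\<^sup>2"
  define W :: "(nat \<Rightarrow> 'k) set" where "W = PiE {..<n} (\<lambda>_. UNIV)"
  \<comment> \<open>\<open>T g\<close> is the coordinate at the word \<open>g\<close> of the
    combination of the \<open>n\<close>-th tensor powers of the \<open>Y j\<close> with coefficients
    \<open>a j\<close>. The double sum in the conclusion is the squared norm of this tensor.\<close>
  define T where "T = (\<lambda>g. \<Sum>j\<in>A. a j * (\<Prod>m<n. Y j (g m)))"
  have pw: "(\<Sum>l\<in>UNIV. p l) ^ n = (\<Sum>g\<in>W. \<Prod>m<n. p (g m))" for p :: "'k \<Rightarrow> 'c::comm_semiring_1"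
    using prod_sum_PiE[of "{..<n}" "\<lambda>_. UNIV :: 'k set" "\<lambda>_. p"] by (simp add: W_def)
  have "(\<Sum>j\<in>A. of_real (a j) * ?S j ^ n) = (\<Sum>g\<in>W. (\<Prod>m<n. Z (g m)) * of_real (T g))"
    unfolding pw T_def
    by (simp add: sum_distrib_left prod.distrib mult_ac) (rule sum.swap)
  then have "cmod (\<Sum>j\<in>A. of_real (a j) * ?S j ^ n)
      \<le> (\<Sum>g\<in>W. (\<Prod>m<n. cmod (Z (g m))) * \<bar>T g\<bar>)"
    using norm_sum[of "\<lambda>g. (\<Prod>m<n. Z (g m)) * of_real (T g)" W] by (simp add: norm_mult prod_norm)
  then have "(cmod (\<Sum>j\<in>A. of_real (a j) * ?S j ^ n))\<^sup>2
      \<le> (\<Sum>g\<in>W. (\<Prod>m<n. cmod (Z (g m))) * \<bar>T g\<bar>)\<^sup>2"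
    by (intro power_mono) auto
  also have "\<dots> \<le> (\<Sum>g\<in>W. (\<Prod>m<n. cmod (Z (g m)))\<^sup>2) * (\<Sum>g\<in>W. \<bar>T g\<bar>\<^sup>2)"
    by (rule Cauchy_Schwarz_ineq_sum)
  also have "(\<Sum>g\<in>W. (\<Prod>m<n. cmod (Z (g m)))\<^sup>2) = ?Z ^ n"
    unfolding pw by (simp add: prod_power_distrib)
  also have "(\<Sum>g\<in>W. \<bar>T g\<bar>\<^sup>2) = (\<Sum>g\<in>W. \<Sum>i\<in>A. \<Sum>j\<in>A. a i * a j * (\<Prod>m<n. Y i (g m) * Y j (g m)))"
    by (simp add: T_def power2_eq_square sum_product prod.distrib mult_ac)
  also have "\<dots> = (\<Sum>i\<in>A. \<Sum>j\<in>A. \<Sum>g\<in>W. a i * a j * (\<Prod>m<n. Y i (g m) * Y j (g m)))"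
    by (subst sum.swap) (intro sum.cong refl sum.swap)
  also have "\<dots> = (\<Sum>i\<in>A. \<Sum>j\<in>A. a i * a j * (\<Sum>l\<in>UNIV. Y i l * Y j l) ^ n)"
    unfolding pw by (simp add: sum_distrib_left)
  finally show ?thesis .
qed

lemma abs_sum_prod_lt_1:
  fixes Z :: "'k::finite \<Rightarrow> complex" and Y :: "'k \<Rightarrow> real"
  assumes "(\<Sum>l\<in>UNIV. (cmod (Z l))\<^sup>2) < 1" "(\<Sum>l\<in>UNIV. (Y l)\<^sup>2) < 1"
  shows "cmod (\<Sum>l\<in>UNIV. Z l * of_real (Y l)) < 1"
proof -
  have "cmod (\<Sum>l\<in>UNIV. Z l * of_real (Y l)) \<le> (\<Sum>l\<in>UNIV. cmod (Z l) * \<bar>Y l\<bar>)"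
    using norm_sum[of "\<lambda>l. Z l * of_real (Y l)" UNIV] by (simp add: norm_mult)
  then have "(cmod (\<Sum>l\<in>UNIV. Z l * of_real (Y l)))\<^sup>2 \<le> (\<Sum>l\<in>UNIV. cmod (Z l) * \<bar>Y l\<bar>)\<^sup>2"
    by (intro power_mono) auto
  also have "\<dots> \<le> (\<Sum>l\<in>UNIV. (cmod (Z l))\<^sup>2) * (\<Sum>l\<in>UNIV. \<bar>Y l\<bar>\<^sup>2)"
    by (rule Cauchy_Schwarz_ineq_sum)
  also have "\<dots> \<le> (\<Sum>l\<in>UNIV. (cmod (Z l))\<^sup>2) * 1"
    using assms by (intro mult_left_mono sum_nonneg) auto
  also have "\<dots> < 1" using assms by simp
  finally show ?thesis by (simp add: power_less_one_iff)
qed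

text \<open>The kernel \<open>(1 - x \<bullet> y) powr (- \<beta>)\<close> of the unit ball is positive definite with positive power series
  coefficients, so its sections extend to the complex unit ball, with the same norm.\<close>

lemma ball_kernel_bound:
  fixes Z :: "'k::finite \<Rightarrow> complex" and Y :: "'j \<Rightarrow> 'k \<Rightarrow> real" and a :: "'j \<Rightarrow> real"
  assumes \<beta>: "0 < \<beta>" and "finite A" and Z: "(\<Sum>l\<in>UNIV. (cmod (Z l))\<^sup>2) < 1"
    and Y: "\<And>j. j \<in> A \<Longrightarrow> (\<Sum>l\<in>UNIV. (Y j l)\<^sup>2) < 1"
  shows "(cmod (\<Sum>j\<in>A. of_real (a j) * (1 - (\<Sum>l\<in>UNIV. Z l * of_real (Y j l))) powr (- of_real \<beta>)))\<^sup>2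
    \<le> (1 - (\<Sum>l\<in>UNIV. (cmod (Z l))\<^sup>2)) powr (- \<beta>) *
       (\<Sum>i\<in>A. \<Sum>j\<in>A. a i * a j * (1 - (\<Sum>l\<in>UNIV. Y i l * Y j l)) powr (- \<beta>))"
proof -
  let ?S = "\<lambda>j. \<Sum>l\<in>UNIV. Z l * of_real (Y j l)" and ?Y = "\<lambda>i j. \<Sum>l\<in>UNIV. Y i l * Y j l"
  define b where "b = (\<lambda>n. pochhammer \<beta> n / fact n)"
  have b: "0 \<le> b n" for n using \<beta> by (simp add: b_def pochhammer_nonneg)
  define R where "R = (\<Sum>l\<in>UNIV. (cmod (Z l))\<^sup>2)"
  have R: "0 \<le> R" "R < 1" using Z by (auto simp: R_def intro: sum_nonneg)
  \<comment> \<open>Degree by degree: \<open>x n\<close> pairs the \<open>n\<close>-th tensor power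
    of \<open>Z\<close> with the combined tensor of the \<open>Y j\<close>, and \<open>q n\<close>
    is the squared norm of that tensor.\<close>
  define x where "x = (\<lambda>n. \<Sum>j\<in>A. of_real (a j) * ?S j ^ n)"
  define q where "q = (\<lambda>n. \<Sum>i\<in>A. \<Sum>j\<in>A. a i * a j * ?Y i j ^ n)"
  have xq: "(cmod (x n))\<^sup>2 \<le> R ^ n * q n" for n
    unfolding x_def R_def q_def by (rule tensor_power_Cauchy_Schwarz)
  \<comment> \<open>Taking for \<open>Z\<close> a unit coordinate vector, with
    \<open>undefined\<close> as an arbitrary index, the factor in front of \<open>q n\<close> is 1,
    so \<open>q n\<close> bounds a square.\<close>
  have q0: "0 \<le> q n" for n
    using tensor_power_Cauchy_Schwarz[where A=A and a=a and Z="\<lambda>l. if l = undefined then 1 else 0" and Y=Y and n=n]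
    by (simp add: q_def if_distrib[of cmod] if_distrib[of "\<lambda>x. x\<^sup>2"] order_trans[OF zero_le_power2] cong: if_cong)
  define LHS where "LHS = (\<Sum>j\<in>A. of_real (a j) * (1 - ?S j) powr (- of_real \<beta>))"
  define Q where "Q = (\<Sum>i\<in>A. \<Sum>j\<in>A. a i * a j * (1 - ?Y i j) powr (- \<beta>))"
  have s1: "(\<lambda>n. of_real (b n) * x n) sums LHS"
  proof -
    have "(\<lambda>n. \<Sum>j\<in>A. of_real (a j) * (of_real (b n) * ?S j ^ n)) sums LHS"
      unfolding LHS_def b_def
      by (intro sums_sum sums_mult neg_binomial_complex_sums abs_sum_prod_lt_1 Z Y)
    then show ?thesis by (simp add: x_def sum_distrib_left mult_ac)
  qed
  have s2: "(\<lambda>n. b n * q n) sums Q"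
  proof -
    have "\<bar>\<Sum>l\<in>UNIV. Y i l * Y j l\<bar> < 1" if "i \<in> A" "j \<in> A" for i j
    proof -
      have "cmod (\<Sum>l\<in>UNIV. of_real (Y i l) * of_real (Y j l)) < 1"
        by (rule abs_sum_prod_lt_1) (use Y that in auto)
      then show ?thesis by (simp flip: of_real_mult of_real_sum)
    qed
    then have "(\<lambda>n. \<Sum>i\<in>A. \<Sum>j\<in>A. a i * a j * (b n * ?Y i j ^ n)) sums Q"
      unfolding Q_def b_def by (intro sums_sum sums_mult neg_binomial_real_sums)
    then show ?thesis by (simp add: q_def sum_distrib_left mult_ac)
  qed
  have s3: "(\<lambda>n. b n * R ^ n) sums (1 - R) powr (- \<beta>)"
    unfolding b_def using R by (intro neg_binomial_real_sums) auto
  \<comment> \<open>A second Cauchy-Schwarz inequality, now over the degree with the nonnegative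
    weights \<open>b n\<close>, separates the geometry of \<open>Z\<close> from the quadratic form.
    It is proved for partial sums and passed to the limit below.\<close>
  have part: "(cmod (\<Sum>n<N. of_real (b n) * x n))\<^sup>2 \<le> (1 - R) powr (- \<beta>) * Q" for N
  proof -
    have "cmod (\<Sum>n<N. of_real (b n) * x n) \<le> (\<Sum>n<N. b n * cmod (x n))"
      using norm_sum[of "\<lambda>n. of_real (b n) * x n" "{..<N}"] b by (simp add: norm_mult)
    also have "\<dots> \<le> (\<Sum>n<N. sqrt (b n * R ^ n) * sqrt (b n * q n))"
    proof (rule sum_mono)
      fix n
      have "cmod (x n) \<le> sqrt (R ^ n * q n)" using xq by (simp add: real_le_rsqrt)
      then have "b n * cmod (x n) \<le> b n * sqrt (R ^ n * q n)" using b by (intro mult_left_mono) auto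
      also have "\<dots> = sqrt (b n * R ^ n) * sqrt (b n * q n)"
        using b[of n] by (simp add: real_sqrt_mult)
      finally show "b n * cmod (x n) \<le> sqrt (b n * R ^ n) * sqrt (b n * q n)" .
    qed
    finally have "(cmod (\<Sum>n<N. of_real (b n) * x n))\<^sup>2 \<le> (\<Sum>n<N. sqrt (b n * R ^ n) * sqrt (b n * q n))\<^sup>2"
      by (intro power_mono) auto
    also have "\<dots> \<le> (\<Sum>n<N. (sqrt (b n * R ^ n))\<^sup>2) * (\<Sum>n<N. (sqrt (b n * q n))\<^sup>2)"
      by (rule Cauchy_Schwarz_ineq_sum)
    also have "\<dots> = (\<Sum>n<N. b n * R ^ n) * (\<Sum>n<N. b n * q n)"
      using b q0 R by simp
    also have "\<dots> \<le> (1 - R) powr (- \<beta>) * Q"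
    proof (rule mult_mono)
      show "(\<Sum>n<N. b n * R ^ n) \<le> (1 - R) powr (- \<beta>)"
        using sum_le_suminf[OF sums_summable[OF s3], of "{..<N}"] b R sums_unique[OF s3] by simp
      show "(\<Sum>n<N. b n * q n) \<le> Q"
        using sum_le_suminf[OF sums_summable[OF s2], of "{..<N}"] b q0 sums_unique[OF s2] by simp
    qed (use b q0 in \<open>auto intro!: sum_nonneg\<close>)
    finally show ?thesis .
  qed
  have "(\<lambda>N. (cmod (\<Sum>n<N. of_real (b n) * x n))\<^sup>2) \<longlonglongrightarrow> (cmod LHS)\<^sup>2"
    using s1 unfolding sums_def by (intro tendsto_intros)
  then have "(cmod LHS)\<^sup>2 \<le> (1 - R) powr (- \<beta>) * Q"
    by (rule Lim_bounded) (use part in auto)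
  then show ?thesis by (simp add: LHS_def R_def Q_def)
qed


section \<open>The multiquadric as a transported ball kernel\<close>

definition stereo_den :: "real \<Rightarrow> ('n::finite \<Rightarrow> 'a::real_field) \<Rightarrow> 'a" where
  "stereo_den \<epsilon> z = of_real (\<epsilon>\<^sup>2 / 2) + 1 + (\<Sum>i\<in>UNIV. (z i)\<^sup>2)"

text \<open>For \<open>\<epsilon> = 0\<close> and real \<open>z\<close> this is the inverse
  stereographic projection onto the unit sphere, with \<open>None\<close> as the polar coordinate.
  The shift \<open>\<epsilon>\<^sup>2 / 2\<close> in the denominator moves the image inside the
  ball. The formula involves no conjugation, so over the complex numbers it is holomorphic in
  \<open>z\<close> away from the zeros of the denominator.\<close>

definition stereo :: "real \<Rightarrow> ('n::finite \<Rightarrow> 'a::real_field) \<Rightarrow> 'n option \<Rightarrow> 'a" where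
  "stereo \<epsilon> z l = (case l of None \<Rightarrow> 1 - 2 / stereo_den \<epsilon> z | Some i \<Rightarrow> 2 * z i / stereo_den \<epsilon> z)"

lemma sum_UNIV_option: "(\<Sum>l\<in>UNIV. f l) = f None + (\<Sum>i\<in>UNIV. f (Some i))"
  for f :: "'n::finite option \<Rightarrow> 'a::comm_monoid_add"
  by (simp add: UNIV_option_conv sum.reindex)

text \<open>The multiquadric is, up to weights, the ball kernel composed with an inverse stereographic
  projection.\<close>

lemma stereo_identity:
  fixes z y :: "'n::finite \<Rightarrow> 'a::real_field"
  assumes "stereo_den \<epsilon> z \<noteq> 0" "stereo_den \<epsilon> y \<noteq> 0"
  shows "stereo_den \<epsilon> z * stereo_den \<epsilon> y * (1 - (\<Sum>l\<in>UNIV. stereo \<epsilon> z l * stereo \<epsilon> y l)) =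
    2 * (of_real (\<epsilon>\<^sup>2) + (\<Sum>i\<in>UNIV. (z i - y i)\<^sup>2))"
proof -
  let ?D = "stereo_den \<epsilon> z" and ?E = "stereo_den \<epsilon> y"
  have "(\<Sum>i\<in>UNIV. stereo \<epsilon> z (Some i) * stereo \<epsilon> y (Some i)) = 4 * (\<Sum>i\<in>UNIV. z i * y i) / (?D * ?E)"
    by (simp add: stereo_def sum_divide_distrib sum_distrib_left mult_ac)
  then have "(\<Sum>l\<in>UNIV. stereo \<epsilon> z l * stereo \<epsilon> y l) =
      (1 - 2 / ?D) * (1 - 2 / ?E) + 4 * (\<Sum>i\<in>UNIV. z i * y i) / (?D * ?E)"
    by (simp add: sum_UNIV_option) (simp add: stereo_def)
  then have "?D * ?E * (1 - (\<Sum>l\<in>UNIV. stereo \<epsilon> z l * stereo \<epsilon> y l)) =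
      2 * (?D + ?E - 2 - 2 * (\<Sum>i\<in>UNIV. z i * y i))"
    using assms by (simp add: field_simps)
  also have "?D + ?E - 2 - 2 * (\<Sum>i\<in>UNIV. z i * y i) = of_real (\<epsilon>\<^sup>2) + (\<Sum>i\<in>UNIV. (z i - y i)\<^sup>2)"
  proof -
    have "of_real (\<epsilon>\<^sup>2) = of_real (\<epsilon>\<^sup>2 / 2) + (of_real (\<epsilon>\<^sup>2 / 2) :: 'a)"
      by (simp only: of_real_add[symmetric]) simp
    then show ?thesis
      by (simp add: stereo_den_def power2_diff sum.distrib sum_subtractf sum_distrib_left mult.assoc)
  qed
  finally show ?thesis .
qed

lemma stereo_den_real_pos: "0 < stereo_den \<epsilon> (z :: 'n::finite \<Rightarrow> real)"
proof -
  have "0 \<le> (\<Sum>i\<in>UNIV. (z i)\<^sup>2)" by (simp add: sum_nonneg)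
  then show ?thesis using zero_le_power2[of \<epsilon>] by (simp add: stereo_den_def add.assoc add_nonneg_pos add_pos_nonneg)
qed

text \<open>On the diagonal the kernel identity reads: squared denominator times the distance of the
  squared norm from 1 equals \<open>2 * \<epsilon>\<^sup>2\<close>, which is positive.\<close>

lemma stereo_norm_lt_1:
  assumes "0 < \<epsilon>"
  shows "(\<Sum>l\<in>UNIV. (stereo \<epsilon> (z :: 'n::finite \<Rightarrow> real) l)\<^sup>2) < 1"
proof -
  have "\<epsilon> \<noteq> 0" using assms by simp
  have D: "0 < stereo_den \<epsilon> z" by (rule stereo_den_real_pos)
  have "0 < stereo_den \<epsilon> z * stereo_den \<epsilon> z * (1 - (\<Sum>l\<in>UNIV. stereo \<epsilon> z l * stereo \<epsilon> z l))"
    unfolding stereo_identity[OF less_imp_neq[OF D, symmetric] less_imp_neq[OF D, symmetric]]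
    using \<open>\<epsilon> \<noteq> 0\<close> by simp
  then show ?thesis using D by (simp add: power2_eq_square zero_less_mult_iff)
qed

text \<open>This is the kernel identity between \<open>z\<close> and its conjugate, whose
  coordinates differ by \<open>2 * \<i> * Im (z i)\<close>. It shows that the image stays in the
  complex ball as long as the imaginary part has Euclidean length below
  \<open>\<epsilon> / 2\<close>. This determines the width of the strip.\<close>

lemma stereo_complex_norm:
  fixes z :: "'n::finite \<Rightarrow> complex"
  assumes "stereo_den \<epsilon> z \<noteq> 0"
  shows "(cmod (stereo_den \<epsilon> z))\<^sup>2 * (1 - (\<Sum>l\<in>UNIV. (cmod (stereo \<epsilon> z l))\<^sup>2)) =
    2 * (\<epsilon>\<^sup>2 - 4 * (\<Sum>i\<in>UNIV. (Im (z i))\<^sup>2))"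
proof -
  let ?D = "stereo_den \<epsilon> z"
  have D: "0 < (cmod ?D)\<^sup>2" using assms by simp
  have "(cmod ?D)\<^sup>2 * (cmod (1 - 2 / ?D))\<^sup>2 = (cmod (?D - 2))\<^sup>2"
    using assms by (simp add: power_mult_distrib[symmetric] norm_mult[symmetric] algebra_simps del: power_mult_distrib)
  also have "\<dots> = (cmod ?D)\<^sup>2 - 4 * Re ?D + 4"
    unfolding cmod_power2 by (simp add: power2_eq_square algebra_simps)
  finally have 1: "(cmod ?D)\<^sup>2 * (cmod (1 - 2 / ?D))\<^sup>2 = (cmod ?D)\<^sup>2 - 4 * Re ?D + 4" .
  have 2: "(cmod ?D)\<^sup>2 * (\<Sum>i\<in>UNIV. (cmod (2 * z i / ?D))\<^sup>2) = 4 * (\<Sum>i\<in>UNIV. (cmod (z i))\<^sup>2)"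
    using D by (simp add: sum_distrib_left norm_mult norm_divide power_divide power_mult_distrib)
  have 3: "Re ?D = \<epsilon>\<^sup>2 / 2 + 1 + (\<Sum>i\<in>UNIV. (cmod (z i))\<^sup>2) - 2 * (\<Sum>i\<in>UNIV. (Im (z i))\<^sup>2)"
    by (simp add: stereo_den_def cmod_power2 Re_power2 sum.distrib sum_subtractf)
  have "(cmod ?D)\<^sup>2 * (1 - (\<Sum>l\<in>UNIV. (cmod (stereo \<epsilon> z l))\<^sup>2)) =
      (cmod ?D)\<^sup>2 - (cmod ?D)\<^sup>2 * (cmod (1 - 2 / ?D))\<^sup>2 - (cmod ?D)\<^sup>2 * (\<Sum>i\<in>UNIV. (cmod (2 * z i / ?D))\<^sup>2)"
    by (simp add: sum_UNIV_option stereo_def algebra_simps)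
  also have "\<dots> = 2 * (\<epsilon>\<^sup>2 - 4 * (\<Sum>i\<in>UNIV. (Im (z i))\<^sup>2))"
    unfolding 1 2 3 by (simp add: field_simps)
  finally show ?thesis .
qed

lemma gmq_kernel_stereo:
  fixes x y :: "real ^ 'n::finite"
  shows "gmq_kernel \<alpha> \<epsilon> x y = 2 powr ((real CARD('n) - \<alpha>) / 2) *
    stereo_den \<epsilon> (($) x) powr (- ((real CARD('n) - \<alpha>) / 2)) * stereo_den \<epsilon> (($) y) powr (- ((real CARD('n) - \<alpha>) / 2)) *
    (1 - (\<Sum>l\<in>UNIV. stereo \<epsilon> (($) x) l * stereo \<epsilon> (($) y) l)) powr (- ((real CARD('n) - \<alpha>) / 2))"
proof -
  define \<beta> where "\<beta> = (real CARD('n) - \<alpha>) / 2"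
  let ?D = "stereo_den \<epsilon> (($) x)" and ?E = "stereo_den \<epsilon> (($) y)"
  let ?P = "1 - (\<Sum>l\<in>UNIV. stereo \<epsilon> (($) x) l * stereo \<epsilon> (($) y) l)"
  have D: "0 < ?D" "0 < ?E" by (rule stereo_den_real_pos)+
  have id: "?D * ?E * ?P = 2 * (\<epsilon>\<^sup>2 + (norm (x - y))\<^sup>2)"
  proof -
    have "(norm (x - y))\<^sup>2 = (\<Sum>i\<in>UNIV. (x $ i - y $ i)\<^sup>2)"
      by (simp only: power2_norm_eq_inner inner_vec_def) (simp add: power2_eq_square)
    then show ?thesis using stereo_identity[of \<epsilon> "($) x" "($) y"] D by simp
  qed
  then have "0 \<le> ?D * ?E * ?P" by simp
  moreover have "0 < ?D * ?E" using D by simp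
  ultimately have P: "0 \<le> ?P" by (simp only: zero_le_mult_iff) linarith
  have "(\<alpha> - real CARD('n)) / 2 = - \<beta>" unfolding \<beta>_def by (simp only: minus_divide_left minus_diff_eq)
  then have "gmq_kernel \<alpha> \<epsilon> x y = (\<epsilon>\<^sup>2 + (norm (x - y))\<^sup>2) powr (- \<beta>)"
    by (simp add: gmq_kernel_def)
  also have "\<epsilon>\<^sup>2 + (norm (x - y))\<^sup>2 = inverse 2 * (?D * ?E * ?P)" using id by simp
  also have "\<dots> powr (- \<beta>) = (inverse 2) powr (- \<beta>) * (?D powr (- \<beta>) * ?E powr (- \<beta>) * ?P powr (- \<beta>))"
  proof -
    have "(inverse 2 * (A * B * C)) powr r = inverse 2 powr r * (A powr r * B powr r * C powr r)"
      if "0 < A" "0 < B" "0 \<le> C" for A B C r :: real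
      using that by (simp add: powr_mult powr_divide)
    then show ?thesis using D P by blast
  qed
  also have "(inverse 2 :: real) powr (- \<beta>) = 2 powr \<beta>"
    by (simp add: powr_minus powr_divide)
  finally show ?thesis by (simp add: \<beta>_def mult.assoc)
qed

lemma strip_bounded_mono:
  assumes "strip_bounded \<rho> M S" "\<rho>' \<le> \<rho>" "M \<le> M'"
  shows "strip_bounded \<rho>' M' S"
  unfolding strip_bounded_def
proof (intro allI impI)
  fix a e :: 'a assume "norm e = 1"
  then obtain F where F: "F holomorphic_on {z. \<bar>Im z\<bar> < 2 * \<rho>}" "\<forall>z. \<bar>Im z\<bar> \<le> \<rho> \<longrightarrow> cmod (F z) \<le> M"
      "\<forall>t. F (of_real t) = of_real (S (a + t *\<^sub>R e))"
    using assms(1) unfolding strip_bounded_def by metis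
  show "\<exists>F. F holomorphic_on {z. \<bar>Im z\<bar> < 2 * \<rho>'} \<and> (\<forall>z. \<bar>Im z\<bar> \<le> \<rho>' \<longrightarrow> cmod (F z) \<le> M') \<and>
        (\<forall>t. F (of_real t) = of_real (S (a + t *\<^sub>R e)))"
  proof (intro exI[of _ F] conjI)
    show "F holomorphic_on {z. \<bar>Im z\<bar> < 2 * \<rho>'}"
      by (rule holomorphic_on_subset[OF F(1)]) (use assms(2) in auto)
    show "\<forall>z. \<bar>Im z\<bar> \<le> \<rho>' \<longrightarrow> cmod (F z) \<le> M'"
      using F(2) assms(2,3) by (meson order_trans)
    show "\<forall>t. F (of_real t) = of_real (S (a + t *\<^sub>R e))" by (rule F(3))
  qed
qed

text \<open>Along a unit direction the imaginary part of the point has length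
  \<open>\<bar>Im w\<bar>\<close>. The weight of the complex point and the factor from
  \<open>ball_kernel_bound\<close> combine, by \<open>stereo_complex_norm\<close>, to a power of
  \<open>\<epsilon>\<^sup>2 - 4 * (Im w)\<^sup>2\<close>. The dependence on the real part cancels,
  so the bound is uniform over all lines; for \<open>\<bar>Im w\<bar> \<le> \<epsilon> / 4\<close>
  the base is at least \<open>3 * \<epsilon>\<^sup>2 / 4\<close>. The double sum is the squared
  native norm when the nodes lie in the domain.\<close>

lemma gmq_strip_bounded:
  fixes Y :: "(real ^ 'n::finite) set" and c :: "real ^ 'n \<Rightarrow> real"
  assumes \<epsilon>: "0 < \<epsilon>" and \<alpha>: "\<alpha> < real CARD('n)" and fin: "finite Y"
  shows "strip_bounded (\<epsilon> / 4)
    (sqrt ((3 * \<epsilon>\<^sup>2 / 4) powr ((\<alpha> - real CARD('n)) / 2) * (\<Sum>y\<in>Y. \<Sum>z\<in>Y. c y * c z * gmq_kernel \<alpha> \<epsilon> y z)))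
    (\<lambda>x. \<Sum>y\<in>Y. c y * gmq_kernel \<alpha> \<epsilon> x y)"
  unfolding strip_bounded_def
proof (intro allI impI)
  fix a e :: "real ^ 'n" assume e: "norm e = 1"
  let ?strip = "{w. \<bar>Im w\<bar> < 2 * (\<epsilon> / 4)}"
  define \<beta> where "\<beta> = (real CARD('n) - \<alpha>) / 2"
  have \<beta>: "0 < \<beta>" using \<alpha> by (simp add: \<beta>_def)
  define Q where "Q = (\<Sum>y\<in>Y. \<Sum>z\<in>Y. c y * c z * gmq_kernel \<alpha> \<epsilon> y z)"
  define z where "z = (\<lambda>w i. of_real (a $ i) + w * of_real (e $ i) :: complex)"
  define D where "D = (\<lambda>w. stereo_den \<epsilon> (z w))"
  define E where "E = (\<lambda>y :: real ^ 'n. stereo_den \<epsilon> (($) y))"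
  \<comment> \<open>The real weights of the nodes are absorbed into the coefficients, so that only
    the pure ball kernel remains.\<close>
  define b where "b = (\<lambda>y. c y * E y powr (- \<beta>))"
  define P where "P = (\<lambda>w y. 1 - (\<Sum>l\<in>UNIV. stereo \<epsilon> (z w) l * of_real (stereo \<epsilon> (($) y) l)))"
  define F where "F = (\<lambda>w. of_real (2 powr \<beta>) * D w powr (- of_real \<beta>) *
      (\<Sum>y\<in>Y. of_real (b y) * P w y powr (- of_real \<beta>)))"
  have e1: "(\<Sum>i\<in>UNIV. (e $ i)\<^sup>2) = 1"
    using e by (simp add: norm_eq_1 inner_vec_def power2_eq_square)
  have im: "(\<Sum>i\<in>UNIV. (Im (z w i))\<^sup>2) = (Im w)\<^sup>2" for w
    by (simp add: z_def power_mult_distrib e1 flip: sum_distrib_left)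
  \<comment> \<open>The denominator stays in the right half plane, off the branch cut of the complex
    power. The same is achieved for the ball kernel by \<open>Pp\<close>.\<close>
  have ReD: "1 \<le> Re (D w)" if "\<bar>Im w\<bar> < 2 * (\<epsilon> / 4)" for w
  proof -
    have "(Im w)\<^sup>2 \<le> (\<epsilon> / 2)\<^sup>2" using that \<epsilon> by (simp add: abs_le_square_iff[symmetric])
    then have "(\<Sum>i\<in>UNIV. (Im (z w i))\<^sup>2) \<le> \<epsilon>\<^sup>2 / 2" 
      unfolding im using zero_le_power2[of \<epsilon>] by (simp add: power_divide, linarith)
    moreover have "Re (D w) = \<epsilon>\<^sup>2 / 2 + 1 + (\<Sum>i\<in>UNIV. (Re (z w i))\<^sup>2) - (\<Sum>i\<in>UNIV. (Im (z w i))\<^sup>2)"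
      by (simp add: D_def stereo_den_def Re_power2 sum_subtractf)
    moreover have "0 \<le> (\<Sum>i\<in>UNIV. (Re (z w i))\<^sup>2)" by (intro sum_nonneg) auto
    ultimately show ?thesis by linarith
  qed
  then have D0: "D w \<noteq> 0" and Dp: "D w \<notin> \<real>\<^sub>\<le>\<^sub>0" if "\<bar>Im w\<bar> < 2 * (\<epsilon> / 4)" for w
    using that by (force simp: complex_nonpos_Reals_iff)+
  have nrm: "(cmod (D w))\<^sup>2 * (1 - (\<Sum>l\<in>UNIV. (cmod (stereo \<epsilon> (z w) l))\<^sup>2)) = 2 * (\<epsilon>\<^sup>2 - 4 * (Im w)\<^sup>2)"
    if "\<bar>Im w\<bar> < 2 * (\<epsilon> / 4)" for w
    using stereo_complex_norm[of \<epsilon> "z w"] D0[OF that] by (simp add: D_def im)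
  have Z1: "(\<Sum>l\<in>UNIV. (cmod (stereo \<epsilon> (z w) l))\<^sup>2) < 1" if "\<bar>Im w\<bar> < 2 * (\<epsilon> / 4)" for w
  proof -
    have "(2 * Im w)\<^sup>2 < \<epsilon>\<^sup>2" 
      using power_strict_mono[of "\<bar>2 * Im w\<bar>" \<epsilon> 2] that by simp
    then have "0 < (cmod (D w))\<^sup>2 * (1 - (\<Sum>l\<in>UNIV. (cmod (stereo \<epsilon> (z w) l))\<^sup>2))"
      unfolding nrm[OF that] by (simp add: power_mult_distrib)
    then show ?thesis by (simp add: zero_less_mult_iff)
  qed
  have Pp: "P w y \<notin> \<real>\<^sub>\<le>\<^sub>0" if "\<bar>Im w\<bar> < 2 * (\<epsilon> / 4)" for w y
  proof -
    have "cmod (1 - P w y) < 1"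
      unfolding P_def using abs_sum_prod_lt_1[OF Z1[OF that] stereo_norm_lt_1[OF \<epsilon>, of "($) y"]] by simp
    then have "0 < Re (P w y)" using abs_Re_le_cmod[of "1 - P w y"] by simp
    then show ?thesis by (auto simp: complex_nonpos_Reals_iff)
  qed
  have hol_st: "(\<lambda>w. stereo \<epsilon> (z w) l) holomorphic_on ?strip" for l
    using D0 unfolding stereo_def D_def stereo_den_def z_def
    by (cases l) (auto intro!: holomorphic_intros)
  have holD: "D holomorphic_on ?strip"
    unfolding D_def stereo_den_def z_def by (intro holomorphic_intros)
  have "F holomorphic_on ?strip"
    unfolding F_def P_def using Pp Dp
    by (intro holomorphic_intros holD hol_st) (auto simp: P_def)
  moreover have "cmod (F w) \<le> sqrt ((3 * \<epsilon>\<^sup>2 / 4) powr ((\<alpha> - real CARD('n)) / 2) * Q)" if w: "\<bar>Im w\<bar> \<le> \<epsilon> / 4" for w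
  proof -
    have w2: "\<bar>Im w\<bar> < 2 * (\<epsilon> / 4)" using w \<epsilon> by simp
    let ?s = "\<Sum>y\<in>Y. of_real (b y) * P w y powr (- of_real \<beta>)"
    let ?N = "1 - (\<Sum>l\<in>UNIV. (cmod (stereo \<epsilon> (z w) l))\<^sup>2)"
    let ?q = "\<Sum>y\<in>Y. \<Sum>y'\<in>Y. b y * b y' * (1 - (\<Sum>l\<in>UNIV. stereo \<epsilon> (($) y) l * stereo \<epsilon> (($) y') l)) powr (- \<beta>)"
    have Q: "2 powr \<beta> * ?q = Q"
      by (simp add: Q_def b_def E_def gmq_kernel_stereo \<beta>_def sum_distrib_left mult_ac)
    have cs: "(cmod ?s)\<^sup>2 \<le> ?N powr (- \<beta>) * ?q"
      unfolding P_def by (intro ball_kernel_bound \<beta> fin Z1 w2 stereo_norm_lt_1 \<epsilon>)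
    have nF: "cmod (F w) = 2 powr \<beta> * cmod (D w) powr (- \<beta>) *
        cmod ?s"
      by (simp add: F_def norm_mult norm_powr_real_powr')
    have "(cmod (F w))\<^sup>2 = (2 powr \<beta> * cmod (D w) powr (- \<beta>))\<^sup>2 *
        (cmod ?s)\<^sup>2"
      by (simp only: nF power_mult_distrib)
    also have "\<dots> \<le> (2 powr \<beta> * cmod (D w) powr (- \<beta>))\<^sup>2 * (?N powr (- \<beta>) * ?q)"
      by (rule mult_left_mono[OF cs zero_le_power2])
    also have "\<dots> = 2 powr \<beta> * (((cmod (D w))\<^sup>2) powr (- \<beta>) * ?N powr (- \<beta>)) * (2 powr \<beta> * ?q)"
      by (simp add: power_mult_distrib power2_eq_square powr_mult)
    also have "((cmod (D w))\<^sup>2) powr (- \<beta>) * ?N powr (- \<beta>) = (2 * (\<epsilon>\<^sup>2 - 4 * (Im w)\<^sup>2)) powr (- \<beta>)"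
      unfolding nrm[OF w2, symmetric] using Z1[OF w2] by (simp add: powr_mult)
    also have "2 powr \<beta> * (2 * (\<epsilon>\<^sup>2 - 4 * (Im w)\<^sup>2)) powr (- \<beta>) * (2 powr \<beta> * ?q) = (\<epsilon>\<^sup>2 - 4 * (Im w)\<^sup>2) powr (- \<beta>) * Q"
    proof -
      have "(2 * (\<epsilon>\<^sup>2 - 4 * (Im w)\<^sup>2)) powr (- \<beta>) = 2 powr (- \<beta>) * (\<epsilon>\<^sup>2 - 4 * (Im w)\<^sup>2) powr (- \<beta>)"
        by (rule powr_mult)
      moreover have "2 powr \<beta> * 2 powr (- \<beta>) = (1 :: real)" by (simp flip: powr_add)
      ultimately show ?thesis unfolding Q by (simp only: mult.assoc[symmetric] mult_1)
    qed
    also have "\<dots> \<le> (3 * \<epsilon>\<^sup>2 / 4) powr (- \<beta>) * Q"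
    proof (rule mult_right_mono)
      have "(Im w)\<^sup>2 \<le> (\<epsilon> / 4)\<^sup>2" using w \<epsilon> by (simp add: abs_le_square_iff[symmetric])
      then have "3 * \<epsilon>\<^sup>2 / 4 \<le> \<epsilon>\<^sup>2 - 4 * (Im w)\<^sup>2" by (simp add: power_divide)
      then show "(\<epsilon>\<^sup>2 - 4 * (Im w)\<^sup>2) powr (- \<beta>) \<le> (3 * \<epsilon>\<^sup>2 / 4) powr (- \<beta>)"
        using \<epsilon> \<beta> by (intro powr_mono2') auto
      \<comment> \<open>Nonnegativity of the quadratic form is read off from the bound itself, whose
        left side is a square.\<close>
      have "0 \<le> ?N powr (- \<beta>) * ?q"
        by (rule order_trans[OF zero_le_power2 cs])
      moreover have "0 < ?N powr (- \<beta>)" using Z1[OF w2] by simp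
      ultimately have "0 \<le> ?q" by (simp only: zero_le_mult_iff) auto
      then show "0 \<le> Q" unfolding Q[symmetric] by simp
    qed
    finally have "(cmod (F w))\<^sup>2 \<le> (3 * \<epsilon>\<^sup>2 / 4) powr (- \<beta>) * Q" .
    moreover have "- \<beta> = (\<alpha> - real CARD('n)) / 2" unfolding \<beta>_def by (simp only: minus_divide_left minus_diff_eq)
    ultimately show ?thesis by (simp only: real_le_rsqrt)
  qed
  moreover have "F (of_real t) = of_real (\<Sum>y\<in>Y. c y * gmq_kernel \<alpha> \<epsilon> (a + t *\<^sub>R e) y)" for t
  proof -
    let ?x = "a + t *\<^sub>R e"
    have zt: "z (of_real t) = (\<lambda>i. of_real (?x $ i))" by (simp add: z_def fun_eq_iff)
    have Dt: "D (of_real t) = of_real (E ?x)" by (simp add: D_def E_def stereo_den_def zt)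
    have st: "stereo \<epsilon> (z (of_real t)) l = of_real (stereo \<epsilon> (($) ?x) l)" for l
      using Dt by (simp add: stereo_def D_def E_def split: option.split) (simp add: zt)
    define p where "p = (\<lambda>y :: real ^ 'n. 1 - (\<Sum>l\<in>UNIV. stereo \<epsilon> (($) ?x) l * stereo \<epsilon> (($) y) l))"
    have Pt: "P (of_real t) y = of_real (p y)" for y by (simp add: P_def st p_def)
    have E0: "0 < E y" for y unfolding E_def by (rule stereo_den_real_pos)
    have "p y > 0" for y
    proof -
      have "0 < E ?x * E y * p y"
        using stereo_identity[of \<epsilon> "($) ?x" "($) y"] E0[of ?x] E0[of y] \<epsilon>
        by (simp add: E_def p_def add_pos_nonneg sum_nonneg)
      then show ?thesis by (rule zero_less_mult_pos) (simp add: E0)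
    qed
    then have "F (of_real t) = of_real (2 powr \<beta> * E ?x powr (- \<beta>) * (\<Sum>y\<in>Y. b y * p y powr (- \<beta>)))"
      using E0[of ?x] unfolding F_def Dt Pt
      by (simp add: powr_of_real less_imp_le flip: of_real_minus)
    also have "2 powr \<beta> * E ?x powr (- \<beta>) * (\<Sum>y\<in>Y. b y * p y powr (- \<beta>)) = (\<Sum>y\<in>Y. c y * gmq_kernel \<alpha> \<epsilon> ?x y)"
      unfolding gmq_kernel_stereo \<beta>_def[symmetric] b_def p_def E_def by (simp add: sum_distrib_left mult_ac)
    finally show ?thesis .
  qed
  ultimately show "\<exists>F. F holomorphic_on ?strip \<and>
      (\<forall>w. \<bar>Im w\<bar> \<le> \<epsilon> / 4 \<longrightarrow> cmod (F w) \<le> sqrt ((3 * \<epsilon>\<^sup>2 / 4) powr ((\<alpha> - real CARD('n)) / 2) * (\<Sum>y\<in>Y. \<Sum>z\<in>Y. c y * c z * gmq_kernel \<alpha> \<epsilon> y z))) \<and>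
      (\<forall>t. F (of_real t) = of_real (\<Sum>y\<in>Y. c y * gmq_kernel \<alpha> \<epsilon> (a + t *\<^sub>R e) y))"
    unfolding Q_def by blast
qed

section \<open>Interpolation in reproducing kernel Hilbert spaces\<close>

lemma is_rkhs_linear:
  assumes "is_rkhs D K H ip"
  shows "\<And>g k. g \<in> H \<Longrightarrow> k \<in> H \<Longrightarrow> (\<lambda>x. g x + k x) \<in> H"
    and "\<And>r g. g \<in> H \<Longrightarrow> (\<lambda>x. r * g x) \<in> H"
    and "(\<lambda>_. 0) \<in> H"
  using assms unfolding is_rkhs_def by blast+

lemma is_rkhs_ip:
  assumes "is_rkhs D K H ip"
  shows "\<And>g k. g \<in> H \<Longrightarrow> k \<in> H \<Longrightarrow> ip g k = ip k g"
    and "\<And>g k l. g \<in> H \<Longrightarrow> k \<in> H \<Longrightarrow> l \<in> H \<Longrightarrow> ip (\<lambda>x. g x + k x) l = ip g l + ip k l"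
    and "\<And>r g k. g \<in> H \<Longrightarrow> k \<in> H \<Longrightarrow> ip (\<lambda>x. r * g x) k = r * ip g k"
    and "\<And>g. g \<in> H \<Longrightarrow> 0 \<le> ip g g"
    and "\<And>g. g \<in> H \<Longrightarrow> ip g g = 0 \<Longrightarrow> g = (\<lambda>_. 0)"
    and "\<And>y. y \<in> D \<Longrightarrow> zero_ext D (\<lambda>x. K x y) \<in> H"
    and "\<And>y g. y \<in> D \<Longrightarrow> g \<in> H \<Longrightarrow> ip g (zero_ext D (\<lambda>x. K x y)) = g y"
  using assms unfolding is_rkhs_def by blast+

lemma is_rkhs_diff:
  assumes R: "is_rkhs D K H ip" and "g \<in> H" "k \<in> H"
  shows "(\<lambda>x. g x - k x) \<in> H"
    and "l \<in> H \<Longrightarrow> ip (\<lambda>x. g x - k x) l = ip g l - ip k l"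
proof -
  have k: "(\<lambda>x. (- 1) * k x) \<in> H" by (rule is_rkhs_linear(2)[OF R assms(3)])
  have eq: "(\<lambda>x. g x - k x) = (\<lambda>x. g x + (- 1) * k x)" by simp
  show "(\<lambda>x. g x - k x) \<in> H" unfolding eq by (rule is_rkhs_linear(1)[OF R assms(2) k])
  show "ip (\<lambda>x. g x - k x) l = ip g l - ip k l" if "l \<in> H"
    unfolding eq using is_rkhs_ip(2)[OF R assms(2) k that] is_rkhs_ip(3)[OF R assms(3) that, of "- 1"] by simp
qed

lemma is_rkhs_Cauchy_Schwarz:
  assumes R: "is_rkhs D K H ip" and g: "g \<in> H" and k: "k \<in> H"
  shows "\<bar>ip g k\<bar> \<le> ip_norm ip g * ip_norm ip k"
proof -
  note ip = is_rkhs_ip[OF R] and lin = is_rkhs_linear[OF R] and df = is_rkhs_diff[OF R]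
  have *: "(ip g k)\<^sup>2 \<le> ip g g * ip k k"
  proof (cases "ip k k = 0")
    case True
    then have "k = (\<lambda>_. 0)" by (rule ip(5)[OF k])
    then have "ip g k = 0" using ip(3)[OF k g, of 0] ip(1)[OF g k] by simp
    then show ?thesis using ip(4)[OF g] ip(4)[OF k] by simp
  next
    case False
    then have pos: "0 < ip k k" using ip(4)[OF k] by simp
    define s where "s = ip g k / ip k k"
    have sk: "(\<lambda>x. s * k x) \<in> H" by (rule lin(2)[OF k])
    note h = df(1)[OF g sk]
    have "0 \<le> ip (\<lambda>x. g x - s * k x) (\<lambda>x. g x - s * k x)" by (rule ip(4)[OF h])
    also have "\<dots> = ip (\<lambda>x. g x - s * k x) g - s * ip (\<lambda>x. g x - s * k x) k"
      using df(2)[OF g sk h] ip(1)[OF g h] ip(3)[OF k h, of s] ip(1)[OF k h] by simp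
    also have "\<dots> = ip g g - 2 * s * ip g k + s\<^sup>2 * ip k k"
    proof -
      have A: "ip (\<lambda>x. g x - s * k x) g = ip g g - s * ip g k"
        using df(2)[OF g sk g] ip(3)[OF k g, of s] ip(1)[OF g k] by simp
      have B: "ip (\<lambda>x. g x - s * k x) k = ip g k - s * ip k k"
        using df(2)[OF g sk k] ip(3)[OF k k, of s] by simp
      show ?thesis unfolding A B by (simp add: algebra_simps power2_eq_square)
    qed
    also have "\<dots> = ip g g - (ip g k)\<^sup>2 / ip k k"
      using pos by (simp add: s_def power2_eq_square field_simps)
    finally show ?thesis using pos by (simp add: field_simps)
  qed
  then have "sqrt ((ip g k)\<^sup>2) \<le> sqrt (ip g g * ip k k)" by (rule real_sqrt_le_mono)
  then show ?thesis by (simp add: ip_norm_def real_sqrt_mult)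
qed

lemma is_rkhs_kernel_sum:
  assumes R: "is_rkhs D K H ip" and "finite X" "X \<subseteq> D"
  shows "zero_ext D (\<lambda>x. \<Sum>z\<in>X. c z * K x z) \<in> H"
  using assms(2,3)
proof (induction X)
  case empty
  then show ?case using is_rkhs_linear(3)[OF R] by (simp add: zero_ext_def)
next
  case (insert z X)
  have "(\<lambda>x. c z * zero_ext D (\<lambda>x. K x z) x + zero_ext D (\<lambda>x. \<Sum>z\<in>X. c z * K x z) x) \<in> H"
    using insert by (intro is_rkhs_linear[OF R] is_rkhs_ip(6)[OF R]) auto
  also have "(\<lambda>x. c z * zero_ext D (\<lambda>x. K x z) x + zero_ext D (\<lambda>x. \<Sum>z\<in>X. c z * K x z) x) =
      zero_ext D (\<lambda>x. \<Sum>z\<in>insert z X. c z * K x z)"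
    using insert by (auto simp: zero_ext_def fun_eq_iff)
  finally show ?case .
qed

lemma is_rkhs_ip_kernel_sum:
  assumes R: "is_rkhs D K H ip" and "finite X" "X \<subseteq> D" and g: "g \<in> H"
  shows "ip g (zero_ext D (\<lambda>x. \<Sum>z\<in>X. c z * K x z)) = (\<Sum>z\<in>X. c z * g z)"
  using assms(2,3)
proof (induction X)
  case empty
  have "ip (\<lambda>_. 0) g = 0" using is_rkhs_ip(3)[OF R g g, of 0] by simp
  then show ?case using is_rkhs_ip(1)[OF R g is_rkhs_linear(3)[OF R]] by (simp add: zero_ext_def)
next
  case (insert z X)
  let ?s = "zero_ext D (\<lambda>x. \<Sum>z\<in>X. c z * K x z)" and ?k = "zero_ext D (\<lambda>x. K x z)"
  have s: "?s \<in> H" using insert by (intro is_rkhs_kernel_sum[OF R]) auto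
  have k: "?k \<in> H" using insert by (intro is_rkhs_ip(6)[OF R]) auto
  have ck: "(\<lambda>x. c z * ?k x) \<in> H" by (rule is_rkhs_linear(2)[OF R k])
  have eq: "zero_ext D (\<lambda>x. \<Sum>z\<in>insert z X. c z * K x z) = (\<lambda>x. c z * ?k x + ?s x)"
    using insert by (auto simp: zero_ext_def fun_eq_iff)
  have "ip g (\<lambda>x. c z * ?k x + ?s x) = c z * ip g ?k + ip g ?s"
    using is_rkhs_ip(1)[OF R g is_rkhs_linear(1)[OF R ck s]] is_rkhs_ip(2)[OF R ck s g]
      is_rkhs_ip(3)[OF R k g] is_rkhs_ip(1)[OF R k g] is_rkhs_ip(1)[OF R s g] by simp
  then show ?case using insert is_rkhs_ip(7)[OF R _ g, of z] unfolding eq by simp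
qed

text \<open>Gram-Schmidt orthogonalisation also covers kernel sections that are linearly dependent.\<close>

lemma is_rkhs_interpolation:
  assumes R: "is_rkhs D K H ip" and "finite X" "X \<subseteq> D" and "g \<in> H"
  shows "\<exists>c. \<forall>z\<in>X. (\<Sum>y\<in>X. c y * K z y) = g z"
  using assms(2-)
proof (induction X arbitrary: g)
  case empty
  then show ?case by simp
next
  case (insert z X)
  let ?k = "zero_ext D (\<lambda>x. K x z)"
  have z: "z \<in> D" and X: "X \<subseteq> D" using insert.prems by auto
  have k: "?k \<in> H" by (rule is_rkhs_ip(6)[OF R z])
  obtain c where c: "\<And>w. w \<in> X \<Longrightarrow> (\<Sum>y\<in>X. c y * K w y) = g w"
    using insert.IH[OF X insert.prems(2)] by blast
  obtain c' where c': "\<And>w. w \<in> X \<Longrightarrow> (\<Sum>y\<in>X. c' y * K w y) = ?k w"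
    using insert.IH[OF X k] by blast
  define s where "s = zero_ext D (\<lambda>x. \<Sum>y\<in>X. c' y * K x y)"
  have s: "s \<in> H" unfolding s_def by (rule is_rkhs_kernel_sum[OF R insert.hyps(1) X])
  \<comment> \<open>The Gram-Schmidt vector: the part of the new section orthogonal to the old ones.
    It vanishes on \<open>X\<close>, and its value at \<open>z\<close> is its squared norm.\<close>
  define e where "e = (\<lambda>x. ?k x - s x)"
  have e: "e \<in> H" unfolding e_def by (rule is_rkhs_diff(1)[OF R k s])
  have eX: "e w = 0" if "w \<in> X" for w using c'[OF that] that X by (auto simp: e_def s_def zero_ext_def)
  have ee: "ip e e = e z"
  proof -
    have "ip e e = ip e ?k - ip e s"
      using is_rkhs_diff(2)[OF R k s e] is_rkhs_ip(1)[OF R e k] is_rkhs_ip(1)[OF R e s] by (simp add: e_def)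
    also have "ip e s = 0"
      unfolding s_def is_rkhs_ip_kernel_sum[OF R insert.hyps(1) X e] using eX by simp
    finally show ?thesis using is_rkhs_ip(7)[OF R z e] by simp
  qed
  define r where "r = g z - (\<Sum>y\<in>X. c y * K z y)"
  show ?case
  proof (cases "e z = 0")
    case True
    then have e0: "e = (\<lambda>_. 0)" using ee is_rkhs_ip(5)[OF R e] by simp
    have Ps: "zero_ext D (\<lambda>x. \<Sum>y\<in>X. c y * K x y) \<in> H" by (rule is_rkhs_kernel_sum[OF R insert.hyps(1) X])
    define q where "q = (\<lambda>x. g x - zero_ext D (\<lambda>x. \<Sum>y\<in>X. c y * K x y) x)"
    have q: "q \<in> H" unfolding q_def by (rule is_rkhs_diff(1)[OF R insert.prems(2) Ps])
    have qX: "q w = 0" if "w \<in> X" for w using c[OF that] that X by (auto simp: q_def zero_ext_def)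
    \<comment> \<open>In this case the new section is a combination of the old ones. A residual that
      vanishes on \<open>X\<close> is orthogonal to all of these and therefore vanishes at
      \<open>z\<close> too; the new coefficient can be 0.\<close>
    have ks: "?k = s" using e0 by (auto simp: e_def fun_eq_iff)
    have "q z = ip q s" using is_rkhs_ip(7)[OF R z q] ks by simp
    also have "\<dots> = 0" unfolding s_def is_rkhs_ip_kernel_sum[OF R insert.hyps(1) X q] using qX by simp
    finally have "(\<Sum>y\<in>X. c y * K z y) = g z" using z by (simp add: q_def zero_ext_def)
    moreover have "(\<Sum>y\<in>insert z X. (c(z := 0)) y * K w y) = (\<Sum>y\<in>X. c y * K w y)" for w
    proof -
      have "(\<Sum>y\<in>X. (c(z := 0)) y * K w y) = (\<Sum>y\<in>X. c y * K w y)"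
        using insert.hyps by (intro sum.cong) auto
      then show ?thesis using insert.hyps by simp
    qed
    ultimately have "\<forall>w\<in>insert z X. (\<Sum>y\<in>insert z X. (c(z := 0)) y * K w y) = g w"
      using c by simp
    then show ?thesis by blast
  next
    case False
    define t where "t = r / e z"
    \<comment> \<open>The coefficients of the old interpolant plus \<open>t\<close> times
      \<open>e\<close>; this leaves the values on \<open>X\<close> unchanged and corrects the value
      at \<open>z\<close>.\<close>
    define c2 where "c2 = (\<lambda>y. if y = z then t else c y - t * c' y)"
    have sums: "(\<Sum>y\<in>insert z X. c2 y * K w y) = (\<Sum>y\<in>X. c y * K w y) + t * e w" if "w \<in> D" for w
    proof -
      have "(\<Sum>y\<in>X. c2 y * K w y) = (\<Sum>y\<in>X. (c y - t * c' y) * K w y)"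
        using insert.hyps by (intro sum.cong) (auto simp: c2_def)
      then have "(\<Sum>y\<in>insert z X. c2 y * K w y) = t * K w z + (\<Sum>y\<in>X. (c y - t * c' y) * K w y)"
        using insert.hyps by (simp add: c2_def)
      then show ?thesis using that
        by (simp add: e_def s_def zero_ext_def left_diff_distrib sum_subtractf right_diff_distrib sum_distrib_left mult.assoc)
    qed
    have "(\<Sum>y\<in>insert z X. c2 y * K w y) = g w" if "w \<in> insert z X" for w
    proof (cases "w = z")
      case True
      then show ?thesis using sums[OF z] False by (simp add: t_def r_def)
    next
      case False
      then have "w \<in> X" using that by simp
      then show ?thesis using sums[of w] X eX c by auto
    qed
    then show ?thesis by blast
  qed
qed


section \<open>Native space functions that vanish on a fine mesh\<close>

text \<open>\<open>J\<close> steps of length \<open>\<rho> / 4\<close> lead from \<open>x0\<close>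
  to any point of \<Omega>, and \<open>c\<close> carries their cost \<open>2 ^ J\<close>. All
  constants are fixed before \<open>H\<close>, \<open>ip\<close>, \<open>X\<close> and
  \<open>h\<close>, hence depend only on \<Omega>, \<alpha> and \<epsilon>.\<close>

lemma gmq_rkhs_small:
  fixes \<Omega> :: "(real ^ 'n::finite) set"
  assumes \<epsilon>: "0 < \<epsilon>" and \<alpha>: "\<alpha> < real CARD('n)" and \<Omega>: "open \<Omega>" "bounded \<Omega>" "\<Omega> \<noteq> {}"
  shows "\<exists>C\<ge>0. \<exists>c>0. \<exists>h\<^sub>0>0. \<forall>H ip X h. is_rkhs \<Omega> (gmq_kernel \<alpha> \<epsilon>) H ip \<longrightarrow> finite X \<longrightarrow> X \<subseteq> \<Omega> \<longrightarrow>
    0 < h \<longrightarrow> h \<le> h\<^sub>0 \<longrightarrow> (\<forall>x\<in>\<Omega>. \<exists>z\<in>X. norm (x - z) \<le> h) \<longrightarrow>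
    (\<forall>g\<in>H. (\<forall>z\<in>X. g z = 0) \<longrightarrow> (\<forall>x\<in>\<Omega>. \<bar>g x\<bar> \<le> C * exp (- c / h) * ip_norm ip g))"
proof -
  obtain x0 r where x0: "x0 \<in> \<Omega>" "0 < r" "ball x0 r \<subseteq> \<Omega>"
    using \<Omega> by (metis openE ex_in_conv)
  define \<rho> where "\<rho> = min (\<epsilon> / 4) (r / 3)"
  have \<rho>: "0 < \<rho>" "\<rho> \<le> \<epsilon> / 4" "2 * \<rho> < r" using \<epsilon> x0 by (auto simp: \<rho>_def)
  obtain B where B: "\<And>x. x \<in> \<Omega> \<Longrightarrow> norm x \<le> B" using \<Omega> by (auto simp: bounded_iff)
  define J where "J = nat \<lceil>2 * B / (\<rho> / 4)\<rceil>"
  have J: "norm (x - x0) \<le> real J * (\<rho> / 4)" if "x \<in> \<Omega>" for x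
  proof -
    have "norm (x - x0) \<le> 2 * B" using norm_triangle_ineq4[of x x0] B[OF that] B[OF x0(1)] by linarith
    also have "2 * B \<le> real J * (\<rho> / 4)"
      using real_nat_ceiling_ge[of "2 * B / (\<rho> / 4)"] \<rho> unfolding J_def by (subst (asm) pos_divide_le_eq) auto
    finally show ?thesis .
  qed
  define \<kappa> where "\<kappa> = (3 * \<epsilon>\<^sup>2 / 4) powr ((\<alpha> - real CARD('n)) / 2)"
  define c where "c = \<rho> / (16 * exp 1 * 2 ^ J)"
  have c: "0 < c" using \<rho> by (simp add: c_def)
  have main: "\<bar>g x\<bar> \<le> 4 * sqrt \<kappa> * exp (- c / h) * ip_norm ip g"
    if R: "is_rkhs \<Omega> (gmq_kernel \<alpha> \<epsilon>) H ip" and X: "finite X" "X \<subseteq> \<Omega>" and h: "0 < h" "h \<le> \<rho> / (2 * exp 1)"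
      and dense: "\<forall>x\<in>\<Omega>. \<exists>z\<in>X. norm (x - z) \<le> h" and g: "g \<in> H" "\<forall>z\<in>X. g z = 0" and x: "x \<in> \<Omega>"
    for H ip X h g x
  proof (cases "x \<in> X")
    case True
    then show ?thesis using g is_rkhs_ip(4)[OF R g(1)] by (simp add: ip_norm_def \<kappa>_def)
  next
    case False
    let ?K = "gmq_kernel \<alpha> \<epsilon> :: real ^ 'n \<Rightarrow> real ^ 'n \<Rightarrow> real"
    obtain a where a: "\<And>z. z \<in> X \<Longrightarrow> (\<Sum>y\<in>X. a y * ?K z y) = zero_ext \<Omega> (\<lambda>z. ?K z x) z"
      using is_rkhs_interpolation[OF R X is_rkhs_ip(6)[OF R x]] by blast
    \<comment> \<open>Coefficients of the residual \<open>s\<close> of the kernel section at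
      \<open>x\<close>. The assumption that \<open>x\<close> is not a node keeps its coefficient 1
      apart from those of the interpolant.\<close>
    define b where "b = (\<lambda>y. if y = x then 1 else - a y)"
    define s where "s = (\<lambda>z. \<Sum>y\<in>insert x X. b y * ?K z y)"
    have s_eq: "s z = ?K z x - (\<Sum>y\<in>X. a y * ?K z y)" for z
    proof -
      have "(\<Sum>y\<in>X. b y * ?K z y) = (\<Sum>y\<in>X. - (a y * ?K z y))"
        using False by (intro sum.cong) (auto simp: b_def)
      then show ?thesis using False X by (simp add: s_def b_def sum_negf)
    qed
    have sX: "s z = 0" if "z \<in> X" for z
      using a[OF that] that X by (auto simp: s_eq zero_ext_def)
    define Q where "Q = (\<Sum>y\<in>insert x X. \<Sum>z\<in>insert x X. b y * b z * ?K y z)"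
    have Qs: "Q = s x"
    proof -
      have "Q = (\<Sum>y\<in>insert x X. b y * s y)"
        by (simp add: Q_def s_def sum_distrib_left mult.assoc)
      also have "\<dots> = s x" using X False sX by (simp add: b_def)
      finally show ?thesis .
    qed
    have SB: "strip_bounded \<rho> (sqrt (\<kappa> * Q)) s"
      using strip_bounded_mono[OF gmq_strip_bounded[OF \<epsilon> \<alpha>, of "insert x X" b] \<rho>(2) order_refl] X
      unfolding s_def Q_def \<kappa>_def by simp
    \<comment> \<open>The largest real exponent allowed by \<open>strip_bounded_small\<close>.
      Rounding down to \<open>n\<close> costs at most a factor 4, which is the 4 in the final
      constant.\<close>
    define T where "T = \<rho> / (16 * exp 1 * h) / (ln 4 * 2 ^ J)"
    define n where "n = nat \<lfloor>T\<rfloor>"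
    have T0: "0 \<le> T" using \<rho> h by (simp add: T_def)
    have n: "real n \<le> T" "T \<le> real n + 1" using T0 unfolding n_def by linarith+
    have "\<bar>s x\<bar> \<le> sqrt (\<kappa> * Q) / 4 ^ n"
    proof (rule strip_bounded_small[OF SB \<rho>(1) h(1) _ _ J[OF x]])
      show "2 * exp 1 * h \<le> \<rho>" using h by (simp add: field_simps)
      show "\<exists>z. norm (y - z) \<le> h \<and> s z = 0" if "norm (y - x0) < 2 * \<rho>" for y
      proof -
        have "y \<in> ball x0 r" using that \<rho> by (simp add: dist_norm norm_minus_commute)
        then show ?thesis using dense x0 sX by blast
      qed
      have "ln 4 * 2 ^ J * real n \<le> ln 4 * 2 ^ J * T" using n by (intro mult_left_mono) auto
      then show "ln 4 * real (2 ^ J * n) \<le> \<rho> / (16 * exp 1 * h)" by (simp add: T_def mult.assoc)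
    qed
    \<comment> \<open>The self-improvement: the strip bound of \<open>s\<close> is
      \<open>sqrt (\<kappa> * Q)\<close> and its value at \<open>x\<close> is \<open>Q\<close>, so
      dividing by \<open>sqrt Q\<close> bounds the norm of the residual itself.\<close>
    then have Q1: "Q \<le> sqrt \<kappa> * sqrt Q / 4 ^ n" by (simp add: Qs real_sqrt_mult)
    define e where "e = zero_ext \<Omega> s"
    have e: "e \<in> H" unfolding e_def s_def using X x by (intro is_rkhs_kernel_sum[OF R]) auto
    have ipe: "ip k e = b x * k x + (\<Sum>z\<in>X. b z * k z)" if "k \<in> H" for k
      using is_rkhs_ip_kernel_sum[OF R _ _ that, of "insert x X" b] X x False by (simp add: e_def s_def)
    have "ip e e = Q"
      using ipe[OF e] X x sX Qs by (auto simp: e_def zero_ext_def b_def subset_iff intro!: sum.neutral)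
    moreover have "ip g e = g x" using ipe[OF g(1)] g(2) by (simp add: b_def)
    ultimately have gx: "\<bar>g x\<bar> \<le> ip_norm ip g * sqrt Q"
      using is_rkhs_Cauchy_Schwarz[OF R g(1) e] by (simp add: ip_norm_def)
    have Q0: "0 \<le> Q" using is_rkhs_ip(4)[OF R e] \<open>ip e e = Q\<close> by simp
    have sQ: "sqrt Q \<le> sqrt \<kappa> / 4 ^ n"
    proof (cases "Q = 0")
      case True
      then show ?thesis by (simp add: \<kappa>_def)
    next
      case False
      then have "0 < sqrt Q" using Q0 by simp
      moreover have "sqrt Q * sqrt Q \<le> (sqrt \<kappa> / 4 ^ n) * sqrt Q" using Q1 Q0 by simp
      ultimately show ?thesis by (simp only: mult_le_cancel_right_pos)
    qed
    have "c / h = T * ln 4" by (simp add: c_def T_def)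
    then have "c / h - ln 4 \<le> real n * ln 4" using n(2) mult_right_mono[OF n(2), of "ln 4"] by (simp add: algebra_simps)
    then have "exp (- (real n * ln 4)) \<le> exp (ln 4 - c / h)" by simp
    also have "\<dots> = 4 * exp (- c / h)" by (simp add: exp_diff exp_minus field_simps)
    also have "exp (- (real n * ln 4)) = 1 / 4 ^ n" by (simp add: exp_minus exp_of_nat_mult inverse_eq_divide)
    finally have "sqrt \<kappa> * (1 / 4 ^ n) \<le> sqrt \<kappa> * (4 * exp (- c / h))"
      by (rule mult_left_mono) (simp add: \<kappa>_def)
    then have "sqrt Q \<le> 4 * sqrt \<kappa> * exp (- c / h)" using sQ by simp
    then have "ip_norm ip g * sqrt Q \<le> ip_norm ip g * (4 * sqrt \<kappa> * exp (- c / h))"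
      by (rule mult_left_mono) (simp add: ip_norm_def is_rkhs_ip(4)[OF R g(1)])
    then show ?thesis using gx by (simp add: mult_ac)
  qed
  show ?thesis
    by (rule exI[of _ "4 * sqrt \<kappa>"], rule conjI, simp add: \<kappa>_def, rule exI[of _ c], rule conjI, rule c,
        rule exI[of _ "\<rho> / (2 * exp 1)"], rule conjI, use \<rho> in simp)
      (use main in blast)
qed

section \<open>Lipschitz bounds and interpolation residuals in the native space\<close>

text \<open>The absolute derivative at \<open>s = 0\<close> of
  \<open>(\<epsilon>\<^sup>2 + s) powr ((\<alpha> - d) / 2)\<close>, the kernel as a function of the
  squared distance \<open>s\<close>.\<close>

definition gmq_lipschitz :: "real \<Rightarrow> real \<Rightarrow> nat \<Rightarrow> real" where
  "gmq_lipschitz \<alpha> \<epsilon> d = \<bar>(\<alpha> - real d) / 2\<bar> * (\<epsilon>\<^sup>2) powr ((\<alpha> - real d) / 2 - 1)"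

lemma gmq_lipschitz_nonneg: "0 \<le> gmq_lipschitz \<alpha> \<epsilon> d"
  by (simp add: gmq_lipschitz_def)

lemma powr_shift_lipschitz:
  assumes "0 < (e :: real)" "p \<le> 1" "0 \<le> s" "0 \<le> t"
  shows "\<bar>(e + s) powr p - (e + t) powr p\<bar> \<le> \<bar>p\<bar> * e powr (p - 1) * \<bar>s - t\<bar>"
proof -
  have "norm ((e + s) powr p - (e + t) powr p) \<le> \<bar>p\<bar> * e powr (p - 1) * norm (s - t)"
  proof (rule field_differentiable_bound[where S="{0..}" and f'="\<lambda>x. p * (e + x) powr (p - 1)"])
    fix x :: real assume x: "x \<in> {0..}"
    then have "0 < e + x" using assms by simp
    then show "((\<lambda>s. (e + s) powr p) has_field_derivative p * (e + x) powr (p - 1)) (at x within {0..})"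
      by (auto intro!: derivative_eq_intros simp: powr_diff)
    have "(e + x) powr (p - 1) \<le> e powr (p - 1)" using x assms by (intro powr_mono2') auto
    then show "norm (p * (e + x) powr (p - 1)) \<le> \<bar>p\<bar> * e powr (p - 1)"
      by (simp add: abs_mult mult_left_mono)
  qed (use assms in auto)
  then show ?thesis by simp
qed

lemma gmq_kernel_lipschitz:
  fixes x y z :: "real ^ 'n::finite"
  assumes "0 < \<epsilon>" "\<alpha> < real CARD('n)"
  shows "\<bar>gmq_kernel \<alpha> \<epsilon> x z - gmq_kernel \<alpha> \<epsilon> y z\<bar> \<le>
    gmq_lipschitz \<alpha> \<epsilon> CARD('n) * \<bar>(norm (x - z))\<^sup>2 - (norm (y - z))\<^sup>2\<bar>"
  unfolding gmq_kernel_def gmq_lipschitz_def using assms by (intro powr_shift_lipschitz) auto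

text \<open>The difference of two kernel sections has squared norm
  \<open>2 * (K x x - K y x)\<close>. The kernel is Lipschitz in the squared distance, so this is of
  order \<open>(norm (x - y))\<^sup>2\<close>, and the norm of the difference functional is of order
  \<open>norm (x - y)\<close>.\<close>

lemma gmq_rkhs_lipschitz:
  fixes \<Omega> :: "(real ^ 'n::finite) set"
  assumes \<epsilon>: "0 < \<epsilon>" and \<alpha>: "\<alpha> < real CARD('n)" and R: "is_rkhs \<Omega> (gmq_kernel \<alpha> \<epsilon>) H ip"
    and g: "g \<in> H" and x: "x \<in> \<Omega>" and y: "y \<in> \<Omega>"
  shows "\<bar>g x - g y\<bar> \<le> sqrt (2 * gmq_lipschitz \<alpha> \<epsilon> CARD('n)) * ip_norm ip g * norm (x - y)"
proof -
  let ?K = "gmq_kernel \<alpha> \<epsilon> :: real ^ 'n \<Rightarrow> real ^ 'n \<Rightarrow> real"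
  let ?L = "gmq_lipschitz \<alpha> \<epsilon> CARD('n)"
  define kx where "kx = zero_ext \<Omega> (\<lambda>z. ?K z x)"
  define ky where "ky = zero_ext \<Omega> (\<lambda>z. ?K z y)"
  have k: "kx \<in> H" "ky \<in> H" unfolding kx_def ky_def by (rule is_rkhs_ip(6)[OF R x] is_rkhs_ip(6)[OF R y])+
  define e where "e = (\<lambda>z. kx z - ky z)"
  have e: "e \<in> H" unfolding e_def by (rule is_rkhs_diff(1)[OF R k])
  have ev: "ip k e = k x - k y" if "k \<in> H" for k
    using is_rkhs_diff(2)[OF R k that] is_rkhs_ip(1)[OF R that e] is_rkhs_ip(1)[OF R that k(1)] is_rkhs_ip(1)[OF R that k(2)]
      is_rkhs_ip(7)[OF R x that] is_rkhs_ip(7)[OF R y that] by (simp add: e_def kx_def[symmetric] ky_def[symmetric])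
  have "ip e e = 2 * (?K x x - ?K y x)"
    using ev[OF e] x y by (simp add: e_def kx_def ky_def zero_ext_def gmq_kernel_def norm_minus_commute)
  also have "\<dots> \<le> 2 * (?L * (norm (x - y))\<^sup>2)"
    using gmq_kernel_lipschitz[OF \<epsilon> \<alpha>, of x x y] by (simp add: norm_minus_commute)
  finally have "ip_norm ip e \<le> sqrt (2 * ?L * (norm (x - y))\<^sup>2)"
    unfolding ip_norm_def by (intro real_sqrt_le_mono) simp
  also have "\<dots> = sqrt (2 * ?L) * norm (x - y)" by (simp add: real_sqrt_mult)
  finally have "ip_norm ip g * ip_norm ip e \<le> ip_norm ip g * (sqrt (2 * ?L) * norm (x - y))"
    by (rule mult_left_mono) (simp add: ip_norm_def is_rkhs_ip(4)[OF R g])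
  then show ?thesis using is_rkhs_Cauchy_Schwarz[OF R g e] unfolding ev[OF g] by (simp add: mult_ac)
qed

text \<open>The interpolant is the orthogonal projection onto the kernel sections, so the residual is no
  larger than the function itself.\<close>

lemma is_rkhs_interpolation_residual:
  assumes R: "is_rkhs D K H ip" and X: "finite X" "X \<subseteq> D" and g: "g \<in> H"
  shows "\<exists>c. (\<lambda>x. g x - zero_ext D (\<lambda>x. \<Sum>z\<in>X. c z * K x z) x) \<in> H \<and>
    (\<forall>z\<in>X. g z - zero_ext D (\<lambda>x. \<Sum>z\<in>X. c z * K x z) z = 0) \<and>
    ip_norm ip (\<lambda>x. g x - zero_ext D (\<lambda>x. \<Sum>z\<in>X. c z * K x z) x) \<le> ip_norm ip g"
proof -
  obtain c where c: "\<And>z. z \<in> X \<Longrightarrow> (\<Sum>y\<in>X. c y * K z y) = g z"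
    using is_rkhs_interpolation[OF assms] by blast
  define p where "p = zero_ext D (\<lambda>x. \<Sum>z\<in>X. c z * K x z)"
  define r where "r = (\<lambda>x. g x - p x)"
  have p: "p \<in> H" unfolding p_def by (rule is_rkhs_kernel_sum[OF R X])
  have r: "r \<in> H" unfolding r_def by (rule is_rkhs_diff(1)[OF R g p])
  have rX: "\<forall>z\<in>X. r z = 0" using c X by (auto simp: r_def p_def zero_ext_def)
  \<comment> \<open>The residual vanishes at the nodes and is thus orthogonal to all their sections;
    \<open>ip r r = ip g r\<close> and Cauchy-Schwarz then bound its norm by that of
    \<open>g\<close>.\<close>
  have "ip r p = 0" unfolding p_def is_rkhs_ip_kernel_sum[OF R X r] using rX by simp
  then have "ip r r = ip g r"
    using is_rkhs_diff(2)[OF R g p r] is_rkhs_ip(1)[OF R r p] by (simp add: r_def)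
  then have "(ip_norm ip r)\<^sup>2 \<le> ip_norm ip g * ip_norm ip r"
    using is_rkhs_Cauchy_Schwarz[OF R g r] is_rkhs_ip(4)[OF R r] by (simp add: ip_norm_def)
  then have "ip_norm ip r * ip_norm ip r \<le> ip_norm ip g * ip_norm ip r" by (simp add: power2_eq_square)
  moreover have "0 \<le> ip_norm ip r" "0 \<le> ip_norm ip g"
    using is_rkhs_ip(4)[OF R r] is_rkhs_ip(4)[OF R g] by (simp_all add: ip_norm_def)
  ultimately have "ip_norm ip r \<le> ip_norm ip g"
    by (cases "ip_norm ip r = 0") auto
  then show ?thesis using r rX unfolding r_def p_def by blast
qed

section \<open>Weakly singular integrals\<close>

lemma sigma_finite_lebesgue: "sigma_finite_measure (lebesgue :: 'a::euclidean_space measure)"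
proof
  let ?A = "range (\<lambda>n::nat. ball (0::'a) (real n))"
  have "x \<in> \<Union> ?A" for x :: 'a
    using reals_Archimedean2[of "norm x"] by auto
  then show "\<exists>A. countable A \<and> A \<subseteq> sets lebesgue \<and> \<Union> A = space (lebesgue :: 'a measure) \<and> (\<forall>a\<in>A. emeasure lebesgue a \<noteq> \<infinity>)"
    using emeasure_lborel_ball_finite[of "0::'a"] by (intro exI[of _ ?A]) (auto simp: less_top)
qed

lemma sigma_finite_lebesgue_on:
  "S \<in> sets lebesgue \<Longrightarrow> sigma_finite_measure (lebesgue_on (S :: 'a::euclidean_space set))"
  by (rule sigma_finite_measure_restrict_space[OF sigma_finite_lebesgue])

lemma AE_pair_both:
  assumes "sigma_finite_measure M" "AE x in M. P x"
  shows "AE z in M \<Otimes>\<^sub>M M. P (fst z) \<and> P (snd z)"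
proof -
  interpret sigma_finite_measure M by fact
  obtain N where N: "N \<in> null_sets M" "{x \<in> space M. \<not> P x} \<subseteq> N"
    using assms(2) unfolding eventually_ae_filter by blast
  have "N \<times> space M \<in> null_sets (M \<Otimes>\<^sub>M M)" "space M \<times> N \<in> null_sets (M \<Otimes>\<^sub>M M)"
    using N by (auto simp: null_sets_def emeasure_pair_measure_Times)
  then have "N \<times> space M \<union> space M \<times> N \<in> null_sets (M \<Otimes>\<^sub>M M)" by (rule null_sets.Un)
  moreover have "{z \<in> space (M \<Otimes>\<^sub>M M). \<not> (P (fst z) \<and> P (snd z))} \<subseteq> N \<times> space M \<union> space M \<times> N"
    using N(2) by (auto simp: space_pair_measure)
  ultimately show ?thesis by (rule AE_I')
qed

lemma id_measurable_lebesgue_on [measurable]: "(\<lambda>x. x) \<in> borel_measurable (lebesgue_on (S :: 'a::euclidean_space set))"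
  by (rule measurable_restrict_space1) (rule measurable_completion, simp)

lemma norm_diff_powr_measurable [measurable]:
  "(\<lambda>(x, y). norm (x - y) powr p) \<in> borel_measurable (lebesgue_on S \<Otimes>\<^sub>M lebesgue_on (T :: 'a::euclidean_space set))"
proof -
  have 1: "fst \<in> borel_measurable (lebesgue_on S \<Otimes>\<^sub>M lebesgue_on T)"
    using measurable_compose[OF measurable_fst id_measurable_lebesgue_on, of S "lebesgue_on T"] by simp
  have 2: "snd \<in> borel_measurable (lebesgue_on S \<Otimes>\<^sub>M lebesgue_on T)"
    using measurable_compose[OF measurable_snd id_measurable_lebesgue_on, of "lebesgue_on S" T] by simp
  show ?thesis unfolding split_beta' using measurable_compose[OF borel_measurable_diff[OF 1 2] borel_measurable_norm]
    by (intro powr_real_measurable borel_measurable_const)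
qed

lemma norm_diff_powr_measurable_snd [measurable]:
  "(\<lambda>y. norm (x - y) powr p) \<in> borel_measurable (lebesgue_on (T :: 'a::euclidean_space set))"
  by measurable

text \<open>On the shell of radius \<open>A * q ^ k\<close> the integrand is at most that radius to
  the power \<open>- p\<close>, and the volume is at most a constant times the radius to the power
  \<open>d\<close>. The resulting geometric series has ratio \<open>q powr (d - p)\<close>. It
  serves both regimes: \<open>q = 1/2\<close> for shells shrinking to \<open>x\<close> and
  \<open>q = 2\<close> for shells going to infinity.\<close>

lemma shell_integral_bound:
  fixes x :: "real ^ 'n::finite"
  assumes A: "0 < A" and q: "0 < q" "q powr (real CARD('n) - p) < 1" and p: "0 \<le> p"
    and S: "\<And>y. y \<in> S \<Longrightarrow> y \<noteq> x \<Longrightarrow> \<exists>k::nat. A * q ^ k \<le> norm (x - y) \<and> norm (x - y) < 2 * (A * q ^ k)"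
  shows "(\<integral>\<^sup>+y. indicator S y * ennreal (norm (x - y) powr (- p)) \<partial>lebesgue)
    \<le> ennreal (unit_ball_vol (real CARD('n)) * 2 ^ CARD('n) * A powr (real CARD('n) - p) / (1 - q powr (real CARD('n) - p)))"
proof -
  define d where "d = real CARD('n)"
  define V where "V = unit_ball_vol (real CARD('n)) * 2 ^ CARD('n)"
  have V: "0 \<le> V" by (simp add: V_def)
  define a where "a = (\<lambda>k::nat. A * q ^ k)"
  let ?f = "\<lambda>k y. ennreal (a k powr (- p)) * indicator (ball x (2 * a k)) y"
  have a: "0 < a k" for k using A q by (simp add: a_def)
  have "(\<integral>\<^sup>+y. indicator S y * ennreal (norm (x - y) powr (- p)) \<partial>lebesgue)
      \<le> (\<integral>\<^sup>+y. (\<Sum>k. ?f k y) \<partial>lebesgue)"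
  proof (rule nn_integral_mono)
    fix y
    show "indicator S y * ennreal (norm (x - y) powr (- p)) \<le> (\<Sum>k. ?f k y)"
    \<comment> \<open>At \<open>y = x\<close> the integrand is 0, since
      \<open>0 powr (- p) = 0\<close>; the centre lies in no shell.\<close>
    proof (cases "y \<in> S \<and> y \<noteq> x")
      case True
      then obtain k where k: "a k \<le> norm (x - y)" "norm (x - y) < 2 * a k" using S unfolding a_def by blast
      have "norm (x - y) powr (- p) \<le> a k powr (- p)"
        using k a[of k] p by (intro powr_mono2') auto
      then have "indicator S y * ennreal (norm (x - y) powr (- p)) \<le> ?f k y"
        using True k by (simp add: dist_norm ennreal_leI)
      also have "\<dots> \<le> (\<Sum>k. ?f k y)"
      proof -
        define f where "f = (\<lambda>k. ?f k y)"
        have "sum f {k} \<le> suminf f" by (rule sum_le_suminf[OF summableI]) auto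
        then have "f k \<le> suminf f" by simp
        then show ?thesis unfolding f_def .
      qed
      finally show ?thesis .
    qed auto
  qed
  also have "\<dots> = (\<Sum>k. \<integral>\<^sup>+y. ?f k y \<partial>lebesgue)"
    by (rule nn_integral_suminf)
      (rule borel_measurable_times_ennreal[OF borel_measurable_const borel_measurable_indicator], simp)
  also have "\<dots> = (\<Sum>k. ennreal (V * A powr (d - p) * (q powr (d - p)) ^ k))"
  proof (intro suminf_cong)
    fix k
    have "(\<integral>\<^sup>+y. ?f k y \<partial>lebesgue) = ennreal (a k powr (- p)) * emeasure lebesgue (ball x (2 * a k))"
      by (rule nn_integral_cmult_indicator) simp
    also have "emeasure lebesgue (ball x (2 * a k)) = ennreal (unit_ball_vol (real CARD('n)) * (2 * a k) ^ CARD('n))"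
      using a[of k] by (simp add: emeasure_ball)
    also have "ennreal (a k powr (- p)) * \<dots> = ennreal (a k powr (- p) * (unit_ball_vol (real CARD('n)) * (2 * a k) ^ CARD('n)))"
      by (rule ennreal_mult'[symmetric]) simp
    also have "a k powr (- p) * (unit_ball_vol (real CARD('n)) * (2 * a k) ^ CARD('n)) = V * (a k powr (- p) * a k powr d)"
      using a[of k] by (simp add: V_def d_def powr_realpow power_mult_distrib)
    also have "a k powr (- p) * a k powr d = a k powr (d - p)" by (simp flip: powr_add)
    also have "a k powr (d - p) = A powr (d - p) * (q powr (d - p)) ^ k"
    proof -
      have "(q ^ k) powr (d - p) = (q powr (d - p)) ^ k"
      proof -
        have "(q ^ k) powr (d - p) = (q powr real k) powr (d - p)" by (simp only: powr_realpow[OF q(1)])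
        also have "\<dots> = (q powr (d - p)) powr real k" by (simp only: powr_powr mult.commute)
        also have "\<dots> = (q powr (d - p)) ^ k" using q(1) by (intro powr_realpow) simp
        finally show ?thesis .
      qed
      then show ?thesis by (simp add: a_def powr_mult)
    qed
    finally show "(\<integral>\<^sup>+y. ?f k y \<partial>lebesgue) = ennreal (V * A powr (d - p) * (q powr (d - p)) ^ k)"
      by (simp add: mult.assoc)
  qed
  also have "\<dots> = ennreal (V * A powr (d - p) * (1 / (1 - q powr (d - p))))"
    using V q by (intro suminf_ennreal_eq sums_mult geometric_sums) (auto simp: d_def)
  finally show ?thesis by (simp add: V_def d_def)
qed

lemma near_integral_bound:
  fixes p D :: real
  assumes p: "0 \<le> p" "p < real CARD('n::finite)" and D: "0 < D"
  shows "\<exists>C\<ge>0. \<forall>x :: real ^ 'n. (\<integral>\<^sup>+y. indicator (ball x D) y * ennreal (norm (x - y) powr (- p)) \<partial>lebesgue) \<le> ennreal C"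
proof -
  have q: "(1/2::real) powr (real CARD('n) - p) < 1"
    using powr_less_mono2_neg[of "- (real CARD('n) - p)" 1 2] p by (simp add: powr_minus powr_divide)
  have "\<exists>k::nat. D / 2 * (1/2) ^ k \<le> norm (x - y) \<and> norm (x - y) < 2 * (D / 2 * (1/2) ^ k)"
    if "y \<in> ball x D" "y \<noteq> x" for x y :: "real ^ 'n"
  proof -
    define t where "t = norm (x - y)"
    have t: "0 < t" "t < D" using that by (auto simp: t_def dist_norm)
    obtain N where "(1/2) ^ N < t / (D / 2)" using real_arch_pow_inv[of "t / (D / 2)" "1/2"] t D by auto
    then have ex: "D / 2 * (1/2) ^ N \<le> t" using D by (simp add: field_simps)
    \<comment> \<open>Minimality yields the outer bound as well: either the preceding radius already
      exceeds \<open>t\<close>, or \<open>k = 0\<close> and \<open>t < D\<close>.\<close>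
    define k where "k = (LEAST k. D / 2 * (1/2) ^ k \<le> t)"
    have k: "D / 2 * (1/2) ^ k \<le> t" unfolding k_def by (rule LeastI[of _ N]) (rule ex)
    have "t < 2 * (D / 2 * (1/2) ^ k)"
    proof (cases k)
      case 0
      then show ?thesis using t by simp
    next
      case (Suc j)
      then have "\<not> D / 2 * (1/2) ^ j \<le> t" using not_less_Least[of j "\<lambda>k. D / 2 * (1/2) ^ k \<le> t"] unfolding k_def by auto
      then show ?thesis using Suc by simp
    qed
    then show ?thesis using k unfolding t_def by blast
  qed
  note * = shell_integral_bound[where A="D / 2" and q="1/2" and p=p, OF _ _ q p(1) this]
  define C where "C = unit_ball_vol (real CARD('n)) * 2 ^ CARD('n) * (D / 2) powr (real CARD('n) - p) / (1 - (1/2) powr (real CARD('n) - p))"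
  have "(\<integral>\<^sup>+y. indicator (ball x D) y * ennreal (norm (x - y) powr (- p)) \<partial>lebesgue) \<le> ennreal C" for x :: "real ^ 'n"
    unfolding C_def by (rule *) (use D in simp_all)
  moreover have "0 \<le> C" unfolding C_def using q by (intro divide_nonneg_nonneg mult_nonneg_nonneg) auto
  ultimately show ?thesis by blast
qed

lemma far_integral_bound:
  fixes p \<delta> :: real and x :: "real ^ 'n::finite"
  assumes p: "real CARD('n) < p" and \<delta>: "0 < \<delta>"
  shows "(\<integral>\<^sup>+y. indicator (- ball x \<delta>) y * ennreal (norm (x - y) powr (- p)) \<partial>lebesgue) < \<infinity>"
proof -
  have q: "(2::real) powr (real CARD('n) - p) < 1"
    using powr_less_mono2_neg[of "real CARD('n) - p" 1 2] p by simp
  have "\<exists>k::nat. \<delta> * 2 ^ k \<le> norm (x - y) \<and> norm (x - y) < 2 * (\<delta> * 2 ^ k)"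
    if "y \<in> - ball x \<delta>" "y \<noteq> x" for y
  proof -
    define t where "t = norm (x - y)"
    have t: "\<delta> \<le> t" using that by (auto simp: t_def dist_norm)
    obtain N where "t / (2 * \<delta>) < 2 ^ N" using real_arch_pow[of 2 "t / (2 * \<delta>)"] by auto
    then have ex: "t < 2 * (\<delta> * 2 ^ N)" using \<delta> by (simp add: field_simps)
    define k where "k = (LEAST k. t < 2 * (\<delta> * 2 ^ k))"
    have k: "t < 2 * (\<delta> * 2 ^ k)" unfolding k_def by (rule LeastI[of _ N]) (rule ex)
    have "\<delta> * 2 ^ k \<le> t"
    proof (cases k)
      case 0
      then show ?thesis using t by simp
    next
      case (Suc j)
      then have "\<not> t < 2 * (\<delta> * 2 ^ j)" using not_less_Least[of j "\<lambda>k. t < 2 * (\<delta> * 2 ^ k)"] unfolding k_def by auto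
      then show ?thesis using Suc by simp
    qed
    then show ?thesis using k unfolding t_def by blast
  qed
  then have "(\<integral>\<^sup>+y. indicator (- ball x \<delta>) y * ennreal (norm (x - y) powr (- p)) \<partial>lebesgue)
    \<le> ennreal (unit_ball_vol (real CARD('n)) * 2 ^ CARD('n) * \<delta> powr (real CARD('n) - p) / (1 - 2 powr (real CARD('n) - p)))"
    by (intro shell_integral_bound \<delta> q) (use p in \<open>simp_all only: zero_less_numeral order_trans[OF of_nat_0_le_iff less_imp_le]\<close>)
  then show ?thesis by (rule le_less_trans) simp
qed

lemma emeasure_lebesgue_on_finite:
  assumes "S \<in> sets lebesgue" "bounded S"
  shows "emeasure (lebesgue_on S) (space (lebesgue_on S)) < \<infinity>"
proof -
  have "emeasure lebesgue S < \<infinity>"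
    using fmeasurableD2[OF bounded_set_imp_lmeasurable[OF assms(2,1)]] by (simp only: less_top infinity_ennreal_def)
  moreover have "emeasure (lebesgue_on S) S = emeasure lebesgue S"
    using assms(1) by (intro emeasure_restrict_space) auto
  ultimately show ?thesis by simp
qed

lemma weakly_singular_integral_finite:
  fixes \<Omega> :: "(real ^ 'n::finite) set"
  assumes \<Omega>: "\<Omega> \<in> sets lebesgue" "bounded \<Omega>" and p: "0 \<le> p" "p < real CARD('n)"
  shows "(\<integral>\<^sup>+(x, y). ennreal (norm (x - y) powr (- p)) \<partial>(lebesgue_on \<Omega> \<Otimes>\<^sub>M lebesgue_on \<Omega>)) < \<infinity>"
proof -
  let ?k = "\<lambda>x y. ennreal (norm (x - y) powr (- p))"
  interpret sigma_finite_measure "lebesgue_on \<Omega>" by (rule sigma_finite_lebesgue_on[OF \<Omega>(1)])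
  obtain B where B: "0 < B" "\<And>x. x \<in> \<Omega> \<Longrightarrow> norm x \<le> B" using \<Omega> by (auto simp: bounded_pos)
  obtain C where C: "\<And>x :: real ^ 'n. (\<integral>\<^sup>+y. indicator (ball x (3 * B)) y * ?k x y \<partial>lebesgue) \<le> ennreal C"
    using near_integral_bound[OF p, of "3 * B"] B by auto
  have "(\<integral>\<^sup>+(x, y). ?k x y \<partial>(lebesgue_on \<Omega> \<Otimes>\<^sub>M lebesgue_on \<Omega>))
      = (\<integral>\<^sup>+x. \<integral>\<^sup>+y. ?k x y \<partial>lebesgue_on \<Omega> \<partial>lebesgue_on \<Omega>)"
    using nn_integral_fst[OF measurable_compose[OF norm_diff_powr_measurable[of "- p" \<Omega> \<Omega>] measurable_ennreal]]
    by (simp add: split_beta')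
  also have "\<dots> \<le> (\<integral>\<^sup>+x. ennreal C \<partial>lebesgue_on \<Omega>)"
  proof (rule nn_integral_mono)
    fix x assume "x \<in> space (lebesgue_on \<Omega>)"
    then have x: "x \<in> \<Omega>" by simp
    have "(\<integral>\<^sup>+y. ?k x y \<partial>lebesgue_on \<Omega>)
        = (\<integral>\<^sup>+y. ?k x y * indicator \<Omega> y \<partial>lebesgue)"
      using \<Omega> by (intro nn_integral_restrict_space) simp
    also have "\<dots> \<le> (\<integral>\<^sup>+y. indicator (ball x (3 * B)) y * ?k x y \<partial>lebesgue)"
    proof (rule nn_integral_mono)
      fix y
      have "norm (x - y) < 3 * B" if "y \<in> \<Omega>"
        using norm_triangle_ineq4[of x y] B(2)[OF x] B(2)[OF that] B(1) by linarith
      then show "?k x y * indicator \<Omega> y \<le> indicator (ball x (3 * B)) y * ?k x y"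
        by (auto simp: indicator_def dist_norm)
    qed
    finally show "(\<integral>\<^sup>+y. ?k x y \<partial>lebesgue_on \<Omega>) \<le> ennreal C" using C[of x] by simp
  qed
  also have "\<dots> < \<infinity>"
    using emeasure_lebesgue_on_finite[OF \<Omega>] by (simp add: ennreal_mult_less_top)
  finally show ?thesis .
qed

lemma slobodeckij_measurable:
  assumes "v \<in> borel_measurable (lebesgue_on \<Omega>)" "w \<in> borel_measurable (lebesgue_on \<Omega>)"
  shows "(\<lambda>(x, y). (v x - v y) * (w x - w y) / norm (x - y) powr p) \<in> borel_measurable (lebesgue_on \<Omega> \<Otimes>\<^sub>M lebesgue_on \<Omega>)"
proof -
  have 1: "(\<lambda>z. v (fst z)) \<in> borel_measurable (lebesgue_on \<Omega> \<Otimes>\<^sub>M lebesgue_on \<Omega>)"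
    "(\<lambda>z. v (snd z)) \<in> borel_measurable (lebesgue_on \<Omega> \<Otimes>\<^sub>M lebesgue_on \<Omega>)"
    "(\<lambda>z. w (fst z)) \<in> borel_measurable (lebesgue_on \<Omega> \<Otimes>\<^sub>M lebesgue_on \<Omega>)"
    "(\<lambda>z. w (snd z)) \<in> borel_measurable (lebesgue_on \<Omega> \<Otimes>\<^sub>M lebesgue_on \<Omega>)"
    using assms by (auto intro: measurable_compose[OF measurable_fst] measurable_compose[OF measurable_snd])
  show ?thesis
    unfolding split_beta'
    by (rule borel_measurable_divide[OF borel_measurable_times[OF borel_measurable_diff[OF 1(1,2)] borel_measurable_diff[OF 1(3,4)]]
          norm_diff_powr_measurable[of p \<Omega> \<Omega>, unfolded split_beta']])
qed

lemma slobodeckij_sq_measurable: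
  assumes "v \<in> borel_measurable (lebesgue_on \<Omega>)"
  shows "(\<lambda>(x, y). ennreal ((v x - v y)\<^sup>2 / norm (x - y) powr p)) \<in> borel_measurable (lebesgue_on \<Omega> \<Otimes>\<^sub>M lebesgue_on \<Omega>)"
  using slobodeckij_measurable[OF assms assms, of p] unfolding split_beta' power2_eq_square
  by (rule measurable_compose[OF _ measurable_ennreal])

text \<open>One factor of the square is bounded by \<open>2 * S\<close>, the other by
  \<open>L * norm (x - y)\<close>. This lowers the order of the singularity by one, to
  \<open>d + 2 * \<sigma> - 1\<close>, which is integrable on bounded sets for
  \<open>2 * \<sigma> < 1\<close>, and still keeps one factor \<open>S\<close>. With
  \<open>\<sigma> = \<alpha> / 2\<close> this is where \<open>\<alpha> < 1\<close> enters.\<close>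

lemma slobodeckij_sq_Lipschitz_bound:
  fixes \<Omega> :: "(real ^ 'n::finite) set"
  assumes \<Omega>: "\<Omega> \<in> sets lebesgue" and eq: "AE x in lebesgue_on \<Omega>. v x = g x"
    and S: "\<And>x. x \<in> \<Omega> \<Longrightarrow> \<bar>g x\<bar> \<le> S" and L: "\<And>x y. x \<in> \<Omega> \<Longrightarrow> y \<in> \<Omega> \<Longrightarrow> \<bar>g x - g y\<bar> \<le> L * norm (x - y)"
    and S0: "0 \<le> S" and L0: "0 \<le> L"
  shows "slobodeckij_sq \<sigma> \<Omega> v \<le> ennreal (2 * S * L) *
    (\<integral>\<^sup>+(x, y). ennreal (norm (x - y) powr (- (real CARD('n) + 2 * \<sigma> - 1))) \<partial>(lebesgue_on \<Omega> \<Otimes>\<^sub>M lebesgue_on \<Omega>))"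
proof -
  let ?M = "lebesgue_on \<Omega> \<Otimes>\<^sub>M lebesgue_on \<Omega>"
  let ?p = "real CARD('n) + 2 * \<sigma>"
  let ?w = "\<lambda>(x, y). ennreal (norm (x - y) powr (- (?p - 1)))"
  have "slobodeckij_sq \<sigma> \<Omega> v \<le> (\<integral>\<^sup>+z. ennreal (2 * S * L) * ?w z \<partial>?M)"
    unfolding slobodeckij_sq_def
  proof (rule nn_integral_mono_AE)
    show "AE z in ?M. (case z of (x, y) \<Rightarrow> ennreal ((v x - v y)\<^sup>2 / norm (x - y) powr ?p))
        \<le> ennreal (2 * S * L) * ?w z"
      using AE_pair_both[OF sigma_finite_lebesgue_on[OF \<Omega>] eq] AE_space[of ?M]
    proof eventually_elim
      case (elim z)
      obtain x y where z: "z = (x, y)" by (cases z)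
      have xy: "x \<in> \<Omega>" "y \<in> \<Omega>" and e: "v x = g x" "v y = g y" 
        using elim by (simp_all only: z fst_conv snd_conv space_pair_measure space_lebesgue_on mem_Times_iff)
      have "(g x - g y)\<^sup>2 / norm (x - y) powr ?p \<le> 2 * S * L * norm (x - y) powr (- (?p - 1))"
      proof (cases "x = y")
        case False
        then have n: "0 < norm (x - y)" by simp
        have "(g x - g y)\<^sup>2 = \<bar>g x - g y\<bar> * \<bar>g x - g y\<bar>" by (simp add: power2_eq_square)
        also have "\<dots> \<le> (2 * S) * (L * norm (x - y))"
          using S[OF xy(1)] S[OF xy(2)] L[OF xy] S0 by (intro mult_mono) auto
        finally have "(g x - g y)\<^sup>2 / norm (x - y) powr ?p \<le> 2 * S * L * (norm (x - y) / norm (x - y) powr ?p)"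
          using n by (simp add: divide_right_mono mult.assoc)
        also have "norm (x - y) / norm (x - y) powr ?p = norm (x - y) powr (- (?p - 1))"
          using n powr_diff[of "norm (x - y)" 1 ?p] by simp
        finally show ?thesis .
      qed simp
      then show ?case using S0 L0 by (simp add: z e ennreal_leI flip: ennreal_mult)
    qed
  qed
  also have "\<dots> = ennreal (2 * S * L) * (\<integral>\<^sup>+z. ?w z \<partial>?M)"
    by (rule nn_integral_cmult) simp
  finally show ?thesis .
qed

section \<open>The weight and the fractional Sobolev norm\<close>

lemma frac_lap_const_pos:
  assumes "0 < \<alpha>" "\<alpha> < 2"
  shows "0 < frac_lap_const d \<alpha>"
proof -
  \<comment> \<open>At a pole \<open>Gamma\<close> has the default value 0; the value
    \<open>- \<alpha> / 2\<close> lies strictly between \<open>- 1\<close> and \<open>0\<close> and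
    avoids the poles.\<close>
  have "- \<alpha> / 2 \<notin> \<int>\<^sub>\<le>\<^sub>0"
  proof
    assume "- \<alpha> / 2 \<in> \<int>\<^sub>\<le>\<^sub>0"
    then obtain n where "- \<alpha> / 2 = of_int n" by (auto simp: nonpos_Ints_def)
    then have "of_int (- 1) < (of_int n :: real)" "of_int n < (of_int 0 :: real)" using assms by auto
    then have "- 1 < n" "n < 0" by (simp_all only: of_int_less_iff)
    then show False by simp
  qed
  then have "Gamma (- \<alpha> / 2) \<noteq> 0" by (simp add: Gamma_eq_zero_iff)
  moreover have "0 < Gamma ((\<alpha> + real d) / 2)" using assms by (intro Gamma_real_pos) simp
  ultimately show ?thesis unfolding frac_lap_const_def
    by (intro divide_pos_pos mult_pos_pos) auto
qed

lemma rho_nn_integral_finite: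
  fixes \<Omega> :: "(real ^ 'n::finite) set"
  assumes "0 < \<alpha>" "open \<Omega>" "x \<in> \<Omega>"
  shows "(\<integral>\<^sup>+y. ennreal (norm (x - y) powr (- real CARD('n) - \<alpha>)) \<partial>lebesgue_on (- \<Omega>)) < \<infinity>"
proof -
  let ?k = "\<lambda>y. ennreal (norm (x - y) powr (- real CARD('n) - \<alpha>))"
  obtain \<delta> where \<delta>: "0 < \<delta>" "ball x \<delta> \<subseteq> \<Omega>" using assms openE by blast
  have "(\<integral>\<^sup>+y. ?k y \<partial>lebesgue_on (- \<Omega>))
      = (\<integral>\<^sup>+y. ?k y * indicator (- \<Omega>) y \<partial>lebesgue)"
    using assms by (intro nn_integral_restrict_space) (simp add: lebesgue_openin borel_open)
  also have "\<dots> \<le> (\<integral>\<^sup>+y. indicator (- ball x \<delta>) y * ennreal (norm (x - y) powr (- (real CARD('n) + \<alpha>))) \<partial>lebesgue)"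
  proof (rule nn_integral_mono)
    fix y
    show "?k y * indicator (- \<Omega>) y
        \<le> indicator (- ball x \<delta>) y * ennreal (norm (x - y) powr (- (real CARD('n) + \<alpha>)))"
      using \<delta>(2) by (cases "y \<in> \<Omega>") (auto simp: indicator_def)
  qed
  also have "\<dots> < \<infinity>" by (rule far_integral_bound) (use assms \<delta> in auto)
  finally show ?thesis .
qed

text \<open>\<open>rho\<close> is a Bochner integral, with default value 0 if the integrand fails to
  be integrable. On the open set the singularity is kept at positive distance, so it agrees with the
  nonnegative integral used for comparisons.\<close>

lemma ennreal_rho:
  fixes \<Omega> :: "(real ^ 'n::finite) set"
  assumes \<alpha>: "0 < \<alpha>" "\<alpha> < 2" and "open \<Omega>" "x \<in> \<Omega>"
  shows "ennreal (rho \<alpha> \<Omega> x) = ennreal (frac_lap_const CARD('n) \<alpha>) *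
    (\<integral>\<^sup>+y. ennreal (norm (x - y) powr (- real CARD('n) - \<alpha>)) \<partial>lebesgue_on (- \<Omega>))"
proof -
  have "integrable (lebesgue_on (- \<Omega>)) (\<lambda>y. norm (x - y) powr (- real CARD('n) - \<alpha>))"
    by (rule integrableI_nonneg) (use rho_nn_integral_finite[OF \<alpha>(1) assms(3,4)] in auto)
  then have "(\<integral>\<^sup>+y. ennreal (norm (x - y) powr (- real CARD('n) - \<alpha>)) \<partial>lebesgue_on (- \<Omega>))
      = ennreal (integral\<^sup>L (lebesgue_on (- \<Omega>)) (\<lambda>y. norm (x - y) powr (- real CARD('n) - \<alpha>)))"
    by (rule nn_integral_eq_integral) simp
  then show ?thesis
    using frac_lap_const_pos[OF \<alpha>, of "CARD('n)"] by (simp add: rho_def ennreal_mult')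
qed

lemma rho_nonneg:
  assumes "0 < \<alpha>" "\<alpha> < 2"
  shows "0 \<le> rho \<alpha> (\<Omega> :: (real ^ 'n::finite) set) x"
  unfolding rho_def using frac_lap_const_pos[OF assms, of "CARD('n)"]
  by (intro mult_nonneg_nonneg Bochner_Integration.integral_nonneg) auto

lemma rho_measurable:
  fixes \<Omega> :: "(real ^ 'n::finite) set"
  assumes "open \<Omega>"
  shows "rho \<alpha> \<Omega> \<in> borel_measurable (lebesgue_on \<Omega>)"
proof -
  have "- \<Omega> \<in> sets lebesgue" using assms by (simp add: borel_open)
  then interpret sigma_finite_measure "lebesgue_on (- \<Omega>)" by (rule sigma_finite_lebesgue_on)
  have "(\<lambda>x. integral\<^sup>L (lebesgue_on (- \<Omega>)) (\<lambda>y. norm (x - y) powr (- real CARD('n) - \<alpha>))) \<in> borel_measurable (lebesgue_on \<Omega>)"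
    by (rule borel_measurable_lebesgue_integral) (rule norm_diff_powr_measurable)
  then show ?thesis unfolding rho_def[abs_def] by (intro borel_measurable_times borel_measurable_const)
qed

lemma rho_lower_bound:
  fixes \<Omega> :: "(real ^ 'n::finite) set"
  assumes \<alpha>: "0 < \<alpha>" "\<alpha> < 2" and \<Omega>: "open \<Omega>" "bounded \<Omega>"
  shows "\<exists>m>0. \<forall>x\<in>\<Omega>. m \<le> rho \<alpha> \<Omega> x"
proof -
  let ?k = "\<lambda>x y. ennreal (norm (x - y) powr (- real CARD('n) - \<alpha>))"
  obtain B where B: "0 < B" "\<And>x. x \<in> \<Omega> \<Longrightarrow> norm x \<le> B" using \<Omega> by (auto simp: bounded_pos)
  \<comment> \<open>The unit ball around \<open>p\<close> misses \<Omega> and lies within distance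
    \<open>2 * B + 3\<close> of every point of \<Omega>; it alone gives the lower bound.\<close>
  obtain p :: "real ^ 'n" where p: "norm p = B + 2" using vector_choose_size[of "B + 2"] B by auto
  define t where "t = (2 * B + 3) powr (- real CARD('n) - \<alpha>)"
  define V where "V = unit_ball_vol (real CARD('n))"
  have t: "0 < t" using B by (simp add: t_def)
  have V: "0 < V" by (simp add: V_def)
  define c where "c = frac_lap_const CARD('n) \<alpha>"
  have c: "0 < c" unfolding c_def by (rule frac_lap_const_pos[OF \<alpha>])
  have "c * (t * V) \<le> rho \<alpha> \<Omega> x" if x: "x \<in> \<Omega>" for x
  proof -
    have "ennreal (t * V) = ennreal t * emeasure lebesgue (ball p 1)"
      using t V by (simp add: emeasure_ball V_def ennreal_mult')
    also have "\<dots> = (\<integral>\<^sup>+y. ennreal t * indicator (ball p 1) y \<partial>lebesgue)"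
      by (rule nn_integral_cmult_indicator[symmetric]) simp
    also have "\<dots> \<le> (\<integral>\<^sup>+y. ?k x y * indicator (- \<Omega>) y \<partial>lebesgue)"
    proof (rule nn_integral_mono)
      fix y
      show "ennreal t * indicator (ball p 1) y \<le> ?k x y * indicator (- \<Omega>) y"
      proof (cases "y \<in> ball p 1")
        case True
        then have y: "norm (p - y) < 1" by (simp add: dist_norm)
        have ny: "B + 1 < norm y" "norm y < B + 3"
          using norm_triangle_ineq2[of p "p - y"] norm_triangle_ineq4[of p "p - y"] y p by auto
        then have "y \<notin> \<Omega>" using B(2)[of y] by auto
        moreover have "norm (x - y) \<le> 2 * B + 3" using norm_triangle_ineq4[of x y] B(2)[OF x] ny by linarith
        moreover have "0 < norm (x - y)" using \<open>y \<notin> \<Omega>\<close> x by auto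
        ultimately have "t \<le> norm (x - y) powr (- real CARD('n) - \<alpha>)"
          unfolding t_def using \<alpha> by (intro powr_mono2') auto
        then show ?thesis using \<open>y \<notin> \<Omega>\<close> True by (simp add: ennreal_leI)
      qed simp
    qed
    also have "\<dots> = (\<integral>\<^sup>+y. ?k x y \<partial>lebesgue_on (- \<Omega>))"
      using \<Omega> by (intro nn_integral_restrict_space[symmetric]) (simp add: borel_open)
    finally have "ennreal c * ennreal (t * V) \<le> ennreal (rho \<alpha> \<Omega> x)"
      unfolding ennreal_rho[OF \<alpha> \<Omega>(1) x] c_def by (rule mult_left_mono) simp
    then have "ennreal (c * (t * V)) \<le> ennreal (rho \<alpha> \<Omega> x)" using c t V by (simp add: ennreal_mult')
    then show ?thesis using rho_nonneg[OF \<alpha>] by (subst (asm) ennreal_le_iff)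
  qed
  then show ?thesis using c t V by (intro exI[of _ "c * (t * V)"]) auto
qed

section \<open>Boundedness of the zero extension in the fractional norm\<close>

text \<open>The squared norm with values in \<open>ennreal\<close>, so that infinite values stay
  visible and series of squared norms need no convergence conditions; \<open>enn2real\<close> inside
  \<open>sobolev_norm\<close> would turn an infinite seminorm into 0.\<close>

definition sobolev_sq :: "real \<Rightarrow> (real ^ 'n::finite) set \<Rightarrow> (real ^ 'n \<Rightarrow> real) \<Rightarrow> ennreal" where
  "sobolev_sq s \<Omega> v = (\<integral>\<^sup>+x. ennreal ((v x)\<^sup>2) \<partial>lebesgue_on \<Omega>) + slobodeckij_sq s \<Omega> v"

definition weighted_sq :: "real \<Rightarrow> (real ^ 'n::finite) set \<Rightarrow> (real ^ 'n \<Rightarrow> real) \<Rightarrow> ennreal" where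
  "weighted_sq \<alpha> \<Omega> v = (\<integral>\<^sup>+x. ennreal (rho \<alpha> \<Omega> x * (v x)\<^sup>2) \<partial>lebesgue_on \<Omega>)"

lemma sobolev_iff_sq:
  assumes "0 < s" "s < 1"
  shows "v \<in> sobolev s \<Omega> \<longleftrightarrow> v \<in> borel_measurable (lebesgue_on \<Omega>) \<and> sobolev_sq s \<Omega> v < \<infinity>"
proof -
  have "integrable (lebesgue_on \<Omega>) (\<lambda>x. (v x)\<^sup>2) \<longleftrightarrow> (\<integral>\<^sup>+x. ennreal ((v x)\<^sup>2) \<partial>lebesgue_on \<Omega>) < \<infinity>"
    if "v \<in> borel_measurable (lebesgue_on \<Omega>)"
    using that by (simp add: integrable_iff_bounded)
  then show ?thesis unfolding sobolev_fractional[OF assms] L2_space_def sobolev_sq_def by auto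
qed

lemma sobolev_norm_nonneg: "0 \<le> sobolev_norm s \<Omega> v"
  unfolding sobolev_norm_def by (intro real_sqrt_ge_zero add_nonneg_nonneg) (auto intro!: sum_nonneg)

lemma sobolev_norm_sq:
  assumes "0 < s" "s < 1" "v \<in> sobolev s \<Omega>"
  shows "ennreal ((sobolev_norm s \<Omega> v)\<^sup>2) = sobolev_sq s \<Omega> v"
proof -
  have v: "v \<in> L2_space \<Omega>" "slobodeckij_sq s \<Omega> v < \<infinity>" using assms sobolev_fractional by blast+
  then have "(\<integral>\<^sup>+x. ennreal ((v x)\<^sup>2) \<partial>lebesgue_on \<Omega>) = ennreal (integral\<^sup>L (lebesgue_on \<Omega>) (\<lambda>x. (v x)\<^sup>2))"
    by (intro nn_integral_eq_integral) (auto simp: L2_space_def)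
  moreover have "0 \<le> integral\<^sup>L (lebesgue_on \<Omega>) (\<lambda>x. (v x)\<^sup>2)" by simp
  ultimately show ?thesis using v(2)
    by (simp add: sobolev_norm_fractional[OF assms(1,2)] sobolev_sq_def)
qed

lemma sq_diff_le: "(a - b)\<^sup>2 \<le> 2 * a\<^sup>2 + 2 * (b :: real)\<^sup>2"
  using zero_le_power2[of "a + b"] by (simp add: power2_eq_square algebra_simps)

lemma sobolev_diff:
  fixes \<Omega> :: "(real ^ 'n::finite) set"
  assumes s: "0 < s" "s < 1" and "u \<in> sobolev s \<Omega>" "v \<in> sobolev s \<Omega>"
  shows "(\<lambda>x. u x - v x) \<in> sobolev s \<Omega>"
proof -
  let ?M = "lebesgue_on \<Omega> \<Otimes>\<^sub>M lebesgue_on \<Omega>"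
  let ?p = "real CARD('n) + 2 * s"
  let ?U = "\<lambda>(x, y). ennreal ((u x - u y)\<^sup>2 / norm (x - y) powr ?p)" and ?V = "\<lambda>(x, y). ennreal ((v x - v y)\<^sup>2 / norm (x - y) powr ?p)"
  have m: "u \<in> borel_measurable (lebesgue_on \<Omega>)" "v \<in> borel_measurable (lebesgue_on \<Omega>)"
    and f: "sobolev_sq s \<Omega> u < \<infinity>" "sobolev_sq s \<Omega> v < \<infinity>"
    using assms by (auto simp: sobolev_iff_sq)
  have "(\<integral>\<^sup>+x. ennreal ((u x - v x)\<^sup>2) \<partial>lebesgue_on \<Omega>) \<le> (\<integral>\<^sup>+x. 2 * ennreal ((u x)\<^sup>2) + 2 * ennreal ((v x)\<^sup>2) \<partial>lebesgue_on \<Omega>)"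
  proof (rule nn_integral_mono)
    fix x
    have "ennreal ((u x - v x)\<^sup>2) \<le> ennreal (2 * (u x)\<^sup>2 + 2 * (v x)\<^sup>2)" by (intro ennreal_leI sq_diff_le)
    then show "ennreal ((u x - v x)\<^sup>2) \<le> 2 * ennreal ((u x)\<^sup>2) + 2 * ennreal ((v x)\<^sup>2)"
      by (simp add: ennreal_mult')
  qed
  also have "\<dots> = 2 * (\<integral>\<^sup>+x. ennreal ((u x)\<^sup>2) \<partial>lebesgue_on \<Omega>) + 2 * (\<integral>\<^sup>+x. ennreal ((v x)\<^sup>2) \<partial>lebesgue_on \<Omega>)"
    using m by (simp add: nn_integral_add nn_integral_cmult)
  also have "\<dots> < \<infinity>" using f by (simp add: sobolev_sq_def ennreal_mult_less_top)
  finally have 1: "(\<integral>\<^sup>+x. ennreal ((u x - v x)\<^sup>2) \<partial>lebesgue_on \<Omega>) < \<infinity>" .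
  have "slobodeckij_sq s \<Omega> (\<lambda>x. u x - v x) \<le>
      (\<integral>\<^sup>+z. 2 * ?U z +
        2 * ?V z \<partial>?M)"
    unfolding slobodeckij_sq_def
  proof (rule nn_integral_mono)
    fix z :: "(real ^ 'n) \<times> (real ^ 'n)"
    obtain x y where z: "z = (x, y)" by (cases z)
    have "(u x - v x - (u y - v y))\<^sup>2 = ((u x - u y) - (v x - v y))\<^sup>2" by (simp add: algebra_simps)
    also have "\<dots> \<le> 2 * (u x - u y)\<^sup>2 + 2 * (v x - v y)\<^sup>2" by (rule sq_diff_le)
    finally have "(u x - v x - (u y - v y))\<^sup>2 / norm (x - y) powr ?p
        \<le> (2 * (u x - u y)\<^sup>2 + 2 * (v x - v y)\<^sup>2) / norm (x - y) powr ?p"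
      by (rule divide_right_mono) simp
    then have "(u x - v x - (u y - v y))\<^sup>2 / norm (x - y) powr ?p
        \<le> 2 * ((u x - u y)\<^sup>2 / norm (x - y) powr ?p) + 2 * ((v x - v y)\<^sup>2 / norm (x - y) powr ?p)"
      by (simp add: add_divide_distrib)
    then have "ennreal ((u x - v x - (u y - v y))\<^sup>2 / norm (x - y) powr ?p)
        \<le> ennreal (2 * ((u x - u y)\<^sup>2 / norm (x - y) powr ?p) + 2 * ((v x - v y)\<^sup>2 / norm (x - y) powr ?p))"
      by (rule ennreal_leI)
    also have "\<dots> = 2 * ennreal ((u x - u y)\<^sup>2 / norm (x - y) powr ?p) + 2 * ennreal ((v x - v y)\<^sup>2 / norm (x - y) powr ?p)"
      by (simp only: ennreal_plus ennreal_mult' zero_le_numeral ennreal_numeral mult_nonneg_nonneg divide_nonneg_nonneg zero_le_power2 powr_ge_zero)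
    finally show "(case z of (x, y) \<Rightarrow> ennreal ((u x - v x - (u y - v y))\<^sup>2 / norm (x - y) powr ?p)) \<le>
       2 * ?U z +
        2 * ?V z" by (simp only: z prod.case)
  qed
  also have "\<dots> = 2 * slobodeckij_sq s \<Omega> u + 2 * slobodeckij_sq s \<Omega> v"
    unfolding slobodeckij_sq_def using slobodeckij_sq_measurable[OF m(1), of ?p] slobodeckij_sq_measurable[OF m(2), of ?p]
    by (simp only: nn_integral_add nn_integral_cmult borel_measurable_times_ennreal borel_measurable_const)
  also have "\<dots> < \<infinity>" using f by (simp add: sobolev_sq_def ennreal_mult_less_top)
  finally show ?thesis
    unfolding sobolev_iff_sq[OF s] using 1 m by (simp add: sobolev_sq_def)
qed

text \<open>For \<open>x\<close> inside and \<open>y\<close> outside \<Omega> the zero extension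
  contributes \<open>(v x)\<^sup>2\<close> to the Slobodeckij integral over the whole space.
  Integrating over these \<open>y\<close> produces the weight, up to the constant of the
  form.\<close>

lemma weighted_sq_finite:
  fixes \<Omega> :: "(real ^ 'n::finite) set"
  assumes \<alpha>: "0 < \<alpha>" "\<alpha> < 2" and \<Omega>: "open \<Omega>" and v: "v \<in> sobolev_tilde (\<alpha> / 2) \<Omega>"
  shows "weighted_sq \<alpha> \<Omega> v < \<infinity>"
proof -
  interpret sigma_finite_measure "lebesgue :: (real ^ 'n) measure" by (rule sigma_finite_lebesgue)
  let ?v = "zero_ext \<Omega> v" and ?p = "real CARD('n) + 2 * (\<alpha> / 2)" and ?c = "frac_lap_const CARD('n) \<alpha>"
  let ?k = "\<lambda>x y. ennreal (norm (x - y) powr (- real CARD('n) - \<alpha>))"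
  have s: "0 < \<alpha> / 2" "\<alpha> / 2 < 1" using \<alpha> by auto
  have "?v \<in> sobolev (\<alpha> / 2) UNIV" using v by (simp add: sobolev_tilde_def)
  then have m: "?v \<in> borel_measurable (lebesgue_on UNIV)" and f: "sobolev_sq (\<alpha> / 2) UNIV ?v < \<infinity>"
    by (simp_all add: sobolev_iff_sq[OF s])
  have \<Omega>m: "\<Omega> \<in> sets lebesgue" "- \<Omega> \<in> sets lebesgue" using \<Omega> by (auto simp: borel_open)
  define F where "F = (\<lambda>(x, y). ennreal ((?v x - ?v y)\<^sup>2 / norm (x - y) powr ?p))"
  have Fm: "F \<in> borel_measurable (lebesgue \<Otimes>\<^sub>M lebesgue)"
    using slobodeckij_sq_measurable[OF m, of ?p] by (simp add: F_def lebesgue_on_UNIV_eq)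
  have "weighted_sq \<alpha> \<Omega> v = (\<integral>\<^sup>+x. ennreal (rho \<alpha> \<Omega> x * (v x)\<^sup>2) * indicator \<Omega> x \<partial>lebesgue)"
    unfolding weighted_sq_def using \<Omega>m by (intro nn_integral_restrict_space) simp
  also have "\<dots> \<le> (\<integral>\<^sup>+x. ennreal ?c * (\<integral>\<^sup>+y. F (x, y) \<partial>lebesgue) \<partial>lebesgue)"
  proof (rule nn_integral_mono)
    fix x
    show "ennreal (rho \<alpha> \<Omega> x * (v x)\<^sup>2) * indicator \<Omega> x \<le> ennreal ?c * (\<integral>\<^sup>+y. F (x, y) \<partial>lebesgue)"
    proof (cases "x \<in> \<Omega>")
      case True
      have "ennreal (rho \<alpha> \<Omega> x * (v x)\<^sup>2) = ennreal (rho \<alpha> \<Omega> x) * ennreal ((v x)\<^sup>2)"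
        by (rule ennreal_mult') (rule rho_nonneg[OF \<alpha>])
      also have "\<dots> = ennreal ?c * (ennreal ((v x)\<^sup>2) * (\<integral>\<^sup>+y. ?k x y \<partial>lebesgue_on (- \<Omega>)))"
        unfolding ennreal_rho[OF \<alpha> \<Omega> True] by (simp add: mult_ac)
      also have "ennreal ((v x)\<^sup>2) * (\<integral>\<^sup>+y. ?k x y \<partial>lebesgue_on (- \<Omega>))
          = (\<integral>\<^sup>+y. ennreal ((v x)\<^sup>2) * ?k x y \<partial>lebesgue_on (- \<Omega>))"
        by (rule nn_integral_cmult[symmetric]) (rule measurable_compose[OF norm_diff_powr_measurable_snd measurable_ennreal])
      also have "\<dots> = (\<integral>\<^sup>+y. ennreal ((v x)\<^sup>2) * ?k x y * indicator (- \<Omega>) y \<partial>lebesgue)"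
        using \<Omega>m by (intro nn_integral_restrict_space) simp
      also have "\<dots> \<le> (\<integral>\<^sup>+y. F (x, y) \<partial>lebesgue)"
      proof (rule nn_integral_mono)
        fix y
        show "ennreal ((v x)\<^sup>2) * ?k x y * indicator (- \<Omega>) y \<le> F (x, y)"
        proof (cases "y \<in> \<Omega>")
          case False
          have "- real CARD('n) - \<alpha> = - ?p" by simp
          then have "norm (x - y) powr (- real CARD('n) - \<alpha>) = 1 / norm (x - y) powr ?p"
            by (simp only: powr_minus inverse_eq_divide)
          then show ?thesis using False True by (simp add: F_def zero_ext_def flip: ennreal_mult')
        qed simp
      qed
      finally have "ennreal (rho \<alpha> \<Omega> x * (v x)\<^sup>2) \<le> ennreal ?c * (\<integral>\<^sup>+y. F (x, y) \<partial>lebesgue)"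
        by (simp add: mult_left_mono)
      then show ?thesis using True by simp
    qed simp
  qed
  also have "\<dots> = ennreal ?c * (\<integral>\<^sup>+x. \<integral>\<^sup>+y. F (x, y) \<partial>lebesgue \<partial>lebesgue)"
    by (rule nn_integral_cmult) (rule borel_measurable_nn_integral_fst[OF Fm])
  also have "(\<integral>\<^sup>+x. \<integral>\<^sup>+y. F (x, y) \<partial>lebesgue \<partial>lebesgue) = integral\<^sup>N (lebesgue \<Otimes>\<^sub>M lebesgue) F"
    by (rule nn_integral_fst[OF Fm])
  also have "\<dots> = slobodeckij_sq (\<alpha> / 2) UNIV ?v"
    by (simp add: slobodeckij_sq_def F_def lebesgue_on_UNIV_eq)
  also have "ennreal ?c * \<dots> < \<infinity>" using f by (simp add: sobolev_sq_def ennreal_mult_less_top)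
  finally show ?thesis .
qed

text \<open>The reverse triangle inequality of the sequence space, for finite sections and then in
  the limit. With the values of a sequence of functions at two points as \<open>a\<close> and
  \<open>b\<close>, and \<open>K\<close> the kernel denominator, it compares integrands of
  Slobodeckij seminorms.\<close>

lemma l2_reverse_triangle:
  fixes a b :: "nat \<Rightarrow> real"
  assumes a: "summable (\<lambda>n. (a n)\<^sup>2)" and b: "summable (\<lambda>n. (b n)\<^sup>2)" and K: "0 \<le> K"
  shows "ennreal ((sqrt (\<Sum>n. (a n)\<^sup>2) - sqrt (\<Sum>n. (b n)\<^sup>2))\<^sup>2 / K) \<le> (\<Sum>n. ennreal ((a n - b n)\<^sup>2 / K))"
proof -
  let ?S = "\<Sum>n. ennreal ((a n - b n)\<^sup>2 / K)"
  let ?s = "\<lambda>N. (sqrt (\<Sum>n<N. (a n)\<^sup>2) - sqrt (\<Sum>n<N. (b n)\<^sup>2))\<^sup>2 / K"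
  have fin: "ennreal (?s N) \<le> ?S" for N
  proof -
    have t: "L2_set f {..<N} \<le> L2_set g {..<N} + L2_set (\<lambda>n. a n - b n) {..<N}"
      if "(f = a \<and> g = b) \<or> (f = b \<and> g = a)" for f g
    proof -
      have "L2_set f {..<N} \<le> L2_set g {..<N} + L2_set (\<lambda>n. f n - g n) {..<N}"
        using L2_set_triangle_ineq[of g "\<lambda>n. f n - g n" "{..<N}"] by simp
      also have "L2_set (\<lambda>n. f n - g n) {..<N} = L2_set (\<lambda>n. a n - b n) {..<N}"
        using that by (auto simp: L2_set_def power2_commute)
      finally show ?thesis .
    qed
    have "\<bar>L2_set a {..<N} - L2_set b {..<N}\<bar> \<le> L2_set (\<lambda>n. a n - b n) {..<N}"
      using t[of a b] t[of b a] by (auto simp: abs_le_iff)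
    then have "(L2_set a {..<N} - L2_set b {..<N})\<^sup>2 \<le> (L2_set (\<lambda>n. a n - b n) {..<N})\<^sup>2"
      by (metis abs_ge_zero power2_abs power_mono)
    also have "\<dots> = (\<Sum>n<N. (a n - b n)\<^sup>2)" by (simp add: L2_set_def sum_nonneg)
    finally have "?s N \<le> (\<Sum>n<N. (a n - b n)\<^sup>2) / K"
      using K by (intro divide_right_mono) (auto simp: L2_set_def)
    then have "ennreal (?s N) \<le> ennreal (\<Sum>n<N. (a n - b n)\<^sup>2 / K)"
      by (intro ennreal_leI) (simp add: sum_divide_distrib)
    also have "\<dots> = (\<Sum>n<N. ennreal ((a n - b n)\<^sup>2 / K))" using K by (simp add: sum_ennreal)
    also have "\<dots> \<le> ?S" by (rule sum_le_suminf[OF summableI]) auto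
    finally show ?thesis .
  qed
  have "(\<lambda>N. ennreal (?s N)) \<longlonglongrightarrow>
      ennreal ((sqrt (\<Sum>n. (a n)\<^sup>2) - sqrt (\<Sum>n. (b n)\<^sup>2))\<^sup>2 / K)"
    unfolding divide_inverse
    by (intro tendsto_ennrealI tendsto_mult tendsto_const tendsto_power tendsto_diff tendsto_real_sqrt summable_LIMSEQ a b)
  then show ?thesis by (rule Lim_bounded) (use fin in auto)
qed

text \<open>The pointwise Euclidean norm of the sequence takes the place of its sum: squares then
  add without cross terms, so a weighted square of the superposition is exactly the sum of the
  weighted squares. The default value 0 of \<open>enn2real\<close> at infinity occurs only on a null
  set when the total squared norm is finite.\<close>

definition l2_superposition :: "(nat \<Rightarrow> 'a \<Rightarrow> real) \<Rightarrow> 'a \<Rightarrow> real" where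
  "l2_superposition w x = sqrt (enn2real (\<Sum>n. ennreal ((w n x)\<^sup>2)))"

text \<open>The zeroth order part adds exactly by monotone convergence. For the seminorm the reverse
  triangle inequality holds at almost every pair of points, namely where both pointwise series are
  finite.\<close>

lemma l2_superposition:
  fixes \<Omega> :: "(real ^ 'n::finite) set"
  assumes \<Omega>: "\<Omega> \<in> sets lebesgue" and w: "\<And>n. w n \<in> borel_measurable (lebesgue_on \<Omega>)"
    and fin: "(\<Sum>n. sobolev_sq s \<Omega> (w n)) < \<infinity>"
  shows "l2_superposition w \<in> borel_measurable (lebesgue_on \<Omega>)"
    and "AE x in lebesgue_on \<Omega>. ennreal ((l2_superposition w x)\<^sup>2) = (\<Sum>n. ennreal ((w n x)\<^sup>2))"
    and "sobolev_sq s \<Omega> (l2_superposition w) \<le> (\<Sum>n. sobolev_sq s \<Omega> (w n))"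
proof -
  let ?q = "\<lambda>x. \<Sum>n. ennreal ((w n x)\<^sup>2)"
  let ?L = "lebesgue_on \<Omega>"
  let ?M = "?L \<Otimes>\<^sub>M ?L" and ?p = "real CARD('n) + 2 * s"
  have w2: "(\<lambda>x. ennreal ((w n x)\<^sup>2)) \<in> borel_measurable ?L" for n
    by (rule measurable_compose[OF borel_measurable_power[OF w] measurable_ennreal])
  have S: "(\<lambda>x. \<Sum>n. ennreal ((w n x)\<^sup>2)) \<in> borel_measurable ?L"
    by (rule borel_measurable_suminf_order[OF w2])
  show 1: "l2_superposition w \<in> borel_measurable ?L"
    unfolding l2_superposition_def[abs_def]
    by (rule measurable_compose[OF borel_measurable_enn2real[OF S] borel_measurable_sqrt])
  have int: "(\<integral>\<^sup>+x. ?q x \<partial>?L) = (\<Sum>n. \<integral>\<^sup>+x. ennreal ((w n x)\<^sup>2) \<partial>?L)"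
    by (rule nn_integral_suminf[OF w2])
  also have "\<dots> \<le> (\<Sum>n. sobolev_sq s \<Omega> (w n))"
    unfolding sobolev_sq_def by (intro suminf_le summableI add_increasing2 order_refl zero_le)
  also have "\<dots> < \<infinity>" by (rule fin)
  finally have "(\<integral>\<^sup>+x. ?q x \<partial>?L) \<noteq> \<infinity>" by (rule less_imp_neq)
  then have ae: "AE x in ?L. ?q x \<noteq> \<infinity>"
    by (rule nn_integral_PInf_AE[OF S])
  have good: "summable (\<lambda>n. (w n x)\<^sup>2)" "l2_superposition w x = sqrt (\<Sum>n. (w n x)\<^sup>2)"
    "ennreal ((l2_superposition w x)\<^sup>2) = ?q x"
    if x: "?q x \<noteq> \<infinity>" for x
  proof -
    show sm: "summable (\<lambda>n. (w n x)\<^sup>2)" 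
      using x by (intro summable_suminf_not_top) (simp_all only: infinity_ennreal_def not_False_eq_True zero_le_power2)
    have e: "?q x = ennreal (\<Sum>n. (w n x)\<^sup>2)"
      using x by (intro suminf_ennreal) (simp_all only: infinity_ennreal_def not_False_eq_True zero_le_power2)
    have "0 \<le> (\<Sum>n. (w n x)\<^sup>2)" by (rule suminf_nonneg[OF sm]) simp
    then show "l2_superposition w x = sqrt (\<Sum>n. (w n x)\<^sup>2)"
      "ennreal ((l2_superposition w x)\<^sup>2) = ?q x"
      by (simp_all add: l2_superposition_def e)
  qed
  show 2: "AE x in ?L. ennreal ((l2_superposition w x)\<^sup>2) = ?q x"
    by (rule eventually_mono[OF ae good(3)])
  have "slobodeckij_sq s \<Omega> (l2_superposition w)
      \<le> (\<integral>\<^sup>+z. (\<Sum>n. case z of (x, y) \<Rightarrow> ennreal ((w n x - w n y)\<^sup>2 / norm (x - y) powr ?p)) \<partial>?M)"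
    unfolding slobodeckij_sq_def
  proof (rule nn_integral_mono_AE)
    show "AE z in ?M. (case z of (x, y) \<Rightarrow> ennreal ((l2_superposition w x - l2_superposition w y)\<^sup>2 / norm (x - y) powr ?p))
        \<le> (\<Sum>n. case z of (x, y) \<Rightarrow> ennreal ((w n x - w n y)\<^sup>2 / norm (x - y) powr ?p))"
      using AE_pair_both[OF sigma_finite_lebesgue_on[OF \<Omega>] ae]
    proof eventually_elim
      case (elim z)
      obtain x y where z: "z = (x, y)" by (cases z)
      have g: "?q x \<noteq> \<infinity>" "?q y \<noteq> \<infinity>"
        using elim unfolding z fst_conv snd_conv by blast+
      show ?case
        unfolding z prod.case good(2)[OF g(1)] good(2)[OF g(2)]
        by (rule l2_reverse_triangle[OF good(1)[OF g(1)] good(1)[OF g(2)] powr_ge_zero])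
    qed
  qed
  also have "\<dots> = (\<Sum>n. slobodeckij_sq s \<Omega> (w n))"
    unfolding slobodeckij_sq_def by (rule nn_integral_suminf) (rule slobodeckij_sq_measurable[OF w])
  finally have "slobodeckij_sq s \<Omega> (l2_superposition w) \<le> (\<Sum>n. slobodeckij_sq s \<Omega> (w n))" .
  moreover have "(\<integral>\<^sup>+x. ennreal ((l2_superposition w x)\<^sup>2) \<partial>?L) = (\<Sum>n. \<integral>\<^sup>+x. ennreal ((w n x)\<^sup>2) \<partial>?L)"
    by (rule trans[OF nn_integral_cong_AE[OF 2] int])
  ultimately have "sobolev_sq s \<Omega> (l2_superposition w) \<le>
      (\<Sum>n. \<integral>\<^sup>+x. ennreal ((w n x)\<^sup>2) \<partial>?L) + (\<Sum>n. slobodeckij_sq s \<Omega> (w n))"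
    unfolding sobolev_sq_def by (simp only: add_left_mono)
  also have "\<dots> = (\<Sum>n. sobolev_sq s \<Omega> (w n))"
    unfolding sobolev_sq_def by (rule suminf_add[OF summableI summableI])
  finally show "sobolev_sq s \<Omega> (l2_superposition w) \<le> (\<Sum>n. sobolev_sq s \<Omega> (w n))" .
qed

lemma sobolev_sq_scale:
  fixes \<Omega> :: "(real ^ 'n::finite) set"
  assumes v: "v \<in> borel_measurable (lebesgue_on \<Omega>)"
  shows "sobolev_sq s \<Omega> (\<lambda>x. r * v x) = ennreal (r\<^sup>2) * sobolev_sq s \<Omega> v"
proof -
  have "(\<integral>\<^sup>+x. ennreal ((r * v x)\<^sup>2) \<partial>lebesgue_on \<Omega>) = (\<integral>\<^sup>+x. ennreal (r\<^sup>2) * ennreal ((v x)\<^sup>2) \<partial>lebesgue_on \<Omega>)"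
    by (simp only: power_mult_distrib ennreal_mult'[OF zero_le_power2])
  also have "\<dots> = ennreal (r\<^sup>2) * (\<integral>\<^sup>+x. ennreal ((v x)\<^sup>2) \<partial>lebesgue_on \<Omega>)"
    by (rule nn_integral_cmult) (rule measurable_compose[OF borel_measurable_power[OF v] measurable_ennreal])
  finally have 1: "(\<integral>\<^sup>+x. ennreal ((r * v x)\<^sup>2) \<partial>lebesgue_on \<Omega>) = ennreal (r\<^sup>2) * (\<integral>\<^sup>+x. ennreal ((v x)\<^sup>2) \<partial>lebesgue_on \<Omega>)" .
  have 2: "slobodeckij_sq s \<Omega> (\<lambda>x. r * v x) = ennreal (r\<^sup>2) * slobodeckij_sq s \<Omega> v"
    unfolding slobodeckij_sq_def nn_integral_cmult[OF slobodeckij_sq_measurable[OF v], symmetric]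
  proof (rule nn_integral_cong)
    fix z :: "(real ^ 'n) \<times> (real ^ 'n)"
    obtain x y where z: "z = (x, y)" by (cases z)
    have "(r * v x - r * v y)\<^sup>2 / q = r\<^sup>2 * ((v x - v y)\<^sup>2 / q)" for q
      by (simp only: right_diff_distrib[symmetric] power_mult_distrib times_divide_eq_right)
    then show "(case z of (x, y) \<Rightarrow> ennreal ((r * v x - r * v y)\<^sup>2 / norm (x - y) powr (real CARD('n) + 2 * s))) =
        ennreal (r\<^sup>2) * (case z of (x, y) \<Rightarrow> ennreal ((v x - v y)\<^sup>2 / norm (x - y) powr (real CARD('n) + 2 * s)))"
      by (simp only: z prod.case ennreal_mult'[OF zero_le_power2])
  qed
  show ?thesis unfolding sobolev_sq_def 1 2 by (rule distrib_left[symmetric])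
qed

lemma weighted_sq_scale:
  fixes \<Omega> :: "(real ^ 'n::finite) set"
  assumes v: "v \<in> borel_measurable (lebesgue_on \<Omega>)" and \<Omega>: "open \<Omega>"
  shows "weighted_sq \<alpha> \<Omega> (\<lambda>x. r * v x) = ennreal (r\<^sup>2) * weighted_sq \<alpha> \<Omega> v"
proof -
  have "weighted_sq \<alpha> \<Omega> (\<lambda>x. r * v x) = (\<integral>\<^sup>+x. ennreal (r\<^sup>2) * ennreal (rho \<alpha> \<Omega> x * (v x)\<^sup>2) \<partial>lebesgue_on \<Omega>)"
    by (simp add: weighted_sq_def power_mult_distrib mult.left_commute flip: ennreal_mult')
  also have "\<dots> = ennreal (r\<^sup>2) * weighted_sq \<alpha> \<Omega> v"
    unfolding weighted_sq_def
    by (intro nn_integral_cmult measurable_compose[OF _ measurable_ennreal] borel_measurable_times rho_measurable[OF \<Omega>] borel_measurable_power v)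
  finally show ?thesis .
qed

text \<open>If no constant worked, there would be functions whose weighted square exceeds
  \<open>2 ^ n\<close> times their Sobolev square. Scaled to weighted square 1, their Sobolev
  squares are at most \<open>(1/2) ^ n\<close> and summable. The superposition is then a Sobolev
  function of infinite weighted square, which the equality of the two spaces rules out.\<close>

lemma weighted_sq_bounded:
  fixes \<Omega> :: "(real ^ 'n::finite) set"
  assumes \<alpha>: "0 < \<alpha>" "\<alpha> < 2" and \<Omega>: "open \<Omega>" and eq: "sobolev (\<alpha> / 2) \<Omega> = sobolev_tilde (\<alpha> / 2) \<Omega>"
  shows "\<exists>C\<ge>0. \<forall>v\<in>sobolev (\<alpha> / 2) \<Omega>. weighted_sq \<alpha> \<Omega> v \<le> ennreal C * sobolev_sq (\<alpha> / 2) \<Omega> v"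
proof (rule ccontr)
  let ?W = "weighted_sq \<alpha> \<Omega>" and ?S = "sobolev_sq (\<alpha> / 2) \<Omega>" and ?H = "sobolev (\<alpha> / 2) \<Omega>"
  assume contra: "\<not> ?thesis"
  have s: "0 < \<alpha> / 2" "\<alpha> / 2 < 1" using \<alpha> by auto
  have \<Omega>m: "\<Omega> \<in> sets lebesgue" using \<Omega> by (simp add: borel_open)
  have fin: "?W v < \<infinity>" if "v \<in> ?H" for v
    using weighted_sq_finite[OF \<alpha> \<Omega>] that eq by simp
  have "\<exists>v\<in>?H. ennreal (2 ^ n) * ?S v < ?W v" for n :: nat
  proof (rule ccontr)
    assume "\<not> ?thesis"
    then have "\<forall>v\<in>?H. ?W v \<le> ennreal (2 ^ n) * ?S v"
      by (meson not_less)
    then have "\<exists>C\<ge>0. \<forall>v\<in>?H. ?W v \<le> ennreal C * ?S v"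
      by (intro exI[of _ "2 ^ n"] conjI) simp_all
    with contra show False ..
  qed
  then obtain v where v: "\<And>n. v n \<in> ?H"
    and vn: "\<And>n. ennreal (2 ^ n) * ?S (v n) < ?W (v n)" by metis
  have vm: "v n \<in> borel_measurable (lebesgue_on \<Omega>)" for n using v[of n] by (simp add: sobolev_iff_sq[OF s])
  define r where "r = (\<lambda>n. 1 / sqrt (enn2real (?W (v n))))"
  define w where "w = (\<lambda>n x. r n * v n x)"
  have R: "0 < enn2real (?W (v n))" "?W (v n) = ennreal (enn2real (?W (v n)))" for n
  proof -
    have "0 < ?W (v n)" using vn[of n] by (rule le_less_trans[rotated]) simp
    then show "0 < enn2real (?W (v n))" using fin[OF v[of n]] by (simp add: enn2real_positive_iff)
    show "?W (v n) = ennreal (enn2real (?W (v n)))" using fin[OF v[of n]] by simp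
  qed
  have wm: "w n \<in> borel_measurable (lebesgue_on \<Omega>)" for n
    unfolding w_def by (intro borel_measurable_times borel_measurable_const vm)
  have W1: "?W (w n) = 1" for n
  proof -
    have "?W (w n) = ennreal ((r n)\<^sup>2) * ennreal (enn2real (?W (v n)))"
      unfolding w_def using weighted_sq_scale[OF vm \<Omega>] R(2) by metis
    also have "\<dots> = ennreal ((r n)\<^sup>2 * enn2real (?W (v n)))" by (simp add: ennreal_mult')
    also have "(r n)\<^sup>2 * enn2real (?W (v n)) = 1" using R(1)[of n] by (simp add: r_def power_divide)
    finally show ?thesis by simp
  qed
  have S: "?S (w n) \<le> ennreal ((1/2) ^ n)" for n
  proof -
    have "ennreal (2 ^ n) * ?S (w n) = ennreal ((r n)\<^sup>2) * (ennreal (2 ^ n) * ?S (v n))"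
      unfolding w_def sobolev_sq_scale[OF vm] by (simp add: mult_ac)
    also have "\<dots> \<le> ennreal ((r n)\<^sup>2) * ?W (v n)" using vn[of n] by (intro mult_left_mono) auto
    also have "\<dots> = 1" using W1[of n] weighted_sq_scale[OF vm \<Omega>, of \<alpha> "r n" n] by (simp add: w_def)
    finally have "ennreal ((1/2) ^ n) * (ennreal (2 ^ n) * ?S (w n)) \<le> ennreal ((1/2) ^ n) * 1"
      by (rule mult_left_mono) simp
    moreover have "ennreal ((1/2) ^ n) * ennreal (2 ^ n) = 1"
      by (simp add: power_divide flip: ennreal_mult')
    ultimately show ?thesis by (simp only: mult.assoc[symmetric] mult_1 mult_1_right)
  qed
  have "(\<Sum>n. ?S (w n)) \<le> (\<Sum>n. ennreal ((1/2) ^ n))"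
    by (intro suminf_le summableI S)
  also have "\<dots> = ennreal 2"
    using geometric_sums[of "1/2 :: real"] by (intro suminf_ennreal_eq) auto
  finally have sum: "(\<Sum>n. ?S (w n)) < \<infinity>" by (rule le_less_trans) simp
  note sp = l2_superposition[OF \<Omega>m wm sum]
  have "l2_superposition w \<in> ?H"
    unfolding sobolev_iff_sq[OF s] using sp(1) le_less_trans[OF sp(3) sum] by blast
  then have "?W (l2_superposition w) < \<infinity>" by (rule fin)
  moreover have "?W (l2_superposition w) = (\<integral>\<^sup>+x. (\<Sum>n. ennreal (rho \<alpha> \<Omega> x * (w n x)\<^sup>2)) \<partial>lebesgue_on \<Omega>)"
    unfolding weighted_sq_def
  proof (rule nn_integral_cong_AE)
    show "AE x in lebesgue_on \<Omega>. ennreal (rho \<alpha> \<Omega> x * (l2_superposition w x)\<^sup>2) = (\<Sum>n. ennreal (rho \<alpha> \<Omega> x * (w n x)\<^sup>2))"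
      using sp(2)
    proof eventually_elim
      case (elim x)
      then show ?case using rho_nonneg[OF \<alpha>, of \<Omega> x] by (simp add: ennreal_mult')
    qed
  qed
  also have "\<dots> = (\<Sum>n. ?W (w n))"
    unfolding weighted_sq_def
    by (intro nn_integral_suminf measurable_compose[OF _ measurable_ennreal] borel_measurable_times rho_measurable[OF \<Omega>] borel_measurable_power wm)
  also have "\<dots> = \<infinity>" 
  proof (rule ccontr)
    assume "(\<Sum>n. ?W (w n)) \<noteq> \<infinity>"
    then have "(\<Sum>n::nat. ennreal 1) \<noteq> top" by (simp only: W1 ennreal_1 infinity_ennreal_def not_False_eq_True)
    then have "summable (\<lambda>_ :: nat. 1 :: real)" by (intro summable_suminf_not_top) auto
    then show False by (simp add: summable_const_iff)
  qed
  ultimately show False by simp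
qed

section \<open>The energy norm and Galerkin approximation\<close>

lemma slobodeckij_integrable:
  fixes \<Omega> :: "(real ^ 'n::finite) set"
  assumes \<alpha>: "0 < \<alpha>" "\<alpha> < 2" and v: "v \<in> sobolev (\<alpha> / 2) \<Omega>"
  shows "integrable (lebesgue_on \<Omega> \<Otimes>\<^sub>M lebesgue_on \<Omega>) (\<lambda>(x, y). (v x - v y)\<^sup>2 / norm (x - y) powr (real CARD('n) + \<alpha>))"
    and "integral\<^sup>L (lebesgue_on \<Omega> \<Otimes>\<^sub>M lebesgue_on \<Omega>) (\<lambda>(x, y). (v x - v y)\<^sup>2 / norm (x - y) powr (real CARD('n) + \<alpha>))
      = enn2real (slobodeckij_sq (\<alpha> / 2) \<Omega> v)"
proof -
  let ?M = "lebesgue_on \<Omega> \<Otimes>\<^sub>M lebesgue_on \<Omega>"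
  let ?f = "\<lambda>(x, y). (v x - v y)\<^sup>2 / norm (x - y) powr (real CARD('n) + \<alpha>)"
  have s: "0 < \<alpha> / 2" "\<alpha> / 2 < 1" using \<alpha> by auto
  have m: "v \<in> borel_measurable (lebesgue_on \<Omega>)" and f: "sobolev_sq (\<alpha> / 2) \<Omega> v < \<infinity>"
    using v by (simp_all only: sobolev_iff_sq[OF s])
  have fm: "?f \<in> borel_measurable ?M" using slobodeckij_measurable[OF m m, of "real CARD('n) + \<alpha>"] by (simp only: power2_eq_square)
  have nn: "AE z in ?M. 0 \<le> ?f z" by (rule AE_I2) (simp add: split_beta')
  have eq: "(\<integral>\<^sup>+z. ennreal (?f z) \<partial>?M) = slobodeckij_sq (\<alpha> / 2) \<Omega> v"
    unfolding slobodeckij_sq_def by (intro nn_integral_cong) (simp add: split_beta')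
  have "slobodeckij_sq (\<alpha> / 2) \<Omega> v < \<infinity>" using f by (simp add: sobolev_sq_def)
  then show "integrable ?M ?f" by (intro integrableI_nonneg fm nn) (simp only: eq)
  show "integral\<^sup>L ?M ?f = enn2real (slobodeckij_sq (\<alpha> / 2) \<Omega> v)"
    using integral_eq_nn_integral[OF fm nn] by (simp only: eq)
qed

lemma abs_prod_div_le: "\<bar>a * b / K\<bar> \<le> a\<^sup>2 / K + b\<^sup>2 / K" if "0 \<le> K" for a b K :: real
proof -
  have "\<bar>a * b\<bar> \<le> a\<^sup>2 + b\<^sup>2"
    using zero_le_power2[of "a - b"] zero_le_power2[of "a + b"] zero_le_power2[of a] zero_le_power2[of b]
    unfolding power2_diff power2_sum abs_le_iff by linarith
  then show ?thesis using that by (simp add: abs_divide divide_right_mono flip: add_divide_distrib)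
qed

lemma frac_form_integrable:
  fixes \<Omega> :: "(real ^ 'n::finite) set"
  assumes \<alpha>: "0 < \<alpha>" "\<alpha> < 2" and u: "u \<in> sobolev (\<alpha> / 2) \<Omega>" and v: "v \<in> sobolev (\<alpha> / 2) \<Omega>"
  shows "integrable (lebesgue_on \<Omega> \<Otimes>\<^sub>M lebesgue_on \<Omega>)
    (\<lambda>(x, y). (u x - u y) * (v x - v y) / norm (x - y) powr (real CARD('n) + \<alpha>))"
proof (rule Bochner_Integration.integrable_bound)
  let ?U = "\<lambda>(x, y). (u x - u y)\<^sup>2 / norm (x - y) powr (real CARD('n) + \<alpha>)" and ?V = "\<lambda>(x, y). (v x - v y)\<^sup>2 / norm (x - y) powr (real CARD('n) + \<alpha>)"
    and ?W = "\<lambda>(x, y). (u x - u y) * (v x - v y) / norm (x - y) powr (real CARD('n) + \<alpha>)"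
  have s: "0 < \<alpha> / 2" "\<alpha> / 2 < 1" using \<alpha> by auto
  show "integrable (lebesgue_on \<Omega> \<Otimes>\<^sub>M lebesgue_on \<Omega>)
     (\<lambda>z. ?U z +
       ?V z)"
    by (intro Bochner_Integration.integrable_add slobodeckij_integrable \<alpha> u v)
  show "?W \<in> borel_measurable (lebesgue_on \<Omega> \<Otimes>\<^sub>M lebesgue_on \<Omega>)"
    using u v by (intro slobodeckij_measurable) (simp_all only: sobolev_iff_sq[OF s])
  show "AE z in lebesgue_on \<Omega> \<Otimes>\<^sub>M lebesgue_on \<Omega>.
     norm (?W z)
     \<le> norm (?U z +
       ?V z)"
  proof (rule AE_I2)
    fix z :: "(real ^ 'n) \<times> (real ^ 'n)"
    obtain x y where z: "z = (x, y)" by (cases z)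
    show "norm (?W z)
     \<le> norm (?U z +
       ?V z)"
      unfolding z prod.case real_norm_def
      by (rule order_trans[OF abs_prod_div_le[OF powr_ge_zero] abs_ge_self])
  qed
qed

lemma rho_integrable:
  fixes \<Omega> :: "(real ^ 'n::finite) set"
  assumes \<alpha>: "0 < \<alpha>" "\<alpha> < 2" and \<Omega>: "open \<Omega>"
    and u: "u \<in> borel_measurable (lebesgue_on \<Omega>)" "weighted_sq \<alpha> \<Omega> u < \<infinity>"
    and v: "v \<in> borel_measurable (lebesgue_on \<Omega>)" "weighted_sq \<alpha> \<Omega> v < \<infinity>"
  shows "integrable (lebesgue_on \<Omega>) (\<lambda>x. rho \<alpha> \<Omega> x * u x * v x)"
proof (rule Bochner_Integration.integrable_bound)
  have int: "integrable (lebesgue_on \<Omega>) (\<lambda>x. rho \<alpha> \<Omega> x * (w x)\<^sup>2)"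
    if "w \<in> borel_measurable (lebesgue_on \<Omega>)" "weighted_sq \<alpha> \<Omega> w < \<infinity>" for w
    by (intro integrableI_nonneg borel_measurable_times rho_measurable[OF \<Omega>] borel_measurable_power that AE_I2
        mult_nonneg_nonneg rho_nonneg[OF \<alpha>] zero_le_power2 that(2)[unfolded weighted_sq_def])
  show "integrable (lebesgue_on \<Omega>) (\<lambda>x. rho \<alpha> \<Omega> x * (u x)\<^sup>2 + rho \<alpha> \<Omega> x * (v x)\<^sup>2)"
    by (intro Bochner_Integration.integrable_add int u v)
  show "(\<lambda>x. rho \<alpha> \<Omega> x * u x * v x) \<in> borel_measurable (lebesgue_on \<Omega>)"
    by (intro borel_measurable_times rho_measurable[OF \<Omega>] u v)
  show "AE x in lebesgue_on \<Omega>. norm (rho \<alpha> \<Omega> x * u x * v x) \<le> norm (rho \<alpha> \<Omega> x * (u x)\<^sup>2 + rho \<alpha> \<Omega> x * (v x)\<^sup>2)"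
  proof (rule AE_I2)
    fix x
    have "rho \<alpha> \<Omega> x * \<bar>u x * v x\<bar> \<le> rho \<alpha> \<Omega> x * ((u x)\<^sup>2 + (v x)\<^sup>2)"
      using abs_prod_div_le[of 1 "u x" "v x"] by (intro mult_left_mono rho_nonneg[OF \<alpha>]) simp
    then show "norm (rho \<alpha> \<Omega> x * u x * v x) \<le> norm (rho \<alpha> \<Omega> x * (u x)\<^sup>2 + rho \<alpha> \<Omega> x * (v x)\<^sup>2)"
      using rho_nonneg[OF \<alpha>, of \<Omega> x] by (simp add: abs_mult mult.assoc flip: distrib_left)
  qed
qed

lemma frac_form_commute: "frac_form \<alpha> \<Omega> u v = frac_form \<alpha> \<Omega> v u"
  unfolding frac_form_def by (simp only: mult.commute[of "u _ - u _"] mult.assoc mult.commute[of "u _"])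

text \<open>The Bochner integral is linear only on integrable functions. The double integral is
  controlled by the two seminorms; the weighted one is integrable because all three functions belong
  to the tilde space.\<close>

lemma frac_form_diff:
  fixes \<Omega> :: "(real ^ 'n::finite) set"
  assumes \<alpha>: "0 < \<alpha>" "\<alpha> < 2" and \<Omega>: "open \<Omega>" and eq: "sobolev (\<alpha> / 2) \<Omega> = sobolev_tilde (\<alpha> / 2) \<Omega>"
    and u: "u \<in> sobolev (\<alpha> / 2) \<Omega>" and w: "w \<in> sobolev (\<alpha> / 2) \<Omega>" and v: "v \<in> sobolev (\<alpha> / 2) \<Omega>"
  shows "frac_form \<alpha> \<Omega> (\<lambda>x. u x - w x) v = frac_form \<alpha> \<Omega> u v - frac_form \<alpha> \<Omega> w v"
proof -
  let ?U = "\<lambda>(x, y). (u x - u y) * (v x - v y) / norm (x - y) powr (real CARD('n) + \<alpha>)" and ?W = "\<lambda>(x, y). (w x - w y) * (v x - v y) / norm (x - y) powr (real CARD('n) + \<alpha>)"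
    and ?D = "\<lambda>(x, y). (u x - w x - (u y - w y)) * (v x - v y) / norm (x - y) powr (real CARD('n) + \<alpha>)"
  let ?M = "lebesgue_on \<Omega> \<Otimes>\<^sub>M lebesgue_on \<Omega>"
  have s: "0 < \<alpha> / 2" "\<alpha> / 2 < 1" using \<alpha> by auto
  have m: "z \<in> borel_measurable (lebesgue_on \<Omega>)" "weighted_sq \<alpha> \<Omega> z < \<infinity>" if "z \<in> sobolev (\<alpha> / 2) \<Omega>" for z
    using that weighted_sq_finite[OF \<alpha> \<Omega>] eq sobolev_iff_sq[OF s] by blast+
  have "integral\<^sup>L ?M ?D
      = integral\<^sup>L ?M (\<lambda>z. ?U z
         - ?W z)"
  proof (rule Bochner_Integration.integral_cong[OF refl])
    fix z :: "(real ^ 'n) \<times> (real ^ 'n)"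
    obtain x y where z: "z = (x, y)" by (cases z)
    have "(u x - w x - (u y - w y)) * (v x - v y) / K = (u x - u y) * (v x - v y) / K - (w x - w y) * (v x - v y) / K" for K
      by (simp add: algebra_simps flip: diff_divide_distrib)
    then show "?D z
       = ?U z
         - ?W z"
      by (simp only: z prod.case)
  qed
  also have "\<dots> = integral\<^sup>L ?M ?U
      - integral\<^sup>L ?M ?W"
    by (intro Bochner_Integration.integral_diff frac_form_integrable \<alpha> u v w)
  finally have 1: "integral\<^sup>L ?M ?D = \<dots>" .
  have "integral\<^sup>L (lebesgue_on \<Omega>) (\<lambda>x. rho \<alpha> \<Omega> x * (u x - w x) * v x)
      = integral\<^sup>L (lebesgue_on \<Omega>) (\<lambda>x. rho \<alpha> \<Omega> x * u x * v x - rho \<alpha> \<Omega> x * w x * v x)"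
    by (intro Bochner_Integration.integral_cong refl) (simp add: algebra_simps)
  also have "\<dots> = integral\<^sup>L (lebesgue_on \<Omega>) (\<lambda>x. rho \<alpha> \<Omega> x * u x * v x) - integral\<^sup>L (lebesgue_on \<Omega>) (\<lambda>x. rho \<alpha> \<Omega> x * w x * v x)"
    by (intro Bochner_Integration.integral_diff rho_integrable \<alpha> \<Omega> m u v w)
  finally show ?thesis unfolding frac_form_def 1 by (simp add: algebra_simps)
qed

lemma frac_form_diag:
  fixes \<Omega> :: "(real ^ 'n::finite) set"
  assumes \<alpha>: "0 < \<alpha>" "\<alpha> < 2" and \<Omega>: "open \<Omega>" and v: "v \<in> sobolev (\<alpha> / 2) \<Omega>"
  shows "frac_form \<alpha> \<Omega> v v = frac_lap_const CARD('n) \<alpha> / 2 * enn2real (slobodeckij_sq (\<alpha> / 2) \<Omega> v)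
    + enn2real (weighted_sq \<alpha> \<Omega> v)"
proof -
  have s: "0 < \<alpha> / 2" "\<alpha> / 2 < 1" using \<alpha> by auto
  have m: "v \<in> borel_measurable (lebesgue_on \<Omega>)" using v sobolev_iff_sq[OF s] by blast
  have "integral\<^sup>L (lebesgue_on \<Omega>) (\<lambda>x. rho \<alpha> \<Omega> x * (v x)\<^sup>2) = enn2real (weighted_sq \<alpha> \<Omega> v)"
    unfolding weighted_sq_def
    by (intro integral_eq_nn_integral borel_measurable_times rho_measurable[OF \<Omega>] borel_measurable_power m AE_I2
        mult_nonneg_nonneg rho_nonneg[OF \<alpha>] zero_le_power2)
  then show ?thesis
    unfolding frac_form_def slobodeckij_integrable(2)[OF \<alpha> v, symmetric]
    by (simp only: mult.assoc power2_eq_square)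
qed

lemma frac_form_equivalent:
  fixes \<Omega> :: "(real ^ 'n::finite) set"
  assumes \<alpha>: "0 < \<alpha>" "\<alpha> < 2" and \<Omega>: "open \<Omega>" "bounded \<Omega>" and eq: "sobolev (\<alpha> / 2) \<Omega> = sobolev_tilde (\<alpha> / 2) \<Omega>"
  shows "\<exists>\<gamma>>0. \<exists>\<Gamma>>0. \<forall>v\<in>sobolev (\<alpha> / 2) \<Omega>.
    \<gamma> * (sobolev_norm (\<alpha> / 2) \<Omega> v)\<^sup>2 \<le> frac_form \<alpha> \<Omega> v v \<and> frac_form \<alpha> \<Omega> v v \<le> \<Gamma> * (sobolev_norm (\<alpha> / 2) \<Omega> v)\<^sup>2"
proof -
  let ?H = "sobolev (\<alpha> / 2) \<Omega>" and ?n = "sobolev_norm (\<alpha> / 2) \<Omega>"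
    and ?S = "sobolev_sq (\<alpha> / 2) \<Omega>" and ?E = "slobodeckij_sq (\<alpha> / 2) \<Omega>"
  have s: "0 < \<alpha> / 2" "\<alpha> / 2 < 1" using \<alpha> by auto
  define c where "c = frac_lap_const CARD('n) \<alpha> / 2"
  have c: "0 < c" unfolding c_def using frac_lap_const_pos[OF \<alpha>, of "CARD('n)"] by simp
  obtain \<mu> where \<mu>: "0 < \<mu>" "\<And>x. x \<in> \<Omega> \<Longrightarrow> \<mu> \<le> rho \<alpha> \<Omega> x" using rho_lower_bound[OF \<alpha> \<Omega>] by blast
  obtain C where C: "0 \<le> C" "\<And>v. v \<in> ?H \<Longrightarrow> weighted_sq \<alpha> \<Omega> v \<le> ennreal C * ?S v"
    using weighted_sq_bounded[OF \<alpha> \<Omega>(1) eq] by blast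
  \<comment> \<open>In the lower constant, \<open>c\<close> serves the seminorm part and \<mu>, the
    lower bound of the weight, the zeroth order part; in the upper one, \<open>C\<close> bounds the
    weighted term.\<close>
  have "min c \<mu> * (?n v)\<^sup>2 \<le> frac_form \<alpha> \<Omega> v v \<and> frac_form \<alpha> \<Omega> v v \<le> (c + C) * (?n v)\<^sup>2"
    if v: "v \<in> ?H" for v
  proof -
    have m: "v \<in> borel_measurable (lebesgue_on \<Omega>)" and f: "?S v < \<infinity>"
      using v sobolev_iff_sq[OF s] by blast+
    define n where "n = (?n v)\<^sup>2"
    define I where "I = (\<integral>\<^sup>+x. ennreal ((v x)\<^sup>2) \<partial>lebesgue_on \<Omega>)"
    define i where "i = enn2real I"
    define e where "e = enn2real (?E v)"
    define w where "w = enn2real (weighted_sq \<alpha> \<Omega> v)"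
    have n: "0 \<le> n" "ennreal n = ?S v" unfolding n_def using sobolev_norm_sq[OF s v] by auto
    have fin: "I < \<infinity>" "?E v < \<infinity>" "weighted_sq \<alpha> \<Omega> v < \<infinity>"
      using f weighted_sq_finite[OF \<alpha> \<Omega>(1)] v eq by (auto simp: sobolev_sq_def I_def)
    have en: "ennreal i = I" "ennreal e = ?E v" "ennreal w = weighted_sq \<alpha> \<Omega> v"
      using fin by (simp_all add: i_def e_def w_def)
    have nn: "0 \<le> i" "0 \<le> e" "0 \<le> w" by (simp_all add: i_def e_def w_def)
    have "ennreal n = ennreal (i + e)" using n(2) en nn by (simp add: sobolev_sq_def I_def)
    then have nie: "n = i + e" using n nn by (subst (asm) ennreal_inj) auto
    have "ennreal w \<le> ennreal (C * n)" using C(2)[OF v] n C(1) en by (simp add: ennreal_mult)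
    then have wC: "w \<le> C * n" using C(1) n(1) by (subst (asm) ennreal_le_iff) auto
    have "ennreal (\<mu> * i) = ennreal \<mu> * I" using \<mu>(1) nn en(1) by (simp add: ennreal_mult)
    also have "\<dots> = (\<integral>\<^sup>+x. ennreal \<mu> * ennreal ((v x)\<^sup>2) \<partial>lebesgue_on \<Omega>)"
      unfolding I_def by (rule nn_integral_cmult[symmetric]) (rule measurable_compose[OF borel_measurable_power[OF m] measurable_ennreal])
    also have "\<dots> \<le> weighted_sq \<alpha> \<Omega> v"
      unfolding weighted_sq_def
    proof (rule nn_integral_mono)
      fix x assume "x \<in> space (lebesgue_on \<Omega>)"
      then have "\<mu> * (v x)\<^sup>2 \<le> rho \<alpha> \<Omega> x * (v x)\<^sup>2" using \<mu>(2) by (intro mult_right_mono) auto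
      then show "ennreal \<mu> * ennreal ((v x)\<^sup>2) \<le> ennreal (rho \<alpha> \<Omega> x * (v x)\<^sup>2)"
        using \<mu>(1) by (simp add: ennreal_leI flip: ennreal_mult)
    qed
    finally have "ennreal (\<mu> * i) \<le> ennreal w" unfolding en(3) .
    then have \<mu>w: "\<mu> * i \<le> w" using nn by (subst (asm) ennreal_le_iff) auto
    have ff: "frac_form \<alpha> \<Omega> v v = c * e + w"
      using frac_form_diag[OF \<alpha> \<Omega>(1) v] by (simp add: c_def e_def w_def)
    have "min c \<mu> * i \<le> \<mu> * i" "min c \<mu> * e \<le> c * e" using nn by (auto intro: mult_right_mono)
    then have "min c \<mu> * n \<le> frac_form \<alpha> \<Omega> v v" unfolding ff nie using \<mu>w by (simp add: distrib_left)
    moreover have "c * e \<le> c * n" using c nn by (simp add: nie)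
    then have "frac_form \<alpha> \<Omega> v v \<le> (c + C) * n" unfolding ff using wC by (simp add: distrib_right)
    ultimately show ?thesis unfolding n_def by blast
  qed
  moreover have "0 < min c \<mu>" "0 < c + C" using c \<mu> C by auto
  ultimately show ?thesis by blast
qed

section \<open>Lipschitz functions, trial functions and the mesh norm\<close>

text \<open>The bound is the interpolation behind the spectral rate: if \<open>S\<close> is
  exponentially small and \<open>L\<close> merely bounded, \<open>S\<^sup>2 + S * L\<close> is still
  exponentially small. The estimates are imposed on \<open>g\<close> at every point of \<Omega>,
  while \<open>v\<close> may be another representative of its class.\<close>

lemma sobolev_Lipschitz:
  fixes \<Omega> :: "(real ^ 'n::finite) set"
  assumes \<alpha>: "0 < \<alpha>" "\<alpha> < 1" and \<Omega>: "open \<Omega>" "bounded \<Omega>"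
  shows "\<exists>K\<ge>0. \<forall>v g S L. v \<in> borel_measurable (lebesgue_on \<Omega>) \<longrightarrow> (AE x in lebesgue_on \<Omega>. v x = g x) \<longrightarrow>
    0 \<le> S \<longrightarrow> 0 \<le> L \<longrightarrow> (\<forall>x\<in>\<Omega>. \<bar>g x\<bar> \<le> S) \<longrightarrow> (\<forall>x\<in>\<Omega>. \<forall>y\<in>\<Omega>. \<bar>g x - g y\<bar> \<le> L * norm (x - y)) \<longrightarrow>
    v \<in> sobolev (\<alpha> / 2) \<Omega> \<and> (sobolev_norm (\<alpha> / 2) \<Omega> v)\<^sup>2 \<le> K * (S\<^sup>2 + S * L)"
proof -
  let ?n = "sobolev_norm (\<alpha> / 2) \<Omega>" and ?H = "sobolev (\<alpha> / 2) \<Omega>" and ?S = "sobolev_sq (\<alpha> / 2) \<Omega>"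
  have s: "0 < \<alpha> / 2" "\<alpha> / 2 < 1" using \<alpha> by auto
  have \<Omega>m: "\<Omega> \<in> sets lebesgue" using \<Omega> by (simp add: borel_open)
  have d: "1 \<le> real CARD('n)" by (simp add: Suc_leI)
  define J where "J = (\<integral>\<^sup>+(x, y). ennreal (norm (x - y) powr (- (real CARD('n) + 2 * (\<alpha> / 2) - 1))) \<partial>(lebesgue_on \<Omega> \<Otimes>\<^sub>M lebesgue_on \<Omega>))"
  have p: "0 \<le> real CARD('n) + 2 * (\<alpha> / 2) - 1" "real CARD('n) + 2 * (\<alpha> / 2) - 1 < real CARD('n)"
    using \<alpha> d by linarith+
  have J: "J < \<infinity>" unfolding J_def by (rule weakly_singular_integral_finite[OF \<Omega>m \<Omega>(2) p])
  define V where "V = emeasure (lebesgue_on \<Omega>) (space (lebesgue_on \<Omega>))"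
  have V: "V < \<infinity>" unfolding V_def by (rule emeasure_lebesgue_on_finite[OF \<Omega>m \<Omega>(2)])
  define K where "K = enn2real V + 2 * enn2real J"
  have "v \<in> ?H \<and> (?n v)\<^sup>2 \<le> K * (S\<^sup>2 + S * L)"
    if m: "v \<in> borel_measurable (lebesgue_on \<Omega>)" and ae: "AE x in lebesgue_on \<Omega>. v x = g x" and S: "0 \<le> S" and L: "0 \<le> L"
      and gS: "\<And>x. x \<in> \<Omega> \<Longrightarrow> \<bar>g x\<bar> \<le> S" and gL: "\<And>x y. x \<in> \<Omega> \<Longrightarrow> y \<in> \<Omega> \<Longrightarrow> \<bar>g x - g y\<bar> \<le> L * norm (x - y)" for v g S L
  proof -
    have "(\<integral>\<^sup>+x. ennreal ((v x)\<^sup>2) \<partial>lebesgue_on \<Omega>) \<le> (\<integral>\<^sup>+x. ennreal (S\<^sup>2) \<partial>lebesgue_on \<Omega>)"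
    proof (rule nn_integral_mono_AE)
      show "AE x in lebesgue_on \<Omega>. ennreal ((v x)\<^sup>2) \<le> ennreal (S\<^sup>2)"
        using ae AE_space[of "lebesgue_on \<Omega>"]
      proof eventually_elim
        case (elim x)
        then have "x \<in> \<Omega>" by simp
        from gS[OF this] have "(g x)\<^sup>2 \<le> S\<^sup>2" using S by (simp add: abs_le_square_iff[symmetric])
        then show ?case unfolding elim(1) by (rule ennreal_leI)
      qed
    qed
    also have "\<dots> = ennreal (S\<^sup>2) * V" by (simp only: nn_integral_const V_def)
    finally have 1: "(\<integral>\<^sup>+x. ennreal ((v x)\<^sup>2) \<partial>lebesgue_on \<Omega>) \<le> ennreal (S\<^sup>2) * V" .
    have 2: "slobodeckij_sq (\<alpha> / 2) \<Omega> v \<le> ennreal (2 * S * L) * J"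
      unfolding J_def by (rule slobodeckij_sq_Lipschitz_bound[OF \<Omega>m ae gS gL S L])
    have "?S v \<le> ennreal (S\<^sup>2) * V + ennreal (2 * S * L) * J"
      unfolding sobolev_sq_def by (rule add_mono[OF 1 2])
    also have "\<dots> = ennreal (S\<^sup>2) * ennreal (enn2real V) + ennreal (2 * S * L) * ennreal (enn2real J)"
      using V J by simp
    also have "\<dots> = ennreal (S\<^sup>2 * enn2real V + 2 * S * L * enn2real J)"
      using S L by (simp add: ennreal_mult)
    also have "\<dots> \<le> ennreal (K * (S\<^sup>2 + S * L))"
    proof (rule ennreal_leI)
      have "0 \<le> 2 * enn2real J * S\<^sup>2" "0 \<le> enn2real V * (S * L)" using S L by auto
      then show "S\<^sup>2 * enn2real V + 2 * S * L * enn2real J \<le> K * (S\<^sup>2 + S * L)"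
        by (simp add: K_def algebra_simps)
    qed
    finally have b: "?S v \<le> ennreal (K * (S\<^sup>2 + S * L))" .
    then have v: "v \<in> ?H"
      unfolding sobolev_iff_sq[OF s] using m le_less_trans[OF b] by simp
    have K0: "0 \<le> K * (S\<^sup>2 + S * L)" using S L by (simp add: K_def)
    have "ennreal ((?n v)\<^sup>2) \<le> ennreal (K * (S\<^sup>2 + S * L))"
      unfolding sobolev_norm_sq[OF s v] by (rule b)
    then show ?thesis using v K0 by (subst (asm) ennreal_le_iff) auto
  qed
  moreover have "0 \<le> K" by (simp add: K_def)
  ultimately show ?thesis by (intro exI[of _ K]) blast
qed

lemma trial_space_subset_sobolev:
  fixes \<Omega> :: "(real ^ 'n::finite) set"
  assumes \<alpha>: "0 < \<alpha>" "\<alpha> < 1" and \<epsilon>: "0 < \<epsilon>" and \<Omega>: "open \<Omega>" "bounded \<Omega>" and X: "finite X" "X \<subseteq> \<Omega>"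
    and v: "v \<in> trial_space \<alpha> \<epsilon> \<Omega> X"
  shows "v \<in> borel_measurable (lebesgue_on \<Omega>)" and "v \<in> sobolev (\<alpha> / 2) \<Omega>"
proof -
  let ?K = "gmq_kernel \<alpha> \<epsilon> :: real ^ 'n \<Rightarrow> real ^ 'n \<Rightarrow> real" and ?L = "gmq_lipschitz \<alpha> \<epsilon> CARD('n)"
    and ?e = "(\<epsilon>\<^sup>2) powr ((\<alpha> - real CARD('n)) / 2)"
  have \<Omega>m: "\<Omega> \<in> sets lebesgue" using \<Omega> by (simp add: borel_open)
  have d: "\<alpha> < real CARD('n)" using \<alpha> by (simp add: less_le_trans[OF \<alpha>(2)] Suc_leI)
  obtain c where c: "\<And>x. x \<in> \<Omega> \<Longrightarrow> v x = (\<Sum>z\<in>X. c z * ?K x z)" using v by (auto simp: trial_space_def)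
  obtain B where B: "0 < B" "\<And>x. x \<in> \<Omega> \<Longrightarrow> norm x \<le> B" using \<Omega> by (auto simp: bounded_pos)
  define g where "g = (\<lambda>x. \<Sum>z\<in>X. c z * ?K x z)"
  have "continuous_on \<Omega> (\<lambda>x. ?K x z)" for z
    unfolding gmq_kernel_def using \<epsilon>
    by (intro continuous_intros) (auto simp: add_nonneg_eq_0_iff)
  then have "continuous_on \<Omega> g" unfolding g_def by (intro continuous_intros)
  then have "continuous_on \<Omega> v" using c by (simp add: g_def cong: continuous_on_cong)
  then show m: "v \<in> borel_measurable (lebesgue_on \<Omega>)" by (rule continuous_imp_measurable_on_sets_lebesgue[OF _ \<Omega>m])
  define S where "S = (\<Sum>z\<in>X. \<bar>c z\<bar> * ?e)"
  \<comment> \<open>Within \<Omega> the squared distances to a node differ by at most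
    \<open>norm (x - y) * (4 * B)\<close>, a product of the difference and the sum of the two
    distances.\<close>
  define L where "L = (\<Sum>z\<in>X. \<bar>c z\<bar> * (?L * (4 * B)))"
  have gS: "\<bar>g x\<bar> \<le> S" for x
    unfolding g_def S_def
  proof (rule order_trans[OF sum_abs], rule sum_mono)
    fix z
    have "?K x z \<le> ?e"
      unfolding gmq_kernel_def using \<epsilon> d by (intro powr_mono2') auto
    moreover have "0 \<le> ?K x z" by (simp add: gmq_kernel_def)
    ultimately show "\<bar>c z * ?K x z\<bar> \<le> \<bar>c z\<bar> * ?e"
      by (simp add: abs_mult mult_left_mono)
  qed
  have gL: "\<bar>g x - g y\<bar> \<le> L * norm (x - y)" if x: "x \<in> \<Omega>" and y: "y \<in> \<Omega>" for x y
  proof -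
    have "g x - g y = (\<Sum>z\<in>X. c z * (?K x z - ?K y z))"
      by (simp add: g_def sum_subtractf right_diff_distrib)
    also have "\<bar>\<dots>\<bar> \<le> (\<Sum>z\<in>X. \<bar>c z\<bar> * (?L * (4 * B)) * norm (x - y))"
    proof (rule order_trans[OF sum_abs], rule sum_mono)
      fix z assume "z \<in> X"
      then have z: "norm z \<le> B" using X B by auto
      have "\<bar>(norm (x - z))\<^sup>2 - (norm (y - z))\<^sup>2\<bar> = \<bar>norm (x - z) - norm (y - z)\<bar> * (norm (x - z) + norm (y - z))"
        by (simp add: power2_eq_square square_diff_square_factored abs_mult mult.commute)
      also have "\<dots> \<le> norm (x - y) * (4 * B)"
      proof (rule mult_mono)
        show "\<bar>norm (x - z) - norm (y - z)\<bar> \<le> norm (x - y)" using norm_triangle_ineq3[of "x - z" "y - z"] by simp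
        show "norm (x - z) + norm (y - z) \<le> 4 * B"
          using norm_triangle_ineq4[of x z] norm_triangle_ineq4[of y z] B(2)[OF x] B(2)[OF y] z by linarith
      qed auto
      finally have "?L * \<bar>(norm (x - z))\<^sup>2 - (norm (y - z))\<^sup>2\<bar> \<le> ?L * (norm (x - y) * (4 * B))"
        by (rule mult_left_mono) (rule gmq_lipschitz_nonneg)
      then have "\<bar>?K x z - ?K y z\<bar> \<le> ?L * (4 * B) * norm (x - y)"
        using gmq_kernel_lipschitz[OF \<epsilon> d, of x z y] by (simp add: mult_ac)
      then have "\<bar>c z\<bar> * \<bar>?K x z - ?K y z\<bar> \<le> \<bar>c z\<bar> * (?L * (4 * B) * norm (x - y))"
        by (rule mult_left_mono) simp
      then show "\<bar>c z * (?K x z - ?K y z)\<bar> \<le> \<bar>c z\<bar> * (?L * (4 * B)) * norm (x - y)"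
        by (simp only: abs_mult mult.assoc)
    qed
    also have "\<dots> = L * norm (x - y)" by (simp add: L_def sum_distrib_right)
    finally show ?thesis .
  qed
  have S0: "0 \<le> S" unfolding S_def by (intro sum_nonneg) simp
  have L0: "0 \<le> L" unfolding L_def using B(1) gmq_lipschitz_nonneg by (intro sum_nonneg) simp
  have "AE x in lebesgue_on \<Omega>. v x = g x" by (rule AE_I2) (simp add: c g_def)
  then show "v \<in> sobolev (\<alpha> / 2) \<Omega>"
    using sobolev_Lipschitz[OF \<alpha> \<Omega>]
  proof (elim exE conjE, goal_cases)
    case (1 K)
    from 1(3)[rule_format, OF m 1(1) S0 L0 gS gL] show ?case by (rule conjunct1)
  qed
qed

lemma trial_space_diff:
  assumes "u \<in> trial_space \<alpha> \<epsilon> \<Omega> X" "v \<in> trial_space \<alpha> \<epsilon> \<Omega> X"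
  shows "(\<lambda>x. u x - v x) \<in> trial_space \<alpha> \<epsilon> \<Omega> X"
proof -
  obtain b c where "\<forall>x\<in>\<Omega>. u x = (\<Sum>z\<in>X. b z * gmq_kernel \<alpha> \<epsilon> x z)" "\<forall>x\<in>\<Omega>. v x = (\<Sum>z\<in>X. c z * gmq_kernel \<alpha> \<epsilon> x z)"
    using assms by (auto simp: trial_space_def)
  then have "\<forall>x\<in>\<Omega>. u x - v x = (\<Sum>z\<in>X. (b z - c z) * gmq_kernel \<alpha> \<epsilon> x z)"
    by (simp add: left_diff_distrib sum_subtractf)
  then show ?thesis unfolding trial_space_def by (intro CollectI exI[of _ "\<lambda>z. b z - c z"])
qed

lemma trial_space_nonempty: "trial_space \<alpha> \<epsilon> \<Omega> X \<noteq> {}"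
  unfolding trial_space_def by auto

text \<open>The supremum is taken in the reals, so boundedness of \<Omega> is what makes it an upper
  bound of the distances.\<close>

lemma mesh_norm_dense:
  assumes "bounded \<Omega>" "finite X" "X \<noteq> {}" "x \<in> \<Omega>"
  shows "\<exists>z\<in>X. norm (x - z) \<le> mesh_norm \<Omega> X"
proof -
  obtain B where B: "\<And>x. x \<in> \<Omega> \<Longrightarrow> norm x \<le> B" using assms by (auto simp: bounded_iff)
  obtain z0 where z0: "z0 \<in> X" using assms by blast
  have "Min ((\<lambda>z. norm (y - z)) ` X) \<le> B + norm z0" if "y \<in> \<Omega>" for y
  proof -
    have "Min ((\<lambda>z. norm (y - z)) ` X) \<le> norm (y - z0)" using assms z0 by (intro Min_le) auto
    then show ?thesis using norm_triangle_ineq4[of y z0] B[OF that] by linarith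
  qed
  then have "bdd_above ((\<lambda>y. Min ((\<lambda>z. norm (y - z)) ` X)) ` \<Omega>)" by (intro bdd_aboveI[of _ "B + norm z0"]) auto
  then have "Min ((\<lambda>z. norm (x - z)) ` X) \<le> mesh_norm \<Omega> X"
    unfolding mesh_norm_def by (intro cSUP_upper assms(4))
  moreover have "Min ((\<lambda>z. norm (x - z)) ` X) \<in> (\<lambda>z. norm (x - z)) ` X" using assms by (intro Min_in) auto
  ultimately show ?thesis by auto
qed

text \<open>A nonempty open set is infinite, so a finite set of nodes misses one of its points.
  Hence the division in \<open>- c / h\<close> is a genuine one.\<close>

lemma mesh_norm_pos:
  fixes \<Omega> :: "(real ^ 'n::finite) set"
  assumes "open \<Omega>" "bounded \<Omega>" "\<Omega> \<noteq> {}" "finite X" "X \<noteq> {}"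
  shows "0 < mesh_norm \<Omega> X"
proof -
  have "infinite \<Omega>" using finite_imp_not_open[of \<Omega>] assms(1,3) by blast
  then have "\<not> \<Omega> \<subseteq> X" using finite_subset[OF _ assms(4)] by blast
  then obtain x where x: "x \<in> \<Omega>" "x \<notin> X" by blast
  then obtain z where "z \<in> X" "norm (x - z) \<le> mesh_norm \<Omega> X" using mesh_norm_dense[OF assms(2,4,5)] by blast
  moreover have "0 < norm (x - z)" using x \<open>z \<in> X\<close> by auto
  ultimately show ?thesis by linarith
qed


section \<open>Quasi-optimality and spectral convergence\<close>

text \<open>Since the form is symmetric, orthogonality gives Pythagoras for
  \<open>z = e + w\<close>: the energy of \<open>u - v\<close> is that of the Galerkin error plus
  that of \<open>uN - v\<close>. This yields the factor \<open>sqrt (\<Gamma> / \<gamma>)\<close>,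
  the square root of the ratio of the energy constants.\<close>

lemma galerkin_quasi_optimal:
  fixes \<Omega> :: "(real ^ 'n::finite) set"
  assumes \<alpha>: "0 < \<alpha>" "\<alpha> < 2" and \<Omega>: "open \<Omega>" and eq: "sobolev (\<alpha> / 2) \<Omega> = sobolev_tilde (\<alpha> / 2) \<Omega>"
    and \<gamma>: "0 < \<gamma>" and \<Gamma>: "0 < \<Gamma>"
    and lower: "\<And>v. v \<in> sobolev (\<alpha> / 2) \<Omega> \<Longrightarrow> \<gamma> * (sobolev_norm (\<alpha> / 2) \<Omega> v)\<^sup>2 \<le> frac_form \<alpha> \<Omega> v v"
    and upper: "\<And>v. v \<in> sobolev (\<alpha> / 2) \<Omega> \<Longrightarrow> frac_form \<alpha> \<Omega> v v \<le> \<Gamma> * (sobolev_norm (\<alpha> / 2) \<Omega> v)\<^sup>2"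
    and u: "u \<in> sobolev (\<alpha> / 2) \<Omega>" and V: "V \<subseteq> sobolev (\<alpha> / 2) \<Omega>" "\<And>v w. v \<in> V \<Longrightarrow> w \<in> V \<Longrightarrow> (\<lambda>x. v x - w x) \<in> V"
    and uN: "uN \<in> V" and orth: "\<And>v. v \<in> V \<Longrightarrow> frac_form \<alpha> \<Omega> u v = frac_form \<alpha> \<Omega> uN v" and v: "v \<in> V"
  shows "sobolev_norm (\<alpha> / 2) \<Omega> (\<lambda>x. u x - uN x) \<le> sqrt (\<Gamma> / \<gamma>) * sobolev_norm (\<alpha> / 2) \<Omega> (\<lambda>x. u x - v x)"
proof -
  let ?a = "frac_form \<alpha> \<Omega>" and ?H = "sobolev (\<alpha> / 2) \<Omega>" and ?n = "sobolev_norm (\<alpha> / 2) \<Omega>"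
  have s: "0 < \<alpha> / 2" "\<alpha> / 2 < 1" using \<alpha> by auto
  note df = frac_form_diff[OF \<alpha> \<Omega> eq]
  define e where "e = (\<lambda>x. u x - uN x)"
  define z where "z = (\<lambda>x. u x - v x)"
  define w where "w = (\<lambda>x. uN x - v x)"
  have vH: "v \<in> ?H" and uNH: "uN \<in> ?H" using v uN V by auto
  have wV: "w \<in> V" unfolding w_def by (rule V(2)[OF uN v])
  then have wH: "w \<in> ?H" using V by auto
  have eH: "e \<in> ?H" and zH: "z \<in> ?H" unfolding e_def z_def by (intro sobolev_diff[OF s] u uNH vH)+
  have ze: "w = (\<lambda>x. z x - e x)" by (simp add: w_def z_def e_def)
  have ew: "?a e w = 0" unfolding e_def df[OF u uNH wH] using orth[OF wV] by simp
  have "?a w w = ?a z w - ?a e w" by (subst (1) ze) (rule df[OF zH eH wH])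
  also have "?a z w = ?a w z" by (rule frac_form_commute)
  also have "?a w z = ?a z z - ?a e z" by (subst ze) (rule df[OF zH eH zH])
  also have "?a e z = ?a e e"
  proof -
    have "?a w e = ?a z e - ?a e e" by (subst ze) (rule df[OF zH eH eH])
    moreover have "?a w e = 0" using ew by (simp only: frac_form_commute[of \<alpha> \<Omega> w])
    ultimately show ?thesis by (simp add: frac_form_commute[of \<alpha> \<Omega> e z])
  qed
  finally have "?a z z = ?a e e + ?a w w" using ew by simp
  moreover have "0 \<le> ?a w w" using order_trans[OF _ lower[OF wH]] \<gamma> by simp
  ultimately have "\<gamma> * (?n e)\<^sup>2 \<le> \<Gamma> * (?n z)\<^sup>2" using lower[OF eH] upper[OF zH] by linarith
  then have "(?n e)\<^sup>2 \<le> \<Gamma> / \<gamma> * (?n z)\<^sup>2" using \<gamma> by (simp add: field_simps)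
  then have "sqrt ((?n e)\<^sup>2) \<le> sqrt (\<Gamma> / \<gamma> * (?n z)\<^sup>2)" by (rule real_sqrt_le_mono)
  then show ?thesis
    by (simp add: real_sqrt_mult real_sqrt_divide e_def z_def abs_of_nonneg[OF sobolev_norm_nonneg])
qed

text \<open>The interpolant itself is the competitor in the infimum. Its squared error is at most
  \<open>K' * exp (- c / h)\<close> times the squared native norm. The square root halves the rate,
  and a further halving to \<open>c / 4\<close> absorbs the constant.\<close>

lemma gmq_spectral_convergence:
  fixes \<Omega> :: "(real ^ 'n::finite) set"
  assumes \<alpha>: "0 < \<alpha>" "\<alpha> < 1" and \<epsilon>: "0 < \<epsilon>" and \<Omega>: "open \<Omega>" "bounded \<Omega>" "\<Omega> \<noteq> {}"
    and u: "u \<in> borel_measurable (lebesgue_on \<Omega>)" and R: "is_rkhs \<Omega> (gmq_kernel \<alpha> \<epsilon>) \<N> ip"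
    and g: "g \<in> \<N>" and ug: "AE x in lebesgue_on \<Omega>. u x = g x"
  shows "\<exists>c>0. \<exists>h\<^sub>0>0. \<forall>X. finite X \<and> X \<noteq> {} \<and> X \<subseteq> \<Omega> \<longrightarrow> mesh_norm \<Omega> X \<le> h\<^sub>0 \<longrightarrow>
    (INF v\<in>trial_space \<alpha> \<epsilon> \<Omega> X. sobolev_norm (\<alpha> / 2) \<Omega> (\<lambda>x. u x - v x)) \<le> exp (- c / mesh_norm \<Omega> X) * ip_norm ip g"
proof -
  let ?n = "sobolev_norm (\<alpha> / 2) \<Omega>" and ?V = "trial_space \<alpha> \<epsilon> \<Omega>"
  have d: "\<alpha> < real CARD('n)" using \<alpha> by (simp add: less_le_trans[OF \<alpha>(2)] Suc_leI)
  obtain C c h1 where C: "0 \<le> C" and c: "0 < c" and h1: "0 < h1"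
    and small: "\<forall>H ip X h. is_rkhs \<Omega> (gmq_kernel \<alpha> \<epsilon>) H ip \<longrightarrow> finite X \<longrightarrow> X \<subseteq> \<Omega> \<longrightarrow>
      0 < h \<longrightarrow> h \<le> h1 \<longrightarrow> (\<forall>x\<in>\<Omega>. \<exists>z\<in>X. norm (x - z) \<le> h) \<longrightarrow>
      (\<forall>g\<in>H. (\<forall>z\<in>X. g z = 0) \<longrightarrow> (\<forall>x\<in>\<Omega>. \<bar>g x\<bar> \<le> C * exp (- c / h) * ip_norm ip g))"
    using gmq_rkhs_small[OF \<epsilon> d \<Omega>] by (elim exE conjE) (rule that)
  obtain K where K: "0 \<le> K" and bound: "\<forall>v g S L. v \<in> borel_measurable (lebesgue_on \<Omega>) \<longrightarrow> (AE x in lebesgue_on \<Omega>. v x = g x) \<longrightarrow>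
    0 \<le> S \<longrightarrow> 0 \<le> L \<longrightarrow> (\<forall>x\<in>\<Omega>. \<bar>g x\<bar> \<le> S) \<longrightarrow> (\<forall>x\<in>\<Omega>. \<forall>y\<in>\<Omega>. \<bar>g x - g y\<bar> \<le> L * norm (x - y)) \<longrightarrow>
    v \<in> sobolev (\<alpha> / 2) \<Omega> \<and> (?n v)\<^sup>2 \<le> K * (S\<^sup>2 + S * L)"
    using sobolev_Lipschitz[OF \<alpha> \<Omega>(1,2)] by (elim exE conjE) (rule that)
  define l where "l = sqrt (2 * gmq_lipschitz \<alpha> \<epsilon> CARD('n))"
  have l: "0 \<le> l" by (simp add: l_def gmq_lipschitz_nonneg)
  define K' where "K' = K * (C\<^sup>2 + C * l)"
  have K': "0 \<le> K'" using K C l by (simp add: K'_def)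
  \<comment> \<open>For \<open>h \<le> h0\<close> the constant satisfies
    \<open>K' \<le> c / (2 * h) \<le> exp (c / (2 * h))\<close>, so half of the exponential decay
    pays for it. The summand 1 keeps the denominator positive when \<open>K' = 0\<close>.\<close>
  define h0 where "h0 = min h1 (c / (4 * (1 + K')))"
  have h0: "0 < h0" using h1 c K' by (simp add: h0_def)
  define G where "G = ip_norm ip g"
  have G: "0 \<le> G" unfolding G_def ip_norm_def using is_rkhs_ip(4)[OF R g] by simp
  have "(INF v\<in>?V X. ?n (\<lambda>x. u x - v x)) \<le> exp (- (c / 4) / mesh_norm \<Omega> X) * G"
    if X: "finite X" "X \<noteq> {}" "X \<subseteq> \<Omega>" and hX: "mesh_norm \<Omega> X \<le> h0" for X
  proof -
    let ?P = "\<lambda>b. zero_ext \<Omega> (\<lambda>x. \<Sum>z\<in>X. b z * gmq_kernel \<alpha> \<epsilon> x z)"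
    define h where "h = mesh_norm \<Omega> X"
    have h: "0 < h" unfolding h_def by (rule mesh_norm_pos[OF \<Omega> X(1,2)])
    have h_le: "h \<le> h1" "h \<le> c / (4 * (1 + K'))" using hX by (auto simp: h_def h0_def)
    obtain b where "(\<lambda>x. g x - ?P b x) \<in> \<N> \<and>
        (\<forall>z\<in>X. g z - ?P b z = 0) \<and>
        ip_norm ip (\<lambda>x. g x - ?P b x) \<le> G"
      using is_rkhs_interpolation_residual[OF R X(1,3) g, folded G_def] by (elim exE) (rule that)
    then obtain p where p: "p = ?P b"
      and r: "(\<lambda>x. g x - p x) \<in> \<N>" "\<forall>z\<in>X. g z - p z = 0" "ip_norm ip (\<lambda>x. g x - p x) \<le> G" by simp
    have pV: "p \<in> ?V X"
      unfolding trial_space_def p by (intro CollectI exI[of _ b]) (simp add: zero_ext_def)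
    define E where "E = exp (- c / h)"
    have E: "0 < E" "E \<le> 1" using c h by (auto simp: E_def)
    have dense: "\<forall>x\<in>\<Omega>. \<exists>z\<in>X. norm (x - z) \<le> h"
      unfolding h_def using mesh_norm_dense[OF \<Omega>(2) X(1,2)] by blast
    have rS: "\<bar>g x - p x\<bar> \<le> C * E * G" if "x \<in> \<Omega>" for x
    proof -
      have "\<bar>g x - p x\<bar> \<le> C * E * ip_norm ip (\<lambda>x. g x - p x)"
        using small[rule_format, OF R X(1,3) h h_le(1) _ r(1) _ that] dense r(2) unfolding E_def by blast
      also have "\<dots> \<le> C * E * G" using r(3) C E by (intro mult_left_mono) auto
      finally show ?thesis .
    qed
    have rL: "\<bar>g x - p x - (g y - p y)\<bar> \<le> l * G * norm (x - y)" if "x \<in> \<Omega>" "y \<in> \<Omega>" for x y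
    proof -
      have "\<bar>g x - p x - (g y - p y)\<bar> \<le> l * ip_norm ip (\<lambda>x. g x - p x) * norm (x - y)"
        unfolding l_def by (rule gmq_rkhs_lipschitz[OF \<epsilon> d R r(1) that])
      also have "\<dots> \<le> l * G * norm (x - y)" using r(3) l by (intro mult_right_mono mult_left_mono) auto
      finally show ?thesis .
    qed
    have m: "(\<lambda>x. u x - p x) \<in> borel_measurable (lebesgue_on \<Omega>)"
      by (intro borel_measurable_diff u trial_space_subset_sobolev(1)[OF \<alpha> \<epsilon> \<Omega>(1,2) X(1,3) pV])
    have ae: "AE x in lebesgue_on \<Omega>. u x - p x = g x - p x" using ug by eventually_elim simp
    have S0: "0 \<le> C * E * G" "0 \<le> l * G" using C E G l by auto
    have "(?n (\<lambda>x. u x - p x))\<^sup>2 \<le> K * ((C * E * G)\<^sup>2 + (C * E * G) * (l * G))"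
      using bound[rule_format, OF m ae S0 rS rL] by (rule conjunct2)
    also have "\<dots> \<le> K' * E * G\<^sup>2"
    proof -
      \<comment> \<open>\<open>E \<le> 1\<close> reduces the quadratic term to the order of the
        mixed term \<open>S * L\<close>, which decides the rate.\<close>
      have "C\<^sup>2 * (E * E) \<le> C\<^sup>2 * (E * 1)" using E by (intro mult_left_mono) auto
      then have "K * ((C\<^sup>2 * (E * E) + C * l * E) * G\<^sup>2) \<le> K * ((C\<^sup>2 * (E * 1) + C * l * E) * G\<^sup>2)"
        using K by (intro mult_left_mono mult_right_mono) auto
      then show ?thesis by (simp add: K'_def power2_eq_square algebra_simps)
    qed
    finally have "sqrt ((?n (\<lambda>x. u x - p x))\<^sup>2) \<le> sqrt (K' * E * G\<^sup>2)"
      by (rule real_sqrt_le_mono)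
    then have "?n (\<lambda>x. u x - p x) \<le> sqrt (K' * E) * G"
      using sobolev_norm_nonneg[of "\<alpha> / 2" \<Omega> "\<lambda>x. u x - p x"] G by (simp add: real_sqrt_mult)
    also have "sqrt (K' * E) \<le> exp (- (c / 4) / h)"
    proof (rule real_le_lsqrt)
      have "4 * (1 + K') * h \<le> c" using h_le(2) K' by (simp add: field_simps)
      moreover have "4 * (1 + K') * h = 4 * h + 4 * (K' * h)" "0 \<le> K' * h" using h K' by (simp_all add: algebra_simps)
      ultimately have "2 * (K' * h) \<le> c" using h by linarith
      then have "K' \<le> c / (2 * h)" using h by (simp add: field_simps)
      also have "\<dots> \<le> exp (c / (2 * h))" using exp_ge_add_one_self[of "c / (2 * h)"] by linarith
      finally have "K' * E \<le> exp (c / (2 * h)) * E" using E by (intro mult_right_mono) auto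
      also have "\<dots> = (exp (- (c / 4) / h))\<^sup>2"
        using h by (simp add: E_def power2_eq_square field_simps flip: exp_add)
      finally show "K' * E \<le> (exp (- (c / 4) / h))\<^sup>2" .
    qed (use K' E in auto)
    then have "sqrt (K' * E) * G \<le> exp (- (c / 4) / h) * G" using G by (rule mult_right_mono)
    finally have "?n (\<lambda>x. u x - p x) \<le> exp (- (c / 4) / h) * G" .
    moreover have "(INF v\<in>?V X. ?n (\<lambda>x. u x - v x)) \<le> ?n (\<lambda>x. u x - p x)"
      by (rule cINF_lower[OF _ pV]) (intro bdd_belowI[of _ 0], use sobolev_norm_nonneg in auto)
    ultimately show ?thesis unfolding h_def by linarith
  qed
  then show ?thesis using c h0 unfolding G_def by (intro exI[of _ "c / 4"] conjI exI[of _ h0]) auto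
qed

theorem theorem3p4:
  fixes \<Omega> :: "(real ^ 'n::finite) set"
    and \<alpha> \<epsilon> :: real
    and f :: "(real ^ 'n \<Rightarrow> real) \<Rightarrow> real"
    and u :: "real ^ 'n \<Rightarrow> real"
    and \<X> :: "(real ^ 'n) set set"
    and uN :: "(real ^ 'n) set \<Rightarrow> real ^ 'n \<Rightarrow> real"
  assumes "0 < \<alpha>" and "\<alpha> < 1" and "0 < \<epsilon>"
    and "open \<Omega>" and "bounded \<Omega>" and "\<Omega> \<noteq> {}"
    and "sobolev (\<alpha> / 2) \<Omega> = sobolev_tilde (\<alpha> / 2) \<Omega>"
    and "f \<in> sobolev_dual (\<alpha> / 2) \<Omega>"
    and "u \<in> sobolev_tilde (\<alpha> / 2) \<Omega>"
    and "\<forall>v\<in>sobolev_tilde (\<alpha> / 2) \<Omega>. frac_form \<alpha> \<Omega> u v = f v"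
    and "\<forall>X\<in>\<X>. finite X \<and> X \<noteq> {} \<and> X \<subseteq> \<Omega>"
    and "\<forall>X\<in>\<X>. uN X \<in> trial_space \<alpha> \<epsilon> \<Omega> X \<and>
           (\<forall>v\<in>trial_space \<alpha> \<epsilon> \<Omega> X. frac_form \<alpha> \<Omega> (uN X) v = f v)"
  shows "(\<forall>s\<ge>0. u \<in> sobolev s \<Omega> \<longrightarrow>
            (\<exists>C\<^sub>0. \<forall>X\<in>\<X>.
               (INF v\<in>trial_space \<alpha> \<epsilon> \<Omega> X. sobolev_norm (\<alpha> / 2) \<Omega> (\<lambda>x. u x - v x))
                 \<le> C\<^sub>0 * mesh_norm \<Omega> X powr (s - \<alpha> / 2) * sobolev_norm s \<Omega> u) \<longrightarrow>
            (\<exists>C. \<forall>X\<in>\<X>.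
               sobolev_norm (\<alpha> / 2) \<Omega> (\<lambda>x. u x - uN X x)
                 \<le> C * mesh_norm \<Omega> X powr (s - \<alpha> / 2) * sobolev_norm s \<Omega> u)) \<and>
         (\<forall>\<N> ip. is_rkhs \<Omega> (gmq_kernel \<alpha> \<epsilon>) \<N> ip \<longrightarrow>
            (\<forall>g\<in>\<N>. (AE x in lebesgue_on \<Omega>. u x = g x) \<longrightarrow>
              (\<exists>c>0. \<exists>h\<^sub>0>0. \<forall>X\<in>\<X>. mesh_norm \<Omega> X \<le> h\<^sub>0 \<longrightarrow>
                 (INF v\<in>trial_space \<alpha> \<epsilon> \<Omega> X. sobolev_norm (\<alpha> / 2) \<Omega> (\<lambda>x. u x - v x))
                   \<le> exp (- c / mesh_norm \<Omega> X) * ip_norm ip g)))"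
proof -
  let ?n = "sobolev_norm (\<alpha> / 2) \<Omega>" and ?V = "trial_space \<alpha> \<epsilon> \<Omega>" and ?h = "mesh_norm \<Omega>"
  have \<alpha>: "0 < \<alpha>" "\<alpha> < 1" "\<alpha> < 2" and s: "0 < \<alpha> / 2" "\<alpha> / 2 < 1" using assms(1,2) by auto
  note \<epsilon> = assms(3) and \<Omega> = assms(4,5,6) and eq = assms(7) and X = assms(11)
  have u: "u \<in> sobolev (\<alpha> / 2) \<Omega>" using assms(9) eq by simp
  then have um: "u \<in> borel_measurable (lebesgue_on \<Omega>)" by (simp only: sobolev_iff_sq[OF s])
  obtain \<gamma> \<Gamma> where \<gamma>: "0 < \<gamma>" "0 < \<Gamma>"
    and equiv: "\<forall>v\<in>sobolev (\<alpha> / 2) \<Omega>. \<gamma> * (?n v)\<^sup>2 \<le> frac_form \<alpha> \<Omega> v v \<and>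
      frac_form \<alpha> \<Omega> v v \<le> \<Gamma> * (?n v)\<^sup>2"
    using frac_form_equivalent[OF \<alpha>(1,3) \<Omega>(1,2) eq] by (elim exE conjE) (rule that)
  note lower = conjunct1[OF bspec[OF equiv]] and upper = conjunct2[OF bspec[OF equiv]]
  define K where "K = sqrt (\<Gamma> / \<gamma>)"
  have K: "0 < K" using \<gamma> by (simp add: K_def)
  define I where "I = (\<lambda>X. INF v\<in>?V X. ?n (\<lambda>x. u x - v x))"
  have cea: "?n (\<lambda>x. u x - uN X x) \<le> K * I X" if "X \<in> \<X>" for X
  proof -
    have XX: "finite X" "X \<subseteq> \<Omega>" using bspec[OF assms(11) that] by simp_all
    have V: "?V X \<subseteq> sobolev (\<alpha> / 2) \<Omega>"
      by (intro subsetI trial_space_subset_sobolev(2)[OF \<alpha>(1,2) \<epsilon> \<Omega>(1,2) XX])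
    have uN: "uN X \<in> ?V X" by (rule conjunct1[OF bspec[OF assms(12) that]])
    have orth: "frac_form \<alpha> \<Omega> u v = frac_form \<alpha> \<Omega> (uN X) v" if "v \<in> ?V X" for v
    proof -
      \<comment> \<open>Trial functions need not vanish at the boundary; the equality of the two
        spaces makes them admissible in the weak formulation, so both equations can be tested with
        \<open>v\<close>.\<close>
      have "v \<in> sobolev_tilde (\<alpha> / 2) \<Omega>" unfolding eq[symmetric] by (rule subsetD[OF V that])
      with assms(10) have "frac_form \<alpha> \<Omega> u v = f v" by (rule bspec)
      moreover have "frac_form \<alpha> \<Omega> (uN X) v = f v"
        by (rule bspec[OF conjunct2[OF bspec[OF assms(12) \<open>X \<in> \<X>\<close>]] that])
      ultimately show ?thesis by simp
    qed
    \<comment> \<open>Quasi-optimality holds against every trial function, so dividing by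
      \<open>K\<close> gives a lower bound of the infimum, attained or not.\<close>
    have "?n (\<lambda>x. u x - uN X x) / K \<le> I X"
      unfolding I_def
    proof (rule cINF_greatest[OF trial_space_nonempty])
      fix v assume v: "v \<in> ?V X"
      have "?n (\<lambda>x. u x - uN X x) \<le> sqrt (\<Gamma> / \<gamma>) * ?n (\<lambda>x. u x - v x)"
        by (rule galerkin_quasi_optimal[where V="?V X", OF \<alpha>(1,3) \<Omega>(1) eq \<gamma> _ _ u V _ uN _ v])
          (fact lower upper trial_space_diff orth)+
      then show "?n (\<lambda>x. u x - uN X x) / K \<le> ?n (\<lambda>x. u x - v x)"
        unfolding K_def[symmetric] using K by (simp add: pos_divide_le_eq mult.commute)
    qed
    then show ?thesis using K by (simp add: pos_divide_le_eq mult.commute)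
  qed
  have part1: "\<exists>C. \<forall>X\<in>\<X>. ?n (\<lambda>x. u x - uN X x)
      \<le> C * ?h X powr (s - \<alpha> / 2) * sobolev_norm s \<Omega> u"
    if C0: "\<forall>X\<in>\<X>. I X \<le> C\<^sub>0 * ?h X powr (s - \<alpha> / 2) * sobolev_norm s \<Omega> u" for s C\<^sub>0
  proof (intro exI ballI)
    fix X assume X: "X \<in> \<X>"
    have "?n (\<lambda>x. u x - uN X x) \<le> K * I X" by (rule cea[OF X])
    also have "\<dots> \<le> K * (C\<^sub>0 * ?h X powr (s - \<alpha> / 2) * sobolev_norm s \<Omega> u)"
      using C0 X K by (intro mult_left_mono) auto
    \<comment> \<open>The new constant is \<open>K * C\<^sub>0\<close>, where \<open>K\<close>
      depends only on the energy constants and is the same for every \<open>X\<close> and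
      \<open>s\<close>.\<close>
    finally show "?n (\<lambda>x. u x - uN X x)
        \<le> (K * C\<^sub>0) * ?h X powr (s - \<alpha> / 2) * sobolev_norm s \<Omega> u" by (simp only: mult.assoc)
  qed
  show ?thesis
  proof (intro conjI allI impI ballI)
    fix s
    assume "\<exists>C\<^sub>0. \<forall>X\<in>\<X>. (INF v\<in>?V X. ?n (\<lambda>x. u x - v x))
        \<le> C\<^sub>0 * ?h X powr (s - \<alpha> / 2) * sobolev_norm s \<Omega> u"
    then show "\<exists>C. \<forall>X\<in>\<X>. ?n (\<lambda>x. u x - uN X x)
        \<le> C * ?h X powr (s - \<alpha> / 2) * sobolev_norm s \<Omega> u"
      by (elim exE) (rule part1[unfolded I_def])
  next
    fix \<N> ip g
    assume R: "is_rkhs \<Omega> (gmq_kernel \<alpha> \<epsilon>) \<N> ip" and g: "g \<in> \<N>" and ug: "AE x in lebesgue_on \<Omega>. u x = g x"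
    obtain c h\<^sub>0 where "0 < c" "0 < h\<^sub>0" and main: "\<forall>X. finite X \<and> X \<noteq> {} \<and> X \<subseteq> \<Omega> \<longrightarrow> ?h X \<le> h\<^sub>0 \<longrightarrow>
        I X \<le> exp (- c / ?h X) * ip_norm ip g"
      using gmq_spectral_convergence[OF \<alpha>(1,2) \<epsilon> \<Omega> um R g ug]
      by (elim exE conjE) (rule that[unfolded I_def], assumption, assumption, assumption)
    then have "\<forall>X\<in>\<X>. ?h X \<le> h\<^sub>0 \<longrightarrow> I X \<le> exp (- c / ?h X) * ip_norm ip g"
      using X by blast
    then have main': "\<forall>X\<in>\<X>. ?h X \<le> h\<^sub>0 \<longrightarrow>
        (INF v\<in>?V X. ?n (\<lambda>x. u x - v x)) \<le> exp (- c / ?h X) * ip_norm ip g"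
      unfolding I_def .
    show "\<exists>c>0. \<exists>h\<^sub>0>0. \<forall>X\<in>\<X>. ?h X \<le> h\<^sub>0 \<longrightarrow>
        (INF v\<in>?V X. ?n (\<lambda>x. u x - v x)) \<le> exp (- c / ?h X) * ip_norm ip g"
      by (rule exI[where x=c], rule conjI[OF \<open>0 < c\<close>], rule exI[where x="h\<^sub>0"], rule conjI[OF \<open>0 < h\<^sub>0\<close> main'])
  qed
qed

end
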